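(* Let $\Phi$ be a local interaction on $V$ satisfying the Commuting Hypothesis, let $\mathbf b:\mathcal P_f(V)\to[0,\infty)$ be subadditive with $$\|\Phi\|_{\mathbf b}:=\sup_{x\in V}\sum_{X\ni x}\|\Phi_X\|\,e^{\mathbf b(X)}<\infty,$$ and suppose the system has finite degree $\mathfrak d\in\mathbb N$. Then for every real $\beta$ with $|\beta|<\frac{1}{\mathfrak d(1+\mathfrak d)e^2\|\Phi\|_{\mathbf b}}$ and every $L\subset V$ there exists a local interaction $\widetilde\Phi^{L,\beta}$ on $V$ such that: (i) $\widetilde\Phi^{L,\beta}_X$ is supported in $X\cap L$ for every finite $X$; (ii) if $L'\subset V$, then $\widetilde\Phi^{L,\beta}_X=\widetilde\Phi^{L',\beta}_X$ for every finite $X$ with $X\cap L'=X\cap L$; (iii) for every finite $\Lambda\subset V$, $\log\mathbb E_L[e^{-\beta H_\Lambda}]=\sum_{X\subset\Lambda}\widetilde\Phi^{L,\beta}_X$; and moreover $\sup_{x\in V}\sum_{X\ni x}\|\widetilde\Phi^{L,\beta}_X\|\,e^{\mathbf b(X)}\le 1$.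
   Context: $V$ is a set with a metric; $\mathcal P_f(V)$ denotes the finite subsets of $V$. Each site carries $\mathbb C^D$; for finite $X$, $\mathfrak A_X=\mathcal B(\bigotimes_{v\in X}\mathbb C^D)$, embedded in $\mathfrak A_Y$ for $X\subset Y$ via $Q\mapsto Q\otimes\mathbb 1$; $\mathfrak A_{loc}=\bigcup_X\mathfrak A_X$. A local interaction is a family $(\Phi_X)_{X\in\mathcal P_f(V)}$ with $\Phi_X=\Phi_X^*\in\mathfrak A_X$; $H_\Lambda=\sum_{X\subset\Lambda}\Phi_X$. For $L\subset V$ and $Q\in\mathfrak A_\Lambda$, $\mathbb E_L[Q]=D^{-|\Lambda\setminus L|}\operatorname{tr}_{\Lambda\setminus L}(Q)\otimes\mathbb 1_{\Lambda\setminus L}$ (normalized partial trace over sites outside $L$). $\log$ is the self-adjoint logarithm of a positive definite operator. Subadditive: $\mathbf b(X\cup Y)\le\mathbf b(X)+\mathbf b(Y)$. Commuting Hypothesis: there is a commutative algebra $\mathcal A\subset\mathfrak A_{loc}$ with $\Phi_X\in\mathcal A$ for all $X$ and $\mathbb E_L[\mathcal A]\subset\mathcal A$ for every $L\subset V$. Let $\mathcal S=\{X\in\mathcal P_f(V):\Phi_X\neq0\}$; the system has finite degree $\mathfrak d$ if for every $X\in\mathcal S$ the number of $Y\in\mathcal S$ with $Y\cap X\neq\emptyset$ is at most $\mathfrak d$. *)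

theory Defs
  imports "HOL-Analysis.Analysis"
begin

text \<open>Quantum spin system on a vertex type 'v, each site carrying C^D.
  Configurations are maps 'v => nat (a basis vector of the tensor product
  corresponds to a configuration with values < D).  A local operator
  (element of the local algebra) is represented as a global matrix kernel
  K sigma tau, which for an element Q of A_X is the kernel of Q tensor identity:
  K sigma tau = Q(sigma|X, tau|X) if sigma = tau off X and both are valid, else 0.\<close>

type_synonym 'v cfg = "'v \<Rightarrow> nat"
type_synonym 'v op = "'v cfg \<Rightarrow> 'v cfg \<Rightarrow> complex"

definition valid :: "nat \<Rightarrow> 'v cfg \<Rightarrow> bool" where
  "valid D \<sigma> \<longleftrightarrow> (\<forall>v. \<sigma> v < D)"

definition cfgs :: "nat \<Rightarrow> 'v set \<Rightarrow> 'v cfg set" where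
  "cfgs D X = {\<sigma>. (\<forall>v\<in>X. \<sigma> v < D) \<and> (\<forall>v. v \<notin> X \<longrightarrow> \<sigma> v = 0)}"

definition r0 :: "'v set \<Rightarrow> 'v cfg \<Rightarrow> 'v cfg" where
  "r0 X \<sigma> = (\<lambda>v. if v \<in> X then \<sigma> v else 0)"

definition upd :: "'v set \<Rightarrow> 'v cfg \<Rightarrow> 'v cfg \<Rightarrow> 'v cfg" where
  "upd A \<sigma> \<omega> = (\<lambda>v. if v \<in> A then \<omega> v else \<sigma> v)"

definition loc_in :: "nat \<Rightarrow> 'v set \<Rightarrow> 'v op \<Rightarrow> bool" where
  "loc_in D X K \<longleftrightarrow> (\<forall>\<sigma> \<tau>. K \<sigma> \<tau> =
     (if valid D \<sigma> \<and> valid D \<tau> \<and> (\<forall>v. v \<notin> X \<longrightarrow> \<sigma> v = \<tau> v)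
      then K (r0 X \<sigma>) (r0 X \<tau>) else 0))"

definition is_local :: "nat \<Rightarrow> 'v op \<Rightarrow> bool" where
  "is_local D K \<longleftrightarrow> (\<exists>X. finite X \<and> loc_in D X K)"

definition herm :: "'v op \<Rightarrow> bool" where
  "herm K \<longleftrightarrow> (\<forall>\<sigma> \<tau>. K \<sigma> \<tau> = cnj (K \<tau> \<sigma>))"

definition zero_op :: "'v op" where
  "zero_op = (\<lambda>_ _. 0)"

definition local_interaction :: "nat \<Rightarrow> ('v set \<Rightarrow> 'v op) \<Rightarrow> bool" where
  "local_interaction D \<Phi> \<longleftrightarrow> (\<forall>X. finite X \<longrightarrow> loc_in D X (\<Phi> X) \<and> herm (\<Phi> X))"

definition gid :: "nat \<Rightarrow> 'v op" where
  "gid D = (\<lambda>\<sigma> \<tau>. if valid D \<sigma> \<and> \<sigma> = \<tau> then 1 else 0)"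

text \<open>Product in A_loc (only finitely many nonzero terms for local kernels).\<close>
definition gmult :: "'v op \<Rightarrow> 'v op \<Rightarrow> 'v op" where
  "gmult K M = (\<lambda>\<sigma> \<tau>. \<Sum>\<^sub>\<infinity>\<rho>. K \<sigma> \<rho> * M \<rho> \<tau>)"

primrec gpow :: "nat \<Rightarrow> 'v op \<Rightarrow> nat \<Rightarrow> 'v op" where
  "gpow D K 0 = gid D"
| "gpow D K (Suc k) = gmult K (gpow D K k)"

definition gexp :: "nat \<Rightarrow> 'v op \<Rightarrow> 'v op" where
  "gexp D K = (\<lambda>\<sigma> \<tau>. \<Sum>k. gpow D K k \<sigma> \<tau> / of_nat (fact k))"

definition glog :: "nat \<Rightarrow> 'v op \<Rightarrow> 'v op" where
  "glog D A = (THE B. is_local D B \<and> herm B \<and> gexp D B = A)"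

text \<open>E_L[Q] for Q in A_Lambda: normalized partial trace over Lambda - L,
  tensored with the identity.\<close>
definition condExp :: "nat \<Rightarrow> 'v set \<Rightarrow> 'v set \<Rightarrow> 'v op \<Rightarrow> 'v op" where
  "condExp D L \<Lambda> K = (\<lambda>\<sigma> \<tau>.
     if valid D \<sigma> \<and> valid D \<tau> \<and> (\<forall>v. v \<notin> \<Lambda> \<inter> L \<longrightarrow> \<sigma> v = \<tau> v)
     then (\<Sum>\<omega>\<in>cfgs D (\<Lambda> - L). K (upd (\<Lambda> - L) \<sigma> \<omega>) (upd (\<Lambda> - L) \<tau> \<omega>))
          / of_nat D ^ card (\<Lambda> - L)
     else 0)"

definition Ham :: "('v set \<Rightarrow> 'v op) \<Rightarrow> 'v set \<Rightarrow> 'v op" where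
  "Ham \<Phi> \<Lambda> = (\<lambda>\<sigma> \<tau>. \<Sum>X\<in>Pow \<Lambda>. \<Phi> X \<sigma> \<tau>)"

definition opnorm :: "nat \<Rightarrow> 'v set \<Rightarrow> 'v op \<Rightarrow> real" where
  "opnorm D X K = Sup {sqrt (\<Sum>\<sigma>\<in>cfgs D X. (cmod (\<Sum>\<tau>\<in>cfgs D X. K \<sigma> \<tau> * \<psi> \<tau>))\<^sup>2) | \<psi>.
                        (\<Sum>\<tau>\<in>cfgs D X. (cmod (\<psi> \<tau>))\<^sup>2) \<le> 1}"

definition bnorm :: "nat \<Rightarrow> ('v set \<Rightarrow> real) \<Rightarrow> ('v set \<Rightarrow> 'v op) \<Rightarrow> ennreal" where
  "bnorm D b \<Phi> = (SUP x. \<Sum>\<^sub>\<infinity>X\<in>{X. finite X \<and> x \<in> X}. ennreal (opnorm D X (\<Phi> X) * exp (b X)))"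

definition subadditive :: "('v set \<Rightarrow> real) \<Rightarrow> bool" where
  "subadditive b \<longleftrightarrow> (\<forall>X Y. finite X \<longrightarrow> finite Y \<longrightarrow> b (X \<union> Y) \<le> b X + b Y)"

definition comm_algebra :: "nat \<Rightarrow> 'v op set \<Rightarrow> bool" where
  "comm_algebra D \<A> \<longleftrightarrow>
     (\<forall>A\<in>\<A>. is_local D A) \<and> zero_op \<in> \<A> \<and>
     (\<forall>A\<in>\<A>. \<forall>B\<in>\<A>. (\<lambda>\<sigma> \<tau>. A \<sigma> \<tau> + B \<sigma> \<tau>) \<in> \<A> \<and> gmult A B \<in> \<A> \<and> gmult A B = gmult B A) \<and>
     (\<forall>c A. A \<in> \<A> \<longrightarrow> (\<lambda>\<sigma> \<tau>. c * A \<sigma> \<tau>) \<in> \<A>)"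

definition commuting_hyp :: "nat \<Rightarrow> ('v set \<Rightarrow> 'v op) \<Rightarrow> bool" where
  "commuting_hyp D \<Phi> \<longleftrightarrow> (\<exists>\<A>. comm_algebra D \<A> \<and> (\<forall>X. finite X \<longrightarrow> \<Phi> X \<in> \<A>) \<and>
     (\<forall>L \<Lambda> Q. Q \<in> \<A> \<longrightarrow> finite \<Lambda> \<longrightarrow> loc_in D \<Lambda> Q \<longrightarrow> condExp D L \<Lambda> Q \<in> \<A>))"

definition interaction_support :: "('v set \<Rightarrow> 'v op) \<Rightarrow> 'v set set" where
  "interaction_support \<Phi> = {X. finite X \<and> \<Phi> X \<noteq> zero_op}"

definition finite_degree :: "('v set \<Rightarrow> 'v op) \<Rightarrow> nat \<Rightarrow> bool" where
  "finite_degree \<Phi> d \<longleftrightarrow> (\<forall>X\<in>interaction_support \<Phi>.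
     finite {Y\<in>interaction_support \<Phi>. Y \<inter> X \<noteq> {}} \<and>
     card {Y\<in>interaction_support \<Phi>. Y \<inter> X \<noteq> {}} \<le> d)"

end

theory Submission
  imports Defs
begin

text \<open>
  Write \<open>Z T = E\<^sub>L[exp (\<Sum>X\<in>T. - \<beta> \<Phi>\<^sub>X)]\<close> for finite collections \<open>T\<close> of interaction sets. By the
  Commuting Hypothesis all \<open>Z T\<close> commute, so they are diagonal in a common eigenbasis. The Moebius
  inverse \<open>\<phi>\<close> of \<open>T \<mapsto> log (Z T)\<close> on the lattice of collections gives the effective interaction:
  its value at \<open>X\<close> is the sum of \<open>\<phi> T\<close> over the collections \<open>T\<close> with union \<open>X\<close>.

  For set functions \<open>f\<close> the weighted norm \<open>\<Sum>U. \<parallel>mob f U\<parallel> (\<Prod>Y\<in>U. w Y)\<close> with \<open>w \<ge> 1\<close> is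
  submultiplicative. Let \<open>r A T\<close> be the partial trace of
  \<open>(\<Prod>X\<in>A. exp (- \<beta> \<Phi>\<^sub>X) - 1) (\<Prod>X\<in>T. exp (- \<beta> \<Phi>\<^sub>X))\<close> and \<open>q A T = r A T / Z T\<close>.
  If no member of \<open>A\<close> meets a member of \<open>T\<close>, then \<open>q A T = r A {}\<close> does not depend on \<open>T\<close>; otherwise the
  increment of \<open>q A\<close> under adding a neighbour \<open>Y\<close> of \<open>A\<close> to \<open>T\<close> is
  \<open>(q (insert Y A) - q A * q {Y}) / (1 + q {Y})\<close>. Induction on \<open>T\<close> bounds the norm of \<open>q A\<close> by
  \<open>\<Prod>X\<in>A. \<theta> X\<close> times a factor \<open>1 + 1/d\<close> for each neighbour of \<open>A\<close>, and
  \<open>log (Z (insert X T)) - log (Z T) = log (1 + q {X} T)\<close> then controls \<open>\<phi>\<close>.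
  No connected clusters have to be counted.
\<close>

section \<open>Moebius inversion and a submultiplicative norm on set functions\<close>

text \<open>\<open>condExp\<close> is not multiplicative, so the logarithm has no direct
  term-by-term expansion. What survives is factorisation over disjoint regions and the fact that the
  partial trace is positive and fixes the identity. The former yields \<open>z_union\<close>; the
  latter bounds the trace of a product of factors exp - 1 by the product of the \<theta>. Besides
  the degree bound and the smallness condition, the abstract estimate uses nothing else. Constants:
  if every neighbour may cost a factor 1 + \<epsilon>, adding Y costs 2 * w Y * bd Y / (1 - bd Y),
  where bd Y = \<theta> Y * (1 + \<epsilon>)^m; this is at most \<epsilon> once w Y * bd Y \<le>
  \<epsilon> / (2 + \<epsilon>). With \<epsilon> = 1/d and at most d - 1 proper neighbours the
  accumulated factor stays below e, and the threshold is 1 / (2 d + 1). The condition on \<beta>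
  leaves room: of exp 2 only the bound 25/4 enters. The algebra is assumed neither to contain the
  identity nor to be closed under limits, so commutation of the Z T is obtained from truncated
  exponential series.\<close>

definition mob :: "('x set \<Rightarrow> 'a::comm_ring_1) \<Rightarrow> 'x set \<Rightarrow> 'a" where
  "mob f U = (\<Sum>V\<in>Pow U. (- 1) ^ card (U - V) * f V)"

lemma sum_Pow_insert:
  assumes "finite U" "Y \<notin> U"
  shows "(\<Sum>V\<in>Pow (insert Y U). g V) = (\<Sum>V\<in>Pow U. g V) + (\<Sum>V\<in>Pow U. g (insert Y V))"
proof -
  have inj: "inj_on (insert Y) (Pow U)"
    using assms(2) by (auto simp: inj_on_def)
  have "Pow U \<inter> insert Y ` Pow U = {}"
    using assms(2) by auto
  then have "(\<Sum>V\<in>Pow (insert Y U). g V) = (\<Sum>V\<in>Pow U. g V) + (\<Sum>V\<in>insert Y ` Pow U. g V)"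
    unfolding Pow_insert using assms(1) by (subst sum.union_disjoint) auto
  then show ?thesis
    by (simp add: sum.reindex[OF inj])
qed

lemma mob_empty [simp]: "mob f {} = f {}"
  by (simp add: mob_def)

lemma mob_cong: "(\<And>V. V \<subseteq> U \<Longrightarrow> f V = g V) \<Longrightarrow> mob f U = mob g U"
  unfolding mob_def by (intro sum.cong) auto

lemma mob_add: "mob (\<lambda>V. f V + g V) U = mob f U + mob g U"
  by (simp add: mob_def sum.distrib algebra_simps)

lemma mob_diff: "mob (\<lambda>V. f V - g V) U = mob f U - mob g U"
  by (simp add: mob_def sum_subtractf algebra_simps)

lemma mob_scale: "mob (\<lambda>V. c * f V) U = c * mob f U"
  by (simp add: mob_def sum_distrib_left algebra_simps)

text \<open>Pairing \<open>V\<close> with \<open>insert Y V\<close> in the alternating sum leaves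
  the Moebius transform of a discrete derivative. The inductions over collections below rest on this
  identity.\<close>

lemma mob_insert:
  assumes "finite U" "Y \<notin> U"
  shows "mob f (insert Y U) = mob (\<lambda>V. f (insert Y V) - f V) U"
proof -
  have 1: "card (insert Y U - V) = Suc (card (U - V))" if "V \<in> Pow U" for V
    using that assms by (subst insert_Diff_if) auto
  have 2: "U - insert Y V = U - V" if "V \<in> Pow U" for V
    using that assms by auto
  show ?thesis
    unfolding mob_def sum_Pow_insert[OF assms]
    by (simp add: 1 2 sum_subtractf sum_negf right_diff_distrib)
qed

text \<open>The function stays arbitrary in the induction: the sets containing \<open>Y\<close>
  contribute the inversion formula for the increment of \<open>f\<close>, and the sum
  telescopes.\<close>

lemma sum_mob: "finite T \<Longrightarrow> (\<Sum>U\<in>Pow T. mob f U) = f T"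
proof (induction T arbitrary: f rule: finite_induct)
  case (insert Y T)
  have "(\<Sum>U\<in>Pow T. mob f (insert Y U)) = (\<Sum>U\<in>Pow T. mob (\<lambda>V. f (insert Y V) - f V) U)"
    using insert.hyps by (intro sum.cong refl mob_insert) (auto intro: finite_subset)
  also have "\<dots> = f (insert Y T) - f T"
    using insert.IH[of "\<lambda>V. f (insert Y V) - f V"] by simp
  finally show ?case
    using insert.hyps insert.IH[of f] by (simp add: sum_Pow_insert)
qed simp

text \<open>Each discrete derivative of a product pulls out one factor \<open>e Y - 1\<close>. For
  Boltzmann factors this makes a Moebius coefficient small in every member of the
  collection.\<close>

lemma mob_prod:
  fixes e :: "'x \<Rightarrow> 'a::comm_ring_1"
  assumes "finite U"
  shows "mob (\<lambda>V. \<Prod>X\<in>V. e X) U = (\<Prod>X\<in>U. e X - 1)"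
  using assms
proof (induction U rule: finite_induct)
  case (insert Y U)
  have "mob (\<lambda>V. (\<Prod>X\<in>insert Y V. e X) - (\<Prod>X\<in>V. e X)) U = mob (\<lambda>V. (e Y - 1) * (\<Prod>X\<in>V. e X)) U"
  proof (rule mob_cong)
    fix V assume "V \<subseteq> U"
    then have "finite V" "Y \<notin> V" using insert.hyps by (auto intro: finite_subset)
    then show "(\<Prod>X\<in>insert Y V. e X) - (\<Prod>X\<in>V. e X) = (e Y - 1) * (\<Prod>X\<in>V. e X)"
      by (simp add: algebra_simps)
  qed
  then show ?case
    using insert by (simp add: mob_insert mob_scale)
qed simp

section \<open>The weighted norm and its bounds for products, inverses and logarithms\<close>

definition snorm :: "'i set \<Rightarrow> ('i \<Rightarrow> real) \<Rightarrow> real" where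
  "snorm I f = Max (insert 0 ((\<lambda>i. \<bar>f i\<bar>) ` I))"

text \<open>The maximum over \<open>I\<close> stands inside the sum over \<open>U\<close>: later
  every Moebius coefficient is measured by its own operator norm, and different coefficients may
  attain it at different eigenvectors.\<close>

definition wnorm :: "'i set \<Rightarrow> ('x \<Rightarrow> real) \<Rightarrow> 'x set \<Rightarrow> ('x set \<Rightarrow> 'i \<Rightarrow> real) \<Rightarrow> real" where
  "wnorm I w T f = (\<Sum>U\<in>Pow T. snorm I (\<lambda>i. mob (\<lambda>V. f V i) U) * (\<Prod>Y\<in>U. w Y))"

locale weighted =
  fixes I :: "'i set" and w :: "'x \<Rightarrow> real"
  assumes finI: "finite I" and w1: "\<And>Y. 1 \<le> w Y"
begin

lemma snorm_nonneg: "0 \<le> snorm I f"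
  unfolding snorm_def by (rule Max_ge) (use finI in auto)

lemma snorm_upper: "i \<in> I \<Longrightarrow> \<bar>f i\<bar> \<le> snorm I f"
  unfolding snorm_def by (rule Max_ge) (use finI in auto)

lemma snorm_least: "0 \<le> c \<Longrightarrow> (\<And>i. i \<in> I \<Longrightarrow> \<bar>f i\<bar> \<le> c) \<Longrightarrow> snorm I f \<le> c"
  unfolding snorm_def by (rule Max.boundedI) (use finI in auto)

lemma snorm_cong: "(\<And>i. i \<in> I \<Longrightarrow> f i = g i) \<Longrightarrow> snorm I f = snorm I g"
  unfolding snorm_def by (simp cong: image_cong)

lemma snorm_add: "snorm I (\<lambda>i. f i + g i) \<le> snorm I f + snorm I g"
  by (rule snorm_least)
    (use snorm_upper[of _ f] snorm_upper[of _ g] snorm_nonneg[of f] snorm_nonneg[of g] in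
      \<open>fastforce intro: order_trans[OF abs_triangle_ineq] add_mono\<close>)+

lemma snorm_mult: "snorm I (\<lambda>i. f i * g i) \<le> snorm I f * snorm I g"
  by (rule snorm_least) (auto simp: abs_mult snorm_nonneg intro!: mult_mono snorm_upper)

lemma snorm_minus: "snorm I (\<lambda>i. - f i) = snorm I f"
  by (simp add: snorm_def)

lemma prod_w_ge1: "1 \<le> (\<Prod>Y\<in>U. w Y)"
  by (rule prod_ge_1) (simp add: w1)

lemma wnorm_nonneg: "0 \<le> wnorm I w T f"
  unfolding wnorm_def
  by (intro sum_nonneg mult_nonneg_nonneg snorm_nonneg order_trans[OF _ prod_w_ge1]) simp

lemma wnorm_empty: "wnorm I w {} f = snorm I (f {})"
  by (simp add: wnorm_def)

lemma wnorm_cong: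
  assumes "\<And>V i. V \<subseteq> T \<Longrightarrow> i \<in> I \<Longrightarrow> f V i = g V i"
  shows "wnorm I w T f = wnorm I w T g"
  unfolding wnorm_def
  by (intro sum.cong refl arg_cong2[where f="(*)"] snorm_cong mob_cong) (use assms in auto)

text \<open>Subsets are sorted by whether they contain \<open>Y\<close>; those that do see only the
  increment of \<open>f\<close> in direction \<open>Y\<close> and carry the extra weight
  \<open>w Y\<close>.\<close>

lemma wnorm_insert:
  assumes "finite T" "Y \<notin> T"
  shows "wnorm I w (insert Y T) f = wnorm I w T f + w Y * wnorm I w T (\<lambda>V i. f (insert Y V) i - f V i)"
proof -
  have "snorm I (\<lambda>i. mob (\<lambda>V. f V i) (insert Y U)) * (\<Prod>Y\<in>insert Y U. w Y) =
        w Y * (snorm I (\<lambda>i. mob (\<lambda>V. f (insert Y V) i - f V i) U) * (\<Prod>Y\<in>U. w Y))"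
    if "U \<in> Pow T" for U
  proof -
    have "finite U" "Y \<notin> U" using that assms by (auto intro: finite_subset)
    then show ?thesis by (simp add: mob_insert)
  qed
  then show ?thesis
    unfolding wnorm_def sum_Pow_insert[OF assms] sum_distrib_left by simp
qed

lemma wnorm_add: "wnorm I w T (\<lambda>V i. f V i + g V i) \<le> wnorm I w T f + wnorm I w T g"
  unfolding wnorm_def mob_add sum.distrib[symmetric] distrib_right[symmetric]
  by (intro sum_mono mult_right_mono snorm_add order_trans[OF _ prod_w_ge1]) simp

lemma wnorm_minus: "wnorm I w T (\<lambda>V i. - f V i) = wnorm I w T f"
proof -
  have "mob (\<lambda>V. - f V i) U = - mob (\<lambda>V. f V i) U" for i U
    using mob_scale[of "-1" "\<lambda>V. f V i" U] by simp
  then show ?thesis by (simp add: wnorm_def snorm_minus)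
qed

lemma wnorm_diff: "wnorm I w T (\<lambda>V i. f V i - g V i) \<le> wnorm I w T f + wnorm I w T g"
  using wnorm_add[of T f "\<lambda>V i. - g V i"] by (simp add: wnorm_minus)

lemma wnorm_const:
  assumes "finite T"
  shows "wnorm I w T (\<lambda>_. c) = snorm I c"
  using assms
proof (induction T rule: finite_induct)
  case (insert Y T)
  have "wnorm I w T (\<lambda>V i. c i - c i) = 0"
    using insert.hyps by (simp add: wnorm_def mob_def snorm_def)
      (auto intro!: sum.neutral simp: image_constant_conv)
  then show ?case using insert by (simp add: wnorm_insert)
qed (simp add: wnorm_empty)

text \<open>Induction by the discrete Leibniz rule: the increment of a product is
  \<open>f' * g' + f * g' + f' * g\<close>. The term \<open>f' * g'\<close> carries
  \<open>w Y\<close> once while the product of the norms offers it twice; the gap is closed by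
  \<open>1 \<le> w Y\<close>.\<close>

lemma wnorm_mult:
  assumes "finite T"
  shows "wnorm I w T (\<lambda>V i. f V i * g V i) \<le> wnorm I w T f * wnorm I w T g"
  using assms
proof (induction T arbitrary: f g rule: finite_induct)
  case empty
  then show ?case by (simp add: wnorm_empty snorm_mult)
next
  case (insert Y T)
  define f' where "f' = (\<lambda>V i. f (insert Y V) i - f V i)"
  define g' where "g' = (\<lambda>V i. g (insert Y V) i - g V i)"
  let ?n = "wnorm I w T"
  have "?n (\<lambda>V i. f (insert Y V) i * g (insert Y V) i - f V i * g V i)
      = ?n (\<lambda>V i. f' V i * g' V i + (f V i * g' V i + f' V i * g V i))"
    by (rule wnorm_cong) (simp add: f'_def g'_def algebra_simps)
  also have "\<dots> \<le> ?n f' * ?n g' + (?n f * ?n g' + ?n f' * ?n g)"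
    by (intro order_trans[OF wnorm_add] add_mono insert.IH)
  finally have "w Y * ?n (\<lambda>V i. f (insert Y V) i * g (insert Y V) i - f V i * g V i)
     \<le> w Y * (?n f' * ?n g' + (?n f * ?n g' + ?n f' * ?n g))"
    by (rule mult_left_mono) (use w1[of Y] in simp)
  moreover have "w Y * (?n f' * ?n g') \<le> (w Y * w Y) * (?n f' * ?n g')"
    by (intro mult_right_mono) (use w1[of Y] wnorm_nonneg in auto)
  ultimately have "w Y * ?n (\<lambda>V i. f (insert Y V) i * g (insert Y V) i - f V i * g V i)
     \<le> (w Y * w Y) * (?n f' * ?n g') + w Y * (?n f * ?n g' + ?n f' * ?n g)"
    by (simp add: algebra_simps)
  with insert.IH[of f g] show ?case
    using insert.hyps unfolding wnorm_insert[OF insert.hyps] f'_def[symmetric] g'_def[symmetric]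
    by (simp add: algebra_simps)
qed

text \<open>Moebius inversion writes \<open>f V\<close> as a sum of coefficients, and weights of at
  least 1 only enlarge them. A norm below 1 therefore makes \<open>1 + q\<close> positive at every
  point and the logarithm series convergent.\<close>

lemma wnorm_upper:
  assumes "finite T" "V \<subseteq> T" "i \<in> I"
  shows "\<bar>f V i\<bar> \<le> wnorm I w T f"
proof -
  have "\<bar>f V i\<bar> = \<bar>\<Sum>U\<in>Pow V. mob (\<lambda>V. f V i) U\<bar>"
    using assms by (simp add: sum_mob finite_subset)
  also have "\<dots> \<le> (\<Sum>U\<in>Pow V. \<bar>mob (\<lambda>V. f V i) U\<bar>)" by (rule sum_abs)
  also have "\<dots> \<le> (\<Sum>U\<in>Pow T. \<bar>mob (\<lambda>V. f V i) U\<bar>)"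
    using assms by (intro sum_mono2) auto
  also have "\<dots> \<le> wnorm I w T f"
    unfolding wnorm_def
  proof (rule sum_mono)
    fix U assume "U \<in> Pow T"
    have "\<bar>mob (\<lambda>V. f V i) U\<bar> \<le> snorm I (\<lambda>i. mob (\<lambda>V. f V i) U) * 1"
      using snorm_upper[OF assms(3), of "\<lambda>i. mob (\<lambda>V. f V i) U"] by simp
    also have "\<dots> \<le> snorm I (\<lambda>i. mob (\<lambda>V. f V i) U) * (\<Prod>Y\<in>U. w Y)"
      by (intro mult_left_mono snorm_nonneg prod_w_ge1)
    finally show "\<bar>mob (\<lambda>V. f V i) U\<bar> \<le> snorm I (\<lambda>i. mob (\<lambda>V. f V i) U) * (\<Prod>Y\<in>U. w Y)" .
  qed
  finally show ?thesis .
qed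

text \<open>The inverse \<open>g\<close> satisfies \<open>g = 1 - q g\<close>, which bounds its (finite) norm without any series.\<close>

lemma wnorm_inverse:
  assumes "finite T" "wnorm I w T q < 1"
    and inv: "\<And>V i. V \<subseteq> T \<Longrightarrow> i \<in> I \<Longrightarrow> g V i * (1 + q V i) = 1"
  shows "wnorm I w T g \<le> 1 / (1 - wnorm I w T q)"
proof -
  have "wnorm I w T g = wnorm I w T (\<lambda>V i. (\<lambda>_ _. 1) V i - q V i * g V i)"
    by (rule wnorm_cong) (use inv in \<open>force simp: algebra_simps\<close>)
  also have "\<dots> \<le> wnorm I w T (\<lambda>_ _. 1) + wnorm I w T q * wnorm I w T g"
    by (intro order_trans[OF wnorm_diff] add_mono wnorm_mult assms) simp
  also have "wnorm I w T (\<lambda>_ _. 1) \<le> 1"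
    using assms(1) by (simp add: wnorm_const snorm_least)
  finally show ?thesis
    using assms(2) by (simp add: field_simps)
qed

lemma wnorm_power:
  assumes "finite T"
  shows "wnorm I w T (\<lambda>V i. q V i ^ Suc n) \<le> wnorm I w T q ^ Suc n"
proof (induction n)
  case (Suc n)
  have "wnorm I w T (\<lambda>V i. q V i * q V i ^ Suc n) \<le> wnorm I w T q * wnorm I w T q ^ Suc n"
    by (intro order_trans[OF wnorm_mult[OF assms]] mult_left_mono Suc wnorm_nonneg)
  then show ?case by simp
qed simp

text \<open>The logarithm is expanded in powers of \<open>q\<close>, whose norms are bounded by
  submultiplicativity; replacing the coefficients 1/(n+1) by 1 leaves a geometric series. The
  Moebius transform is a finite linear combination and so acts termwise.\<close>

lemma wnorm_ln:
  assumes T: "finite T" and q1: "wnorm I w T q < 1"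
  shows "wnorm I w T (\<lambda>V i. ln (1 + q V i)) \<le> wnorm I w T q / (1 - wnorm I w T q)"
proof -
  let ?p = "\<lambda>n U. snorm I (\<lambda>i. mob (\<lambda>V. q V i ^ Suc n) U)"
  let ?W = "\<lambda>U. \<Prod>Y\<in>U. w Y"
  have W0: "0 \<le> ?W U" for U using prod_w_ge1[of U] by linarith
  have geo: "(\<lambda>n. wnorm I w T q ^ Suc n) sums (wnorm I w T q / (1 - wnorm I w T q))"
    using sums_mult[OF geometric_sums, of "wnorm I w T q" "wnorm I w T q"] q1 wnorm_nonneg[of T q]
    by simp
  have term_le: "?p n U * ?W U \<le> wnorm I w T q ^ Suc n" if "U \<in> Pow T" for n U
  proof -
    have "?p n U * ?W U \<le> wnorm I w T (\<lambda>V i. q V i ^ Suc n)"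
      unfolding wnorm_def using that T
      by (intro member_le_sum) (auto intro!: mult_nonneg_nonneg snorm_nonneg W0)
    with wnorm_power[OF T, of q n] show ?thesis by linarith
  qed
  have sumW: "summable (\<lambda>n. ?p n U * ?W U)" if "U \<in> Pow T" for U
    by (rule summable_comparison_test'[OF sums_summable[OF geo], of 0])
      (use term_le[OF that] in \<open>auto simp: abs_mult snorm_nonneg W0\<close>)
  have sump: "summable (\<lambda>n. ?p n U)" if U: "U \<in> Pow T" for U
  proof (rule summable_comparison_test'[OF sumW[OF U], of 0])
    fix n
    have "?p n U * 1 \<le> ?p n U * ?W U" by (intro mult_left_mono snorm_nonneg prod_w_ge1)
    then show "norm (?p n U) \<le> ?p n U * ?W U" by (simp add: snorm_nonneg)
  qed
  have main: "snorm I (\<lambda>i. mob (\<lambda>V. ln (1 + q V i)) U) \<le> (\<Sum>n. ?p n U)" if U: "U \<in> Pow T" for U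
  proof (rule snorm_least)
    show "0 \<le> (\<Sum>n. ?p n U)" by (intro suminf_nonneg sump U snorm_nonneg)
    fix i assume i: "i \<in> I"
    have ser: "(\<lambda>n. (-1)^n * (1 / real (n + 1)) * q V i ^ Suc n) sums ln (1 + q V i)" if V: "V \<subseteq> U" for V
    proof -
      have "\<bar>q V i\<bar> < 1" by (rule le_less_trans[OF wnorm_upper[OF T _ i] q1]) (use V U in auto)
      then have x: "0 < 1 + q V i" "1 + q V i < 2" and y: "norm (q V i) < 1" by auto
      have "summable (\<lambda>n. (-1)^n * (1 / real (n + 1)) * q V i ^ Suc n)"
      proof (rule summable_comparison_test'[of "\<lambda>n. \<bar>q V i\<bar> ^ n" 0])
        show "summable (\<lambda>n. \<bar>q V i\<bar> ^ n)" using y by (intro summable_geometric) simp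
        fix n :: nat
        have "1 / real (n + 1) * \<bar>q V i\<bar> ^ Suc n \<le> 1 * \<bar>q V i\<bar> ^ n"
          by (intro mult_mono) (use y in \<open>auto intro: power_decreasing simp: mult_left_le_one_le\<close>)
        then show "norm ((-1)^n * (1 / real (n + 1)) * q V i ^ Suc n) \<le> \<bar>q V i\<bar> ^ n"
          by (simp add: abs_mult power_abs)
      qed
      then show ?thesis using ln_series[OF x] by (simp add: sums_iff)
    qed
    have "(\<lambda>n. \<Sum>V\<in>Pow U. (-1) ^ card (U - V) * ((-1)^n * (1 / real (n + 1)) * q V i ^ Suc n))
        sums mob (\<lambda>V. ln (1 + q V i)) U"
      unfolding mob_def by (intro sums_sum sums_mult ser) auto
    moreover have "(\<Sum>V\<in>Pow U. (-1) ^ card (U - V) * ((-1)^n * (1 / real (n + 1)) * q V i ^ Suc n))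
       = ((-1)^n * (1 / real (n + 1))) * mob (\<lambda>V. q V i ^ Suc n) U" for n
      unfolding mob_def sum_distrib_left by (intro sum.cong refl) (simp add: algebra_simps)
    ultimately have s: "(\<lambda>n. ((-1)^n * (1 / real (n + 1))) * mob (\<lambda>V. q V i ^ Suc n) U)
        sums mob (\<lambda>V. ln (1 + q V i)) U" by simp
    have "\<bar>\<Sum>n. ((-1)^n * (1 / real (n + 1))) * mob (\<lambda>V. q V i ^ Suc n) U\<bar> \<le> (\<Sum>n. ?p n U)"
      unfolding real_norm_def[symmetric]
    proof (rule norm_suminf_le[OF _ sump[OF U]])
      fix n :: nat
      have "1 / real (n + 1) * \<bar>mob (\<lambda>V. q V i ^ Suc n) U\<bar> \<le> 1 * ?p n U"
        by (intro mult_mono snorm_upper i) auto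
      then show "norm (((-1)^n * (1 / real (n + 1))) * mob (\<lambda>V. q V i ^ Suc n) U) \<le> ?p n U"
        by (simp add: abs_mult)
    qed
    then show "\<bar>mob (\<lambda>V. ln (1 + q V i)) U\<bar> \<le> (\<Sum>n. ?p n U)"
      using s by (simp add: sums_iff)
  qed
  have "wnorm I w T (\<lambda>V i. ln (1 + q V i)) \<le> (\<Sum>U\<in>Pow T. (\<Sum>n. ?p n U * ?W U))"
    unfolding wnorm_def
  proof (rule sum_mono)
    fix U assume U: "U \<in> Pow T"
    show "snorm I (\<lambda>i. mob (\<lambda>V. ln (1 + q V i)) U) * ?W U \<le> (\<Sum>n. ?p n U * ?W U)"
      using mult_right_mono[OF main[OF U] W0[of U]] suminf_mult2[OF sump[OF U], of "?W U"] by simp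
  qed
  also have "\<dots> = (\<Sum>n. \<Sum>U\<in>Pow T. ?p n U * ?W U)"
    by (rule suminf_sum[symmetric]) (rule sumW)
  also have "\<dots> \<le> (\<Sum>n. wnorm I w T q ^ Suc n)"
    using wnorm_power[OF T, of q]
    by (intro suminf_le summable_sum sumW sums_summable[OF geo]) (auto simp: wnorm_def)
  also have "\<dots> = wnorm I w T q / (1 - wnorm I w T q)"
    using geo by (simp add: sums_iff)
  finally show ?thesis .
qed

end


section \<open>The cluster estimate in abstract form\<close>

text \<open>In the application \<open>S\<close> consists of interaction sets, \<open>adj\<close> is
  nonempty intersection, \<open>I\<close> is a common eigenbasis and \<open>z T\<close> lists the
  eigenvalues of the traced Boltzmann factor of \<open>T\<close>. \<open>degree\<close> leaves out
  \<open>X\<close> itself. \<open>small\<close> is the condition under which the induction over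
  neighbours closes.\<close>

locale cluster = weighted I w for I :: "'i set" and w :: "'x \<Rightarrow> real" +
  fixes S :: "'x set" and adj :: "'x \<Rightarrow> 'x \<Rightarrow> bool" and z :: "'x set \<Rightarrow> 'i \<Rightarrow> real"
    and \<theta> :: "'x \<Rightarrow> real" and m :: nat and \<epsilon> :: real
  assumes finS: "finite S"
    and z_empty: "\<And>i. i \<in> I \<Longrightarrow> z {} i = 1"
    and z_union: "\<And>A T i. A \<subseteq> S \<Longrightarrow> T \<subseteq> S \<Longrightarrow> A \<inter> T = {} \<Longrightarrow> (\<And>X Y. X \<in> A \<Longrightarrow> Y \<in> T \<Longrightarrow> \<not> adj X Y)
          \<Longrightarrow> i \<in> I \<Longrightarrow> z (A \<union> T) i = z A i * z T i"
    and z_bound: "\<And>A. A \<subseteq> S \<Longrightarrow> snorm I (\<lambda>i. mob (\<lambda>V. z V i) A) \<le> (\<Prod>X\<in>A. \<theta> X)"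
    and degree: "\<And>X. X \<in> S \<Longrightarrow> card {Y \<in> S. Y \<noteq> X \<and> adj X Y} \<le> m"
    and theta_nonneg: "\<And>X. 0 \<le> \<theta> X" and eps_pos: "0 < \<epsilon>"
    and small: "\<And>X. X \<in> S \<Longrightarrow> w X * \<theta> X * (1 + \<epsilon>) ^ m \<le> \<epsilon> / (2 + \<epsilon>)"
begin

definition r :: "'x set \<Rightarrow> 'x set \<Rightarrow> 'i \<Rightarrow> real" where
  "r A T i = mob (\<lambda>V. z (V \<union> T) i) A"

definition q :: "'x set \<Rightarrow> 'x set \<Rightarrow> 'i \<Rightarrow> real" where
  "q A T i = r A T i / z T i"

definition nbrs :: "'x set \<Rightarrow> 'x set \<Rightarrow> 'x set" where
  "nbrs A T = {Y \<in> T. \<exists>X\<in>A. adj X Y}"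

abbreviation bd :: "'x \<Rightarrow> real" where
  "bd X \<equiv> \<theta> X * (1 + \<epsilon>) ^ m"

text \<open>This is exp = 1 + (exp - 1) for the factor of \<open>Y\<close>: either \<open>Y\<close>
  disappears from the spectators or it is promoted to an active member of \<open>A\<close>.\<close>

lemma r_insert:
  assumes "finite A" "Y \<notin> A"
  shows "r A (insert Y T) i = r A T i + r (insert Y A) T i"
  using assms by (simp add: r_def mob_insert mob_diff)

lemma bd_nonneg: "0 \<le> bd X"
  using theta_nonneg[of X] eps_pos by simp

lemma bd_le:
  assumes "X \<in> S"
  shows "bd X \<le> \<epsilon> / (2 + \<epsilon>)"
proof -
  have "1 * bd X \<le> w X * bd X" by (intro mult_right_mono w1 bd_nonneg)
  then show ?thesis using small[OF assms] by (simp add: mult.assoc)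
qed

lemma bd_less_1: "X \<in> S \<Longrightarrow> bd X < 1"
  using bd_le[of X] eps_pos divide_less_eq_1[of \<epsilon> "2 + \<epsilon>"] by linarith

text \<open>The threshold in \<open>small\<close> is calibrated for this:
  \<open>bd X \<le> \<epsilon> / (2 + \<epsilon>)\<close> says the same as
  \<open>2 / (2 + \<epsilon>) \<le> 1 - bd X\<close>.\<close>

lemma inverse_bd_le: "X \<in> S \<Longrightarrow> 1 / (1 - bd X) \<le> 1 + \<epsilon> / 2"
proof -
  assume X: "X \<in> S"
  have "2 / (2 + \<epsilon>) \<le> 1 - bd X" using bd_le[OF X] eps_pos by (simp add: field_simps)
  then have "1 / (1 - bd X) \<le> 1 / (2 / (2 + \<epsilon>))"
    using eps_pos by (intro divide_left_mono) (auto intro!: mult_pos_pos simp: bd_less_1[OF X])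
  then show ?thesis by (simp add: field_simps)
qed

lemma prod_theta_nonneg: "0 \<le> (\<Prod>X\<in>A. \<theta> X)"
  by (intro prod_nonneg) (simp add: theta_nonneg)

lemma card_nbrs_singleton:
  assumes "Y \<in> S" "T \<subseteq> S" "Y \<notin> T"
  shows "card (nbrs {Y} T) \<le> m"
proof -
  have "card (nbrs {Y} T) \<le> card {X \<in> S. X \<noteq> Y \<and> adj Y X}"
    using assms finS by (intro card_mono) (auto simp: nbrs_def)
  with degree[OF assms(1)] show ?thesis by simp
qed

lemma card_nbrs_insert:
  assumes "Y \<in> S" "T \<subseteq> S" "Y \<notin> T"
  shows "card (nbrs (insert Y A) T) \<le> card (nbrs A T) + m"
proof -
  have "finite T" using assms finS finite_subset by blast
  then have "card (nbrs (insert Y A) T) \<le> card (nbrs A T \<union> nbrs {Y} T)"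
    by (intro card_mono) (auto simp: nbrs_def)
  also have "\<dots> \<le> card (nbrs A T) + card (nbrs {Y} T)" by (rule card_Un_le)
  finally show ?thesis using card_nbrs_singleton[OF assms] by simp
qed

text \<open>Both claims are proved together, since \<open>q\<close> divides by \<open>z\<close>,
  while positivity passes from \<open>V\<close> to \<open>insert Y V\<close> only through
  \<open>\<bar>q {Y} V i\<bar> < 1\<close>. The bound ranges over all \<open>A\<close> because the
  step for \<open>A\<close> calls the hypothesis for \<open>insert Y A\<close> on a smaller
  \<open>T\<close>.\<close>

lemma z_pos_and_q_bound:
  "T \<subseteq> S \<Longrightarrow> (\<forall>V\<subseteq>T. \<forall>i\<in>I. 0 < z V i) \<and>
    (\<forall>A\<subseteq>S. A \<inter> T = {} \<longrightarrow> wnorm I w T (q A) \<le> (\<Prod>X\<in>A. \<theta> X) * (1 + \<epsilon>) ^ card (nbrs A T))"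
proof (induction "card T" arbitrary: T rule: less_induct)
  case less
  note T = less.prems
  have finT: "finite T" using T finS by (rule finite_subset)
  have IH_pos: "0 < z V i" if "U \<subset> T" "V \<subseteq> U" "i \<in> I" for U V i
    using less.hyps[OF psubset_card_mono[OF finT that(1)]] that T by auto
  have IH_q: "wnorm I w U (q A) \<le> (\<Prod>X\<in>A. \<theta> X) * (1 + \<epsilon>) ^ card (nbrs A U)"
    if "U \<subset> T" "A \<subseteq> S" "A \<inter> U = {}" for U A
    using less.hyps[OF psubset_card_mono[OF finT that(1)]] that T by auto
  have IH_Y: "wnorm I w (T - {Y}) (q {Y}) \<le> bd Y" if "Y \<in> T" for Y
  proof -
    have "wnorm I w (T - {Y}) (q {Y}) \<le> \<theta> Y * (1 + \<epsilon>) ^ card (nbrs {Y} (T - {Y}))"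
      using IH_q[of "T - {Y}" "{Y}"] that T by auto
    also have "\<dots> \<le> bd Y"
      using card_nbrs_singleton[of Y "T - {Y}"] that T eps_pos
      by (intro mult_left_mono power_increasing theta_nonneg) auto
    finally show ?thesis .
  qed
  have q_Y: "1 + q {Y} V i = z (insert Y V) i / z V i \<and> 0 < 1 + q {Y} V i"
    if "Y \<in> T" "V \<subseteq> T - {Y}" "i \<in> I" for Y V i
  proof -
    have pos: "0 < z V i" using IH_pos[of "T - {Y}" V i] that by auto
    have "\<bar>q {Y} V i\<bar> \<le> wnorm I w (T - {Y}) (q {Y})"
      using that finT by (intro wnorm_upper) auto
    also have "\<dots> < 1" using IH_Y[OF that(1)] bd_less_1[of Y] that T by auto
    finally have "0 < 1 + q {Y} V i" by simp
    moreover have "r {Y} V i = z (insert Y V) i - z V i"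
      using mob_insert[of "{}" Y "\<lambda>W. z (W \<union> V) i"] by (simp add: r_def)
    then have "1 + q {Y} V i = z (insert Y V) i / z V i"
      using pos by (simp add: q_def field_simps)
    ultimately show ?thesis by simp
  qed
  \<comment> \<open>Only \<open>V = T\<close> is new: \<open>z T\<close> is
    \<open>z (T - {Y})\<close> times the positive number \<open>1 + q {Y} (T - {Y})\<close>.\<close>
  have pos: "0 < z V i" if "V \<subseteq> T" "i \<in> I" for V i
  proof (cases "V = T")
    case False
    with that IH_pos[of V V i] show ?thesis by auto
  next
    case True
    show ?thesis
    proof (cases "T = {}")
      case True
      then show ?thesis using \<open>V = T\<close> that z_empty by simp
    next
      case False
      then obtain Y where Y: "Y \<in> T" by auto
      have "0 < z (T - {Y}) i" using IH_pos[of "T - {Y}" "T - {Y}" i] Y that by auto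
      with q_Y[OF Y subset_refl that(2)] show ?thesis
        using Y \<open>V = T\<close> zero_less_divide_iff[of "z T i" "z (T - {Y}) i"] by (auto simp: insert_absorb)
    qed
  qed
  have "wnorm I w T (q A) \<le> (\<Prod>X\<in>A. \<theta> X) * (1 + \<epsilon>) ^ card (nbrs A T)"
    if A: "A \<subseteq> S" "A \<inter> T = {}" for A
  proof (cases "nbrs A T = {}")
    case True
    have "q A V i = mob (\<lambda>W. z W i) A" if V: "V \<subseteq> T" "i \<in> I" for V i
    proof -
      have "r A V i = mob (\<lambda>W. z V i * z W i) A"
        unfolding r_def
      proof (rule mob_cong)
        fix W assume "W \<subseteq> A"
        then show "z (W \<union> V) i = z V i * z W i"
          using A V T True by (subst z_union) (auto simp: nbrs_def, blast)
      qed
      then show ?thesis using pos[OF V] by (simp add: q_def mob_scale)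
    qed
    then have "wnorm I w T (q A) = wnorm I w T (\<lambda>_ i. mob (\<lambda>W. z W i) A)"
      by (intro wnorm_cong) auto
    then show ?thesis
      using z_bound[OF A(1)] True by (simp add: wnorm_const finT)
  next
    case False
    \<comment> \<open>Any neighbour will do. Removing it lowers the number of neighbours by exactly
      one, which pays for one factor \<open>1 + \<epsilon>\<close>.\<close>
    then obtain Y where Y: "Y \<in> T" "Y \<in> nbrs A T" by (auto simp: nbrs_def)
    define T0 where "T0 = T - {Y}"
    have T0: "T0 \<subset> T" "finite T0" "Y \<notin> T0" "T = insert Y T0" "T0 \<subseteq> S" "Y \<in> S" "Y \<notin> A" "finite A"
      using Y finT T A finS by (auto simp: T0_def intro: finite_subset)
    let ?n = "wnorm I w T0"
    define p where "p = (\<Prod>X\<in>A. \<theta> X) * (1 + \<epsilon>) ^ card (nbrs A T0)"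
    have p0: "0 \<le> p" using prod_theta_nonneg eps_pos by (simp add: p_def)
    have cardT: "card (nbrs A T) = Suc (card (nbrs A T0))"
    proof -
      have "nbrs A T = insert Y (nbrs A T0)" "Y \<notin> nbrs A T0" "finite (nbrs A T0)"
        using Y T0 by (auto simp: nbrs_def)
      then show ?thesis by simp
    qed
    have a: "?n (q A) \<le> p" using IH_q[of T0 A] A T0 by (auto simp: p_def)
    have e: "?n (q {Y}) \<le> bd Y" using IH_Y[OF Y(1)] by (simp add: T0_def)
    \<comment> \<open>Promoting \<open>Y\<close> to an active member adds at most \<open>m\<close>
      neighbours, so the price is the single factor \<open>bd Y\<close>, uniformly in
      \<open>A\<close>.\<close>
    have c: "?n (q (insert Y A)) \<le> p * bd Y"
    proof -
      have "?n (q (insert Y A)) \<le> (\<Prod>X\<in>insert Y A. \<theta> X) * (1 + \<epsilon>) ^ card (nbrs (insert Y A) T0)"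
        by (rule IH_q) (use A T0 in auto)
      also have "\<dots> \<le> (\<Prod>X\<in>insert Y A. \<theta> X) * (1 + \<epsilon>) ^ (card (nbrs A T0) + m)"
        using card_nbrs_insert[of Y T0 A] T0 eps_pos
        by (intro mult_left_mono power_increasing prod_theta_nonneg) auto
      also have "\<dots> = p * bd Y" using T0 by (simp add: p_def power_add)
      finally show ?thesis .
    qed
    define g where "g = (\<lambda>V i. 1 / (1 + q {Y} V i))"
    have b1: "bd Y < 1" using bd_less_1 T0 by simp
    have g: "?n g \<le> 1 / (1 - bd Y)"
    proof -
      have "?n g \<le> 1 / (1 - ?n (q {Y}))"
      proof (rule wnorm_inverse)
        show "g V i * (1 + q {Y} V i) = 1" if "V \<subseteq> T0" "i \<in> I" for V i
          using conjunct2[OF q_Y[OF Y(1) that[unfolded T0_def]]] by (simp add: g_def)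
      qed (use e b1 T0 in auto)
      also have "\<dots> \<le> 1 / (1 - bd Y)"
        using e b1 by (intro divide_left_mono) auto
      finally show ?thesis .
    qed
    \<comment> \<open>The split of \<open>r A (insert Y V)\<close> from \<open>r_insert\<close> is
      divided by \<open>z (insert Y V) = z V * (1 + q {Y} V)\<close>.\<close>
    have step: "?n (\<lambda>V i. q A (insert Y V) i - q A V i)
        = ?n (\<lambda>V i. (q (insert Y A) V i - q A V i * q {Y} V i) * g V i)"
    proof (rule wnorm_cong)
      fix V i assume V: "V \<subseteq> T0" "i \<in> I"
      have z: "0 < z V i" using pos V T0 by auto
      have y: "1 + q {Y} V i = z (insert Y V) i / z V i" "0 < 1 + q {Y} V i"
        using q_Y[OF Y(1), of V i] V by (auto simp: T0_def)
      have "q A (insert Y V) i * (1 + q {Y} V i) = r A (insert Y V) i / z V i"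
        using y z by (simp add: q_def zero_less_divide_iff)
      also have "\<dots> = q A V i + q (insert Y A) V i"
        using T0 by (simp add: r_insert q_def add_divide_distrib)
      finally have "q A (insert Y V) i = (q A V i + q (insert Y A) V i) / (1 + q {Y} V i)"
        using y(2) by (simp add: field_simps)
      then show "q A (insert Y V) i - q A V i = (q (insert Y A) V i - q A V i * q {Y} V i) * g V i"
        using y(2) by (simp add: g_def field_simps)
    qed
    have "?n (\<lambda>V i. q A (insert Y V) i - q A V i)
       \<le> ?n (\<lambda>V i. q (insert Y A) V i - q A V i * q {Y} V i) * ?n g"
      unfolding step by (rule wnorm_mult) (rule T0)
    also have "\<dots> \<le> (p * bd Y + p * bd Y) * (1 / (1 - bd Y))"
    proof (intro mult_mono g)
      have "?n (\<lambda>V i. q A V i * q {Y} V i) \<le> p * bd Y"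
        by (rule order_trans[OF wnorm_mult]) (auto intro!: mult_mono a e p0 wnorm_nonneg T0)
      then show "?n (\<lambda>V i. q (insert Y A) V i - q A V i * q {Y} V i) \<le> p * bd Y + p * bd Y"
        using c wnorm_diff[of T0 "q (insert Y A)" "\<lambda>V i. q A V i * q {Y} V i"] by linarith
    qed (use p0 bd_nonneg[of Y] b1 wnorm_nonneg in auto)
    finally have d: "?n (\<lambda>V i. q A (insert Y V) i - q A V i) \<le> 2 * p * bd Y * (1 / (1 - bd Y))"
      by (simp add: algebra_simps)
    have "w Y * ?n (\<lambda>V i. q A (insert Y V) i - q A V i) \<le> w Y * (2 * p * bd Y * (1 / (1 - bd Y)))"
      by (intro mult_left_mono d order_trans[OF _ w1]) simp
    also have "\<dots> = p * ((w Y * \<theta> Y * (1 + \<epsilon>) ^ m) * (2 * (1 / (1 - bd Y))))"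
      by (simp add: algebra_simps)
    \<comment> \<open>The factor 2 counts the two terms of the increment, and
      \<open>1 + \<epsilon> / 2\<close> bounds the inverse; the product with the threshold is
      exactly \<open>\<epsilon>\<close>.\<close>
    also have "\<dots> \<le> p * ((\<epsilon> / (2 + \<epsilon>)) * (2 * (1 + \<epsilon> / 2)))"
      using eps_pos b1 inverse_bd_le[OF \<open>Y \<in> S\<close>]
      by (intro mult_left_mono mult_mono small T0 p0) (auto intro!: mult_nonneg_nonneg)
    also have "\<dots> = p * \<epsilon>" using eps_pos by (simp add: field_simps)
    finally have "wnorm I w T (q A) \<le> p + p * \<epsilon>"
      using a T0 by (simp add: wnorm_insert)
    also have "\<dots> = (\<Prod>X\<in>A. \<theta> X) * (1 + \<epsilon>) ^ card (nbrs A T)"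
      by (simp add: cardT p_def algebra_simps)
    finally show ?thesis .
  qed
  with pos show ?case by auto
qed

lemma z_pos: "T \<subseteq> S \<Longrightarrow> i \<in> I \<Longrightarrow> 0 < z T i"
  using z_pos_and_q_bound by blast

text \<open>Each \<open>U\<close> containing \<open>X\<close> is \<open>insert X\<close> of a subset
  of \<open>S - {X}\<close>, and its Moebius coefficient is that of the increment
  \<open>ln (1 + q {X})\<close>. The sum is thus \<open>w X\<close> times a \<open>wnorm\<close>, to
  which \<open>wnorm_ln\<close> applies.\<close>

theorem mob_ln_bound:
  assumes X: "X \<in> S"
  shows "(\<Sum>U | U \<subseteq> S \<and> X \<in> U. snorm I (\<lambda>i. mob (\<lambda>V. ln (z V i)) U) * (\<Prod>Y\<in>U. w Y))
     \<le> (w X * \<theta> X * (1 + \<epsilon>) ^ m) * (1 + \<epsilon> / 2)"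
proof -
  let ?T = "S - {X}"
  let ?n = "wnorm I w ?T"
  have T: "finite ?T" "X \<notin> ?T" using finS by auto
  have "?n (q {X}) \<le> \<theta> X * (1 + \<epsilon>) ^ card (nbrs {X} ?T)"
    using conjunct2[OF z_pos_and_q_bound[OF Diff_subset], rule_format, of "{X}" "{X}"] X by simp
  also have "\<dots> \<le> bd X"
    using card_nbrs_singleton[OF X Diff_subset T(2)] eps_pos
    by (intro mult_left_mono power_increasing theta_nonneg) simp_all
  finally have e: "?n (q {X}) \<le> bd X" .
  have b1: "bd X < 1" by (rule bd_less_1[OF X])
  have set: "{U. U \<subseteq> S \<and> X \<in> U} = insert X ` Pow ?T"
  proof (intro equalityI subsetI)
    fix U assume "U \<in> {U. U \<subseteq> S \<and> X \<in> U}"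
    then have "U = insert X (U - {X})" "U - {X} \<in> Pow ?T" by auto
    then show "U \<in> insert X ` Pow ?T" by blast
  qed (use X in auto)
  have inj: "inj_on (insert X) (Pow ?T)" by (auto simp: inj_on_def)
  have "(\<Sum>U | U \<subseteq> S \<and> X \<in> U. snorm I (\<lambda>i. mob (\<lambda>V. ln (z V i)) U) * (\<Prod>Y\<in>U. w Y))
     = (\<Sum>U\<in>Pow ?T. w X * (snorm I (\<lambda>i. mob (\<lambda>V. ln (z (insert X V) i) - ln (z V i)) U) * (\<Prod>Y\<in>U. w Y)))"
    unfolding set sum.reindex[OF inj] o_def
  proof (rule sum.cong[OF refl])
    fix U assume "U \<in> Pow ?T"
    then have "finite U" "X \<notin> U" using T by (auto intro: finite_subset)
    then show "snorm I (\<lambda>i. mob (\<lambda>V. ln (z V i)) (insert X U)) * (\<Prod>Y\<in>insert X U. w Y)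
      = w X * (snorm I (\<lambda>i. mob (\<lambda>V. ln (z (insert X V) i) - ln (z V i)) U) * (\<Prod>Y\<in>U. w Y))"
      by (simp add: mob_insert)
  qed
  also have "\<dots> = w X * ?n (\<lambda>V i. ln (z (insert X V) i) - ln (z V i))"
    by (simp add: wnorm_def sum_distrib_left)
  also have "?n (\<lambda>V i. ln (z (insert X V) i) - ln (z V i)) = ?n (\<lambda>V i. ln (1 + q {X} V i))"
  proof (rule wnorm_cong)
    fix V i assume V: "V \<subseteq> ?T" "i \<in> I"
    have z: "0 < z V i" "0 < z (insert X V) i" using V X by (auto intro!: z_pos)
    have "r {X} V i = z (insert X V) i - z V i"
      using mob_insert[of "{}" X "\<lambda>W. z (W \<union> V) i"] by (simp add: r_def)
    then have "1 + q {X} V i = z (insert X V) i / z V i"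
      using z by (simp add: q_def field_simps)
    then show "ln (z (insert X V) i) - ln (z V i) = ln (1 + q {X} V i)"
      using z by (simp add: ln_div)
  qed
  also have "w X * ?n (\<lambda>V i. ln (1 + q {X} V i)) \<le> w X * (bd X * (1 + \<epsilon> / 2))"
  proof (rule mult_left_mono)
    have "?n (\<lambda>V i. ln (1 + q {X} V i)) \<le> ?n (q {X}) / (1 - ?n (q {X}))"
      by (rule wnorm_ln) (use e b1 T in auto)
    also have "\<dots> \<le> bd X / (1 - bd X)"
      using e b1 by (intro frac_le) (auto simp: bd_nonneg)
    also have "\<dots> = bd X * (1 / (1 - bd X))" by simp
    also have "\<dots> \<le> bd X * (1 + \<epsilon> / 2)"
      by (intro mult_left_mono inverse_bd_le X bd_nonneg)
    finally show "?n (\<lambda>V i. ln (1 + q {X} V i)) \<le> bd X * (1 + \<epsilon> / 2)" .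
  qed (use w1[of X] in simp)
  finally show ?thesis by (simp add: mult.assoc)
qed

end

section \<open>Simultaneous diagonalisation of commuting Hermitian matrices\<close>

definition ip :: "'c set \<Rightarrow> ('c \<Rightarrow> complex) \<Rightarrow> ('c \<Rightarrow> complex) \<Rightarrow> complex" where
  "ip C u v = (\<Sum>x\<in>C. cnj (u x) * v x)"

text \<open>Setting the result to 0 off \<open>C\<close> makes eigenvector equations equalities of
  total functions and keeps images among the vectors supported on \<open>C\<close>.\<close>

definition mv :: "'c set \<Rightarrow> ('c \<Rightarrow> 'c \<Rightarrow> complex) \<Rightarrow> ('c \<Rightarrow> complex) \<Rightarrow> 'c \<Rightarrow> complex" where
  "mv C A u = (\<lambda>x. if x \<in> C then \<Sum>y\<in>C. A x y * u y else 0)"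

definition herm_on :: "'c set \<Rightarrow> ('c \<Rightarrow> 'c \<Rightarrow> complex) \<Rightarrow> bool" where
  "herm_on C A \<longleftrightarrow> (\<forall>x\<in>C. \<forall>y\<in>C. A x y = cnj (A y x))"

definition commute_on :: "'c set \<Rightarrow> ('c \<Rightarrow> 'c \<Rightarrow> complex) \<Rightarrow> ('c \<Rightarrow> 'c \<Rightarrow> complex) \<Rightarrow> bool" where
  "commute_on C A B \<longleftrightarrow> (\<forall>x\<in>C. \<forall>y\<in>C. (\<Sum>z\<in>C. A x z * B z y) = (\<Sum>z\<in>C. B x z * A z y))"

text \<open>Vectors are functions on a possibly infinite type, topologised as a product and
  vanishing off \<open>C\<close>. Closedness is carried along because the maximisation needs a
  compact unit sphere.\<close>

definition closed_subspace :: "'c set \<Rightarrow> ('c \<Rightarrow> complex) set \<Rightarrow> bool" where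
  "closed_subspace C W \<longleftrightarrow> (\<forall>u\<in>W. \<forall>x. x \<notin> C \<longrightarrow> u x = 0) \<and>
     (\<forall>u\<in>W. \<forall>v\<in>W. \<forall>c. (\<lambda>x. u x + c * v x) \<in> W) \<and> closed W"

lemma ip_add_right: "ip C u (\<lambda>x. v x + c * v' x) = ip C u v + c * ip C u v'"
  by (simp add: ip_def sum.distrib sum_distrib_left algebra_simps)

lemma ip_add_left: "ip C (\<lambda>x. v x + c * v' x) u = ip C v u + cnj c * ip C v' u"
  by (simp add: ip_def sum.distrib sum_distrib_left algebra_simps)

lemma ip_scale_right: "ip C u (\<lambda>x. c * v x) = c * ip C u v"
  by (simp add: ip_def sum_distrib_left algebra_simps)

lemma ip_scale_left: "ip C (\<lambda>x. c * v x) u = cnj c * ip C v u"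
  by (simp add: ip_def sum_distrib_left algebra_simps)

lemma cnj_ip: "cnj (ip C u v) = ip C v u"
  by (simp add: ip_def mult.commute)

lemma ip_self: "ip C u u = of_real (\<Sum>x\<in>C. (cmod (u x))\<^sup>2)"
  by (simp add: ip_def complex_norm_square mult.commute del: of_real_power)

lemma ip_self_eq_0:
  assumes "finite C" "ip C u u = 0" "x \<in> C"
  shows "u x = 0"
  using assms by (simp add: ip_self sum_nonneg_eq_0_iff flip: of_real_sum of_real_power)

lemma mv_add: "mv C A (\<lambda>x. u x + c * v x) = (\<lambda>x. mv C A u x + c * mv C A v x)"
  by (simp add: mv_def fun_eq_iff sum.distrib sum_distrib_left algebra_simps)

lemma mv_scale: "mv C A (\<lambda>x. c * v x) = (\<lambda>x. c * mv C A v x)"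
  by (simp add: mv_def fun_eq_iff sum_distrib_left algebra_simps)

lemma ip_mv: "ip C u (mv C A v) = (\<Sum>x\<in>C. \<Sum>y\<in>C. cnj (u x) * A x y * v y)"
  by (simp add: ip_def mv_def sum_distrib_left mult.assoc)

lemma ip_mv_herm:
  assumes "herm_on C A"
  shows "ip C (mv C A u) v = ip C u (mv C A v)"
proof -
  have "ip C (mv C A u) v = (\<Sum>x\<in>C. \<Sum>y\<in>C. cnj (A x y) * cnj (u y) * v x)"
    by (simp add: ip_def mv_def sum_distrib_right)
  also have "\<dots> = (\<Sum>y\<in>C. \<Sum>x\<in>C. cnj (A x y) * cnj (u y) * v x)" by (rule sum.swap)
  also have "\<dots> = (\<Sum>y\<in>C. \<Sum>x\<in>C. cnj (u y) * A y x * v x)"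
  proof (intro sum.cong refl)
    fix x y assume "x \<in> C" "y \<in> C"
    then have "A y x = cnj (A x y)" using assms unfolding herm_on_def by blast
    then show "cnj (A x y) * cnj (u y) * v x = cnj (u y) * A y x * v x" by simp
  qed
  finally show ?thesis by (simp add: ip_mv)
qed

lemma mv_commute:
  assumes "commute_on C A B"
  shows "mv C A (mv C B u) = mv C B (mv C A u)"
proof -
  have *: "mv C A (mv C B u) = (\<lambda>x. if x \<in> C then \<Sum>y\<in>C. (\<Sum>z\<in>C. A x z * B z y) * u y else 0)" for A B
  proof
    fix x
    have "(\<Sum>z\<in>C. \<Sum>y\<in>C. A x z * (B z y * u y)) = (\<Sum>y\<in>C. \<Sum>z\<in>C. A x z * (B z y * u y))"
      by (rule sum.swap)
    then show "mv C A (mv C B u) x = (if x \<in> C then \<Sum>y\<in>C. (\<Sum>z\<in>C. A x z * B z y) * u y else 0)"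
      by (simp add: mv_def sum_distrib_left sum_distrib_right mult.assoc)
  qed
  show ?thesis unfolding * using assms by (auto simp: commute_on_def fun_eq_iff)
qed

lemma continuous_on_mv: "continuous_on S (\<lambda>u. mv C A u x)"
  by (cases "x \<in> C") (auto simp: mv_def intro!: continuous_intros continuous_on_subset[OF continuous_on_product_coordinates])

lemma continuous_on_ip: "continuous_on S f \<Longrightarrow> continuous_on S g \<Longrightarrow> continuous_on S (\<lambda>u. ip C (f u) (g u))"
  unfolding ip_def by (intro continuous_intros) (auto intro: continuous_on_product_then_coordinatewise)

lemma closed_subspace_add: "closed_subspace C W \<Longrightarrow> u \<in> W \<Longrightarrow> v \<in> W \<Longrightarrow> (\<lambda>x. u x + c * v x) \<in> W"
  by (simp add: closed_subspace_def)

lemma closed_subspace_zero: "closed_subspace C W \<Longrightarrow> u \<in> W \<Longrightarrow> (\<lambda>x. 0) \<in> W"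
  using closed_subspace_add[of C W u u "-1"] by simp

lemma closed_subspace_scale: "closed_subspace C W \<Longrightarrow> u \<in> W \<Longrightarrow> (\<lambda>x. c * u x) \<in> W"
  using closed_subspace_add[of C W "\<lambda>x. 0" u c] closed_subspace_zero[of C W u] by simp

text \<open>Tychonoff: the sphere is a closed subset of a product of unit discs over
  \<open>C\<close> and singletons elsewhere.\<close>

lemma compact_unit_sphere:
  fixes W :: "('c \<Rightarrow> complex) set"
  assumes C: "finite C" and W: "closed_subspace C W"
  shows "compact {u \<in> W. ip C u u = 1}"
proof -
  let ?P = "Pi\<^sub>E UNIV (\<lambda>x. if x \<in> C then cball (0::complex) 1 else {0})"
  have "compactin (product_topology (\<lambda>_. euclidean) UNIV) ?P"
    by (subst compactin_PiE) auto
  then have "compact ?P" by (simp add: euclidean_product_topology)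
  moreover have "closed {u \<in> W. ip C u u = 1}"
  proof -
    have "{u \<in> W. ip C u u = 1} = W \<inter> {u. ip C u u = 1}" by auto
    then show ?thesis
      using W by (auto simp: closed_subspace_def intro!: closed_Int closed_Collect_eq continuous_on_ip)
  qed
  moreover have "{u \<in> W. ip C u u = 1} \<subseteq> ?P"
  proof
    fix u assume u: "u \<in> {u \<in> W. ip C u u = 1}"
    then have "(\<Sum>x\<in>C. (cmod (u x))\<^sup>2) = 1"
      by (metis (mono_tags, lifting) ip_self mem_Collect_eq of_real_eq_1_iff)
    moreover have "(cmod (u x))\<^sup>2 \<le> (\<Sum>x\<in>C. (cmod (u x))\<^sup>2)" if "x \<in> C" for x
      using that C by (intro member_le_sum) auto
    ultimately have "cmod (u x) \<le> 1" if "x \<in> C" for x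
      using that by (metis abs_norm_cancel abs_square_le_1)
    then show "u \<in> ?P" using u W by (auto simp: closed_subspace_def)
  qed
  ultimately show ?thesis
    using compact_Int_closed[of ?P "{u \<in> W. ip C u u = 1}"] by (simp add: Int_absorb1)
qed

text \<open>A maximiser of the Rayleigh quotient is an eigenvector.\<close>

lemma eigenvector_exists:
  fixes W :: "('c \<Rightarrow> complex) set"
  assumes C: "finite C" and W: "closed_subspace C W" and A: "herm_on C A"
    and inv: "\<And>u. u \<in> W \<Longrightarrow> mv C A u \<in> W" and u0: "u0 \<in> W" "u0 x0 \<noteq> 0"
  shows "\<exists>\<mu>::real. \<exists>u\<in>W. ip C u u = 1 \<and> mv C A u = (\<lambda>x. of_real \<mu> * u x)"
proof -
  let ?S = "{u \<in> W. ip C u u = 1}"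
  define R where "R = (\<lambda>u. Re (ip C u (mv C A u)))"
  have normalise: "\<exists>c. c \<noteq> 0 \<and> ip C (\<lambda>x. of_real c * u x) (\<lambda>x. of_real c * u x) = 1 \<and>
      ip C u u = of_real (1 / c\<^sup>2)" if "u \<in> W" "u x \<noteq> 0" for u x
  proof -
    define s where "s = (\<Sum>x\<in>C. (cmod (u x))\<^sup>2)"
    have "x \<in> C" using that W by (auto simp: closed_subspace_def)
    then have "(cmod (u x))\<^sup>2 \<le> s" unfolding s_def using C by (intro member_le_sum) auto
    then have s: "0 < s" using that by (smt (verit) zero_less_norm_iff zero_less_power)
    then have "complex_of_real (1 / sqrt s) * (complex_of_real (1 / sqrt s) * complex_of_real s) = 1"
      unfolding of_real_mult[symmetric] by (simp add: real_div_sqrt)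
    then have "1 / sqrt s \<noteq> 0 \<and> ip C (\<lambda>x. of_real (1 / sqrt s) * u x) (\<lambda>x. of_real (1 / sqrt s) * u x) = 1
        \<and> ip C u u = of_real (1 / (1 / sqrt s)\<^sup>2)"
      unfolding ip_scale_left ip_scale_right using s
      by (simp add: ip_self s_def[symmetric] power_divide real_sqrt_pow2)
    then show ?thesis by blast
  qed
  have ne: "?S \<noteq> {}"
    using normalise[OF u0] closed_subspace_scale[OF W u0(1)] by blast
  have "continuous_on ?S R"
    unfolding R_def
    by (intro continuous_intros continuous_on_ip continuous_on_coordinatewise_then_product continuous_on_mv)
  then obtain u where u: "u \<in> ?S" and max: "\<And>v. v \<in> ?S \<Longrightarrow> R v \<le> R u"
    using continuous_attains_sup[OF compact_unit_sphere[OF C W] ne] by blast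
  define \<mu> where "\<mu> = R u"
  \<comment> \<open>A nonnegative quadratic form on \<open>W\<close> that vanishes at the maximiser
    \<open>u\<close>. Perturbing \<open>u\<close> along the residual \<open>\<phi>\<close> would
    make it negative unless \<open>\<phi> = 0\<close>.\<close>
  define Q where "Q = (\<lambda>v. \<mu> * Re (ip C v v) - R v)"
  have Q0: "0 \<le> Q v" if v: "v \<in> W" for v
  proof (cases "\<exists>x. v x \<noteq> 0")
    case True
    then obtain x where "v x \<noteq> 0" by blast
    from normalise[OF v this] obtain c where c: "c \<noteq> 0"
      "ip C (\<lambda>x. of_real c * v x) (\<lambda>x. of_real c * v x) = 1" "ip C v v = of_real (1 / c\<^sup>2)" by blast
    have "R (\<lambda>x. of_real c * v x) \<le> \<mu>"
      unfolding \<mu>_def by (rule max) (use c closed_subspace_scale[OF W v] in auto)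
    moreover have "R (\<lambda>x. of_real c * v x) = c\<^sup>2 * R v"
      by (simp add: R_def mv_scale ip_scale_left ip_scale_right power2_eq_square mult.assoc)
    ultimately show ?thesis using c(1) by (simp add: Q_def c(3) field_simps)
  next
    case False
    then have "v = (\<lambda>x. 0)" by auto
    then show ?thesis by (simp add: Q_def R_def ip_def)
  qed
  define \<phi> where "\<phi> = (\<lambda>x. mv C A u x + (- of_real \<mu>) * u x)"
  have uW: "u \<in> W" and uu: "ip C u u = 1" using u by auto
  have \<phi>W: "\<phi> \<in> W"
    unfolding \<phi>_def by (rule closed_subspace_add[OF W inv[OF uW] uW])
  have re: "ip C \<phi> (mv C A u) - of_real \<mu> * ip C \<phi> u = ip C \<phi> \<phi>"
    using ip_add_right[of C \<phi> "mv C A u" "- of_real \<mu>" u] by (simp add: \<phi>_def)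
  have quad: "0 \<le> - 2 * t * Re (ip C \<phi> \<phi>) + t\<^sup>2 * Q \<phi>" for t :: real
  proof -
    let ?v = "\<lambda>x. u x + of_real t * \<phi> x"
    have sw: "ip C u (mv C A \<phi>) = cnj (ip C \<phi> (mv C A u))" "ip C u \<phi> = cnj (ip C \<phi> u)"
      by (simp_all add: cnj_ip ip_mv_herm[OF A])
    have "R ?v = R u + 2 * t * Re (ip C \<phi> (mv C A u)) + t\<^sup>2 * R \<phi>"
      unfolding R_def mv_add ip_add_left ip_add_right sw by (simp add: algebra_simps power2_eq_square)
    moreover have "Re (ip C ?v ?v) = 1 + 2 * t * Re (ip C \<phi> u) + t\<^sup>2 * Re (ip C \<phi> \<phi>)"
      unfolding ip_add_left ip_add_right sw uu by (simp add: algebra_simps power2_eq_square)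
    moreover have "Re (ip C \<phi> (mv C A u)) - \<mu> * Re (ip C \<phi> u) = Re (ip C \<phi> \<phi>)"
      unfolding re[symmetric] by simp
    ultimately have "Q ?v = - 2 * t * Re (ip C \<phi> \<phi>) + t\<^sup>2 * Q \<phi>"
      unfolding Q_def \<mu>_def[symmetric] by algebra
    moreover have "?v \<in> W" by (rule closed_subspace_add[OF W uW \<phi>W])
    ultimately show ?thesis using Q0 by metis
  qed
  have nn: "0 \<le> Re (ip C \<phi> \<phi>)" by (simp add: ip_self sum_nonneg)
  have "Re (ip C \<phi> \<phi>) = 0"
  proof (rule ccontr)
    assume "\<not> ?thesis"
    with nn have p: "0 < Re (ip C \<phi> \<phi>)" by simp
    \<comment> \<open>With this step size the quadratic term is at most half of the linear one; the
      1 in the denominator keeps it positive when \<open>Q \<phi> = 0\<close>.\<close>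
    define t where "t = Re (ip C \<phi> \<phi>) / (1 + Q \<phi>)"
    have q: "0 < 1 + Q \<phi>" using Q0[OF \<phi>W] by simp
    have t: "0 < t" "t * Q \<phi> \<le> Re (ip C \<phi> \<phi>)"
      using p q Q0[OF \<phi>W] by (auto simp: t_def field_simps)
    have "t * (t * Q \<phi>) \<le> t * Re (ip C \<phi> \<phi>)" using t by (intro mult_left_mono) auto
    moreover have "0 < t * Re (ip C \<phi> \<phi>)" using t p by simp
    ultimately show False using quad[of t] by (simp add: power2_eq_square)
  qed
  then have "ip C \<phi> \<phi> = 0" by (simp add: ip_self)
  then have "\<phi> x = 0" for x
    using ip_self_eq_0[OF C] \<phi>W W by (cases "x \<in> C") (auto simp: closed_subspace_def)
  then have "mv C A u = (\<lambda>x. of_real \<mu> * u x)" by (auto simp: \<phi>_def fun_eq_iff)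
  then show ?thesis using uW uu by blast
qed

text \<open>An eigenspace of one matrix inside \<open>W\<close> is again a closed subspace, and
  matrices commuting with it map it into itself. The induction over \<open>F\<close> therefore
  shrinks \<open>W\<close>.\<close>

lemma joint_eigenvector_exists:
  fixes W :: "('c \<Rightarrow> complex) set"
  assumes C: "finite C" and "finite F"
    and "\<And>A. A \<in> F \<Longrightarrow> herm_on C A"
    and "\<And>A B. A \<in> F \<Longrightarrow> B \<in> F \<Longrightarrow> commute_on C A B"
    and "closed_subspace C W" and "\<And>A u. A \<in> F \<Longrightarrow> u \<in> W \<Longrightarrow> mv C A u \<in> W"
    and "u0 \<in> W" "u0 x0 \<noteq> 0"
  shows "\<exists>u\<in>W. (\<exists>x. u x \<noteq> 0) \<and> (\<forall>A\<in>F. \<exists>\<mu>::real. mv C A u = (\<lambda>x. of_real \<mu> * u x))"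
  using assms(2-)
proof (induction F arbitrary: W u0 x0 rule: finite_induct)
  case (insert A F)
  note W = insert.prems(3)
  obtain \<mu> :: real and u where u: "u \<in> W" "ip C u u = 1" "mv C A u = (\<lambda>x. of_real \<mu> * u x)"
    using eigenvector_exists[OF C W insert.prems(1)[OF insertI1] insert.prems(4)[OF insertI1]
        insert.prems(5,6)] by auto
  define W' where "W' = {u \<in> W. mv C A u = (\<lambda>x. of_real \<mu> * u x)}"
  have "\<exists>x. u x \<noteq> 0"
  proof (rule ccontr)
    assume "\<not> ?thesis"
    then have "ip C u u = 0" by (simp add: ip_def)
    with u(2) show False by simp
  qed
  then obtain x where x: "u x \<noteq> 0" by blast
  have cl: "closed_subspace C W'"
    unfolding closed_subspace_def
  proof (intro conjI)
    show "\<forall>u\<in>W'. \<forall>x. x \<notin> C \<longrightarrow> u x = 0" using W by (auto simp: closed_subspace_def W'_def)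
    show "\<forall>u\<in>W'. \<forall>v\<in>W'. \<forall>c. (\<lambda>x. u x + c * v x) \<in> W'"
      using W by (auto simp: closed_subspace_def W'_def mv_add algebra_simps)
    have "W' = W \<inter> (\<Inter>x. {u. mv C A u x = of_real \<mu> * u x})"
      by (auto simp: W'_def fun_eq_iff)
    moreover have "closed \<dots>"
      using W by (auto simp: closed_subspace_def
          intro!: closed_Int closed_INT closed_Collect_eq continuous_on_mv continuous_intros)
    ultimately show "closed W'" by simp
  qed
  have inv: "mv C B v \<in> W'" if B: "B \<in> F" and v: "v \<in> W'" for B v
  proof -
    have "mv C A (mv C B v) = mv C B (mv C A v)"
      by (rule mv_commute) (use B insert.prems(2) in auto)
    also have "\<dots> = (\<lambda>x. of_real \<mu> * mv C B v x)" using v by (simp add: W'_def mv_scale)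
    finally show ?thesis using B v insert.prems(4) by (auto simp: W'_def)
  qed
  have "\<exists>u\<in>W'. (\<exists>x. u x \<noteq> 0) \<and> (\<forall>B\<in>F. \<exists>\<mu>::real. mv C B u = (\<lambda>x. of_real \<mu> * u x))"
    by (rule insert.IH[OF _ _ cl inv, of u x]) (use insert.prems u x in \<open>auto simp: W'_def\<close>)
  then show ?case unfolding W'_def by blast
qed auto

definition orthonormal :: "'c set \<Rightarrow> ('c \<Rightarrow> complex) set \<Rightarrow> bool" where
  "orthonormal C B \<longleftrightarrow> finite B \<and> (\<forall>u\<in>B. \<forall>v\<in>B. ip C u v = (if u = v then 1 else 0))"

text \<open>\<open>e\<close> is the unit vector at \<open>c\<close> minus its projection onto the
  span of \<open>B\<close>. Its norm gives Bessel's inequality; its orthogonality to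
  \<open>B\<close> later gives completeness.\<close>

lemma orthonormal_residual:
  assumes C: "finite C" and B: "orthonormal C B" and c: "c \<in> C"
  defines "e \<equiv> \<lambda>x. (if x = c then 1 else 0) + (- 1) * (\<Sum>v\<in>B. cnj (v c) * v x)"
  shows "v \<in> B \<Longrightarrow> ip C v e = 0"
    and "ip C e e = 1 - of_real (\<Sum>v\<in>B. (cmod (v c))\<^sup>2)"
proof -
  let ?d = "\<lambda>x. if x = c then 1 else (0::complex)"
  let ?p = "\<lambda>x. \<Sum>v\<in>B. cnj (v c) * v x"
  have d: "ip C v ?d = cnj (v c)" for v
    using c C by (simp add: ip_def if_distrib cong: if_cong)
  have p: "ip C u ?p = (\<Sum>v\<in>B. cnj (v c) * ip C u v)" for u
    unfolding ip_def sum_distrib_left by (subst sum.swap) (simp add: algebra_simps)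
  have orth: "ip C v e = 0" if "v \<in> B" for v
  proof -
    have "(\<Sum>u\<in>B. cnj (u c) * ip C v u) = (\<Sum>u\<in>B. if u = v then cnj (v c) else 0)"
      using B that by (intro sum.cong) (auto simp: orthonormal_def)
    also have "\<dots> = cnj (v c)" using B that by (simp add: orthonormal_def)
    finally show ?thesis unfolding e_def ip_add_right d p by simp
  qed
  then show "v \<in> B \<Longrightarrow> ip C v e = 0" .
  have "ip C e ?p = 0"
    unfolding p using orth by (auto intro!: sum.neutral) (metis cnj_ip complex_cnj_zero)
  then have "ip C e e = ip C e ?d" unfolding e_def ip_add_right by simp
  also have "\<dots> = cnj (e c)" by (rule d)
  also have "\<dots> = 1 - (\<Sum>v\<in>B. v c * cnj (v c))" by (simp add: e_def)
  also have "\<dots> = 1 - of_real (\<Sum>v\<in>B. (cmod (v c))\<^sup>2)" by (simp add: complex_norm_square del: of_real_power)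
  finally show "ip C e e = 1 - of_real (\<Sum>v\<in>B. (cmod (v c))\<^sup>2)" .
qed

text \<open>Bessel's inequality is summed over all unit vectors, and exchanging the sums counts each
  member of \<open>B\<close> once. The bound guarantees that a largest orthonormal family
  exists.\<close>

lemma card_orthonormal_le:
  assumes C: "finite C" and B: "orthonormal C B"
  shows "card B \<le> card C"
proof -
  have bessel: "(\<Sum>v\<in>B. (cmod (v c))\<^sup>2) \<le> 1" if "c \<in> C" for c
  proof -
    define e where "e = (\<lambda>x. (if x = c then 1 else 0) + (- 1) * (\<Sum>v\<in>B. cnj (v c) * v x))"
    have "Re (ip C e e) = Re (1 - of_real (\<Sum>v\<in>B. (cmod (v c))\<^sup>2))"
      unfolding e_def orthonormal_residual(2)[OF C B that] ..
    moreover have "Re (ip C e e) \<ge> 0" unfolding ip_self by (simp add: sum_nonneg)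
    ultimately show ?thesis by simp
  qed
  have "(\<Sum>x\<in>C. (cmod (v x))\<^sup>2) = 1" if "v \<in> B" for v
    using B that ip_self[of C v] unfolding orthonormal_def by (metis of_real_eq_1_iff)
  then have "real (card B) = (\<Sum>v\<in>B. \<Sum>x\<in>C. (cmod (v x))\<^sup>2)" by simp
  also have "\<dots> = (\<Sum>x\<in>C. \<Sum>v\<in>B. (cmod (v x))\<^sup>2)" by (rule sum.swap)
  also have "\<dots> \<le> real (card C)" using sum_mono[of C _ "\<lambda>_. 1", OF bessel] by simp
  finally show ?thesis by simp
qed

text \<open>Take a largest orthonormal family of joint eigenvectors. Its orthogonal complement is
  invariant by Hermiticity, so a nonzero vector in it would produce one more joint eigenvector.
  Hence the complement is 0, and vanishing of the residuals is the completeness relation.\<close>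

theorem joint_eigenbasis_exists:
  fixes F :: "('c \<Rightarrow> 'c \<Rightarrow> complex) set"
  assumes C: "finite C" and F: "finite F"
    and H: "\<And>A. A \<in> F \<Longrightarrow> herm_on C A"
    and comm: "\<And>A B. A \<in> F \<Longrightarrow> B \<in> F \<Longrightarrow> commute_on C A B"
  shows "\<exists>B (ev :: ('c \<Rightarrow> 'c \<Rightarrow> complex) \<Rightarrow> ('c \<Rightarrow> complex) \<Rightarrow> real). orthonormal C B \<and>
     (\<forall>x\<in>C. \<forall>y\<in>C. (\<Sum>v\<in>B. v x * cnj (v y)) = (if x = y then 1 else 0)) \<and>
     (\<forall>A\<in>F. \<forall>v\<in>B. \<forall>x\<in>C. (\<Sum>y\<in>C. A x y * v y) = of_real (ev A v) * v x)"
proof -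
  define good where "good = (\<lambda>B. orthonormal C B \<and> (\<forall>v\<in>B. \<forall>x. x \<notin> C \<longrightarrow> v x = 0) \<and>
     (\<forall>A\<in>F. \<forall>v\<in>B. \<exists>\<mu>::real. mv C A v = (\<lambda>x. of_real \<mu> * v x)))"
  have "good {}" by (simp add: good_def orthonormal_def)
  moreover have "\<forall>B. good B \<longrightarrow> card B \<le> card C"
    using card_orthonormal_le[OF C] by (auto simp: good_def)
  ultimately obtain B where B: "good B" and max: "\<And>B'. good B' \<Longrightarrow> card B' \<le> card B"
    using ex_has_greatest_nat[of good "{}" card "Suc (card C)"] by (auto simp: less_Suc_eq_le)
  have onB: "orthonormal C B" using B by (simp add: good_def)
  define W where "W = {u. (\<forall>x. x \<notin> C \<longrightarrow> u x = 0) \<and> (\<forall>v\<in>B. ip C v u = 0)}"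
  have W0: "u x = 0" if uW: "u \<in> W" for u x
  proof (rule ccontr)
    assume nz: "u x \<noteq> 0"
    have cl: "closed_subspace C W"
      unfolding closed_subspace_def
    proof (intro conjI)
      have "W = (\<Inter>x\<in>-C. {u. u x = 0}) \<inter> (\<Inter>v\<in>B. {u. ip C v u = 0})"
        by (auto simp: W_def)
      moreover have "closed \<dots>"
        by (intro closed_Int closed_INT ballI closed_Collect_eq continuous_on_ip continuous_intros) auto
      ultimately show "closed W" by simp
    qed (auto simp: W_def ip_add_right)
    have inv: "mv C A u \<in> W" if A: "A \<in> F" and u: "u \<in> W" for A u
    proof -
      have "ip C v (mv C A u) = 0" if v: "v \<in> B" for v
      proof -
        obtain \<mu> :: real where "mv C A v = (\<lambda>x. of_real \<mu> * v x)"
          using B A v unfolding good_def by blast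
        then have "ip C v (mv C A u) = of_real \<mu> * ip C v u"
          by (simp add: ip_mv_herm[OF H[OF A], symmetric] ip_scale_left)
        then show ?thesis using u v by (simp add: W_def)
      qed
      then show ?thesis by (simp add: W_def mv_def)
    qed
    obtain u where u: "u \<in> W" "\<exists>x. u x \<noteq> 0" "\<And>A. A \<in> F \<Longrightarrow> \<exists>\<mu>::real. mv C A u = (\<lambda>x. of_real \<mu> * u x)"
      using joint_eigenvector_exists[OF C F H comm cl inv uW nz] by blast
    define s where "s = (\<Sum>x\<in>C. (cmod (u x))\<^sup>2)"
    have s: "0 < s"
    proof -
      obtain y where y: "u y \<noteq> 0" using u by blast
      then have "y \<in> C" using u by (auto simp: W_def)
      then have "(cmod (u y))\<^sup>2 \<le> s" unfolding s_def using C by (intro member_le_sum) auto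
      with y show ?thesis by (smt (verit) zero_less_norm_iff zero_less_power)
    qed
    define u' where "u' = (\<lambda>x. of_real (1 / sqrt s) * u x)"
    have "complex_of_real (1 / sqrt s) * (complex_of_real (1 / sqrt s) * complex_of_real s) = 1"
      unfolding of_real_mult[symmetric] using s by (simp add: real_div_sqrt)
    then have n: "ip C u' u' = 1"
      unfolding u'_def ip_scale_left ip_scale_right ip_self s_def by simp
    have orth: "ip C v u' = 0" "ip C u' v = 0" if "v \<in> B" for v
    proof -
      show "ip C v u' = 0" using u(1) that unfolding u'_def ip_scale_right by (simp add: W_def)
      then show "ip C u' v = 0" by (metis cnj_ip complex_cnj_zero)
    qed
    have "u' \<notin> B" using n orth(1)[of u'] by auto
    have "good (insert u' B)"
      unfolding good_def
    proof (intro conjI)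
      show "orthonormal C (insert u' B)"
        using onB n orth \<open>u' \<notin> B\<close> by (auto simp: orthonormal_def)
      show "\<forall>v\<in>insert u' B. \<forall>x. x \<notin> C \<longrightarrow> v x = 0"
        using B u(1) by (auto simp: good_def u'_def W_def)
      show "\<forall>A\<in>F. \<forall>v\<in>insert u' B. \<exists>\<mu>::real. mv C A v = (\<lambda>x. of_real \<mu> * v x)"
      proof (intro ballI)
        fix A v assume A: "A \<in> F" and v: "v \<in> insert u' B"
        show "\<exists>\<mu>::real. mv C A v = (\<lambda>x. of_real \<mu> * v x)"
        proof (cases "v = u'")
          case True
          obtain \<mu> :: real where "mv C A u = (\<lambda>x. of_real \<mu> * u x)" using u(3) A by blast
          then have "mv C A u' = (\<lambda>x. of_real \<mu> * u' x)"
            unfolding u'_def mv_scale by (simp add: algebra_simps)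
          then show ?thesis using True by blast
        qed (use v A B in \<open>auto simp: good_def\<close>)
      qed
    qed
    from max[OF this] show False using \<open>u' \<notin> B\<close> onB by (simp add: orthonormal_def)
  qed
  have complete: "(\<Sum>v\<in>B. v x * cnj (v y)) = (if x = y then 1 else 0)" if "x \<in> C" "y \<in> C" for x y
  proof -
    define e where "e = (\<lambda>x. (if x = y then 1 else 0) + (- 1) * (\<Sum>v\<in>B. cnj (v y) * v x))"
    have "e \<in> W"
      using orthonormal_residual(1)[OF C onB that(2)] B that(2)
      by (auto simp: W_def e_def good_def intro!: sum.neutral)
    from W0[OF this, of x] show ?thesis by (simp add: e_def mult.commute)
  qed
  have "\<forall>A\<in>F. \<forall>v\<in>B. \<exists>\<mu>::real. \<forall>x\<in>C. (\<Sum>y\<in>C. A x y * v y) = of_real \<mu> * v x"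
    using B unfolding good_def by (metis mv_def)
  then obtain ev :: "('c \<Rightarrow> 'c \<Rightarrow> complex) \<Rightarrow> ('c \<Rightarrow> complex) \<Rightarrow> real"
    where "\<forall>A\<in>F. \<forall>v\<in>B. \<forall>x\<in>C. (\<Sum>y\<in>C. A x y * v y) = of_real (ev A v) * v x"
    by metis
  then show ?thesis using onB complete by blast
qed

section \<open>Local operators and the normalised partial trace\<close>

lemma r0_r0 [simp]: "r0 X (r0 Y \<sigma>) = r0 (X \<inter> Y) \<sigma>"
  by (auto simp: r0_def)

lemma r0_cfgs: "\<sigma> \<in> cfgs D X \<Longrightarrow> r0 X \<sigma> = \<sigma>"
  by (auto simp: r0_def cfgs_def)

lemma cfgs_bij_PiE: "bij_betw (\<lambda>\<sigma>. restrict \<sigma> X) (cfgs D X) (X \<rightarrow>\<^sub>E {..<D})"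
  by (rule bij_betw_byWitness[where f' = "\<lambda>\<sigma> v. if v \<in> X then \<sigma> v else 0"])
    (auto simp: cfgs_def fun_eq_iff PiE_def extensional_def split: if_splits)

lemma finite_cfgs: "finite X \<Longrightarrow> finite (cfgs D X)"
  using bij_betw_finite[OF cfgs_bij_PiE[of X D]] by (simp add: finite_PiE)

lemma card_cfgs: "finite X \<Longrightarrow> card (cfgs D X) = D ^ card X"
  using bij_betw_same_card[OF cfgs_bij_PiE[of X D]] by (simp add: card_PiE)

lemma sum_cfgs_Un:
  assumes "X \<inter> Y = {}"
  shows "(\<Sum>\<sigma>\<in>cfgs D (X \<union> Y). g \<sigma>) = (\<Sum>\<eta>\<in>cfgs D Y. \<Sum>\<sigma>\<in>cfgs D X. g (upd X \<eta> \<sigma>))"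
proof -
  have "(\<Sum>\<sigma>\<in>cfgs D (X \<union> Y). g \<sigma>) = (\<Sum>(\<eta>, \<sigma>)\<in>cfgs D Y \<times> cfgs D X. g (upd X \<eta> \<sigma>))"
    by (rule sum.reindex_bij_witness[where i = "\<lambda>(\<eta>, \<sigma>). upd X \<eta> \<sigma>" and j = "\<lambda>\<sigma>. (r0 Y \<sigma>, r0 X \<sigma>)"])
      (use assms in \<open>auto simp: cfgs_def r0_def upd_def fun_eq_iff intro!: arg_cong[where f = g]\<close>)
  then show ?thesis by (simp add: sum.cartesian_product)
qed

lemma card_Diff_add: "finite X \<Longrightarrow> Y \<subseteq> X \<Longrightarrow> card X = card Y + card (X - Y)"
  by (metis card_Diff_subset card_mono finite_subset le_add_diff_inverse)

locale spin =
  fixes D :: nat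
  assumes D_pos: "0 < D"
begin

text \<open>The embedding of a matrix on the configurations of \<open>X\<close> as Q tensor
  identity; locality in \<open>X\<close> means being fixed by it.\<close>

definition lext :: "'v set \<Rightarrow> 'v op \<Rightarrow> 'v op" where
  "lext X k = (\<lambda>\<sigma> \<tau>. if valid D \<sigma> \<and> valid D \<tau> \<and> (\<forall>v. v \<notin> X \<longrightarrow> \<sigma> v = \<tau> v)
     then k (r0 X \<sigma>) (r0 X \<tau>) else 0)"

lemma valid_r0: "valid D \<sigma> \<Longrightarrow> valid D (r0 X \<sigma>)"
  using D_pos by (simp add: valid_def r0_def)

lemma r0_in_cfgs: "valid D \<sigma> \<Longrightarrow> r0 X \<sigma> \<in> cfgs D X"
  by (simp add: valid_def r0_def cfgs_def)

lemma valid_cfgs: "\<sigma> \<in> cfgs D X \<Longrightarrow> valid D \<sigma>"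
  using D_pos by (force simp: valid_def cfgs_def)

lemma valid_upd: "valid D \<sigma> \<Longrightarrow> \<omega> \<in> cfgs D X \<Longrightarrow> valid D (upd X \<sigma> \<omega>)"
  by (simp add: valid_def upd_def cfgs_def)

lemma cfgs_mono: "X \<subseteq> Y \<Longrightarrow> cfgs D X \<subseteq> cfgs D Y"
  using D_pos by (fastforce simp: cfgs_def)

lemma cfgs_nonempty: "cfgs D X \<noteq> {}"
  using D_pos by (auto simp: cfgs_def intro!: exI[of _ "\<lambda>_. 0"])

lemma loc_inD: "loc_in D X K \<Longrightarrow> K \<sigma> \<tau> =
     (if valid D \<sigma> \<and> valid D \<tau> \<and> (\<forall>v. v \<notin> X \<longrightarrow> \<sigma> v = \<tau> v)
      then K (r0 X \<sigma>) (r0 X \<tau>) else 0)"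
  unfolding loc_in_def by blast

lemma loc_in_iff: "loc_in D X K \<longleftrightarrow> K = lext X K"
  unfolding loc_in_def lext_def fun_eq_iff ..

lemma loc_in_r0:
  assumes "loc_in D X K" "valid D \<sigma>" "valid D \<tau>" "\<And>v. v \<notin> X \<Longrightarrow> \<sigma> v = \<tau> v"
  shows "K \<sigma> \<tau> = K (r0 X \<sigma>) (r0 X \<tau>)"
proof -
  have c: "valid D \<sigma> \<and> valid D \<tau> \<and> (\<forall>v. v \<notin> X \<longrightarrow> \<sigma> v = \<tau> v)" using assms by blast
  show ?thesis using loc_inD[OF assms(1), of \<sigma> \<tau>] unfolding if_P[OF c] .
qed

lemma loc_in_off:
  assumes "loc_in D X K" "\<not> (valid D \<sigma> \<and> valid D \<tau> \<and> (\<forall>v. v \<notin> X \<longrightarrow> \<sigma> v = \<tau> v))"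
  shows "K \<sigma> \<tau> = 0"
  using loc_inD[OF assms(1), of \<sigma> \<tau>] unfolding if_not_P[OF assms(2)] .

lemma loc_in_zero: "loc_in D X K \<Longrightarrow> v \<notin> X \<Longrightarrow> \<sigma> v \<noteq> \<tau> v \<Longrightarrow> K \<sigma> \<tau> = 0"
  using loc_in_off[of X K \<sigma> \<tau>] by blast

lemma loc_in_invalid: "loc_in D X K \<Longrightarrow> \<not> (valid D \<sigma> \<and> valid D \<tau>) \<Longrightarrow> K \<sigma> \<tau> = 0"
  using loc_in_off[of X K \<sigma> \<tau>] by blast

lemma loc_inI:
  assumes "\<And>\<sigma> \<tau>. valid D \<sigma> \<Longrightarrow> valid D \<tau> \<Longrightarrow> (\<And>v. v \<notin> X \<Longrightarrow> \<sigma> v = \<tau> v) \<Longrightarrow> K \<sigma> \<tau> = K (r0 X \<sigma>) (r0 X \<tau>)"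
    and "\<And>\<sigma> \<tau>. \<not> (valid D \<sigma> \<and> valid D \<tau> \<and> (\<forall>v. v \<notin> X \<longrightarrow> \<sigma> v = \<tau> v)) \<Longrightarrow> K \<sigma> \<tau> = 0"
  shows "loc_in D X K"
  unfolding loc_in_def
proof (intro allI)
  fix \<sigma> \<tau>
  show "K \<sigma> \<tau> = (if valid D \<sigma> \<and> valid D \<tau> \<and> (\<forall>v. v \<notin> X \<longrightarrow> \<sigma> v = \<tau> v)
      then K (r0 X \<sigma>) (r0 X \<tau>) else 0)" (is "_ = (if ?c then _ else 0)")
  proof (cases ?c)
    case True
    show ?thesis unfolding if_P[OF True] using True by (intro assms(1)) auto
  next
    case False
    show ?thesis unfolding if_not_P[OF False] by (rule assms(2)[OF False])
  qed
qed

lemma loc_in_lext: "loc_in D X (lext X k)"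
  by (rule loc_inI) (auto simp: lext_def valid_r0, auto simp: r0_def)

lemma lext_cfgs: "\<sigma> \<in> cfgs D X \<Longrightarrow> \<tau> \<in> cfgs D X \<Longrightarrow> lext X k \<sigma> \<tau> = k \<sigma> \<tau>"
  by (simp add: lext_def r0_cfgs valid_cfgs) (auto simp: cfgs_def)

lemma lext_cong: "(\<And>\<sigma> \<tau>. \<sigma> \<in> cfgs D X \<Longrightarrow> \<tau> \<in> cfgs D X \<Longrightarrow> k \<sigma> \<tau> = k' \<sigma> \<tau>) \<Longrightarrow> lext X k = lext X k'"
  by (auto simp: lext_def fun_eq_iff r0_in_cfgs)

text \<open>A local operator is determined by a finite matrix. Most operator identities below are
  reduced to matrix entries this way.\<close>

lemma loc_in_eqI:
  assumes "loc_in D X K" "loc_in D X M"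
    and "\<And>\<sigma> \<tau>. \<sigma> \<in> cfgs D X \<Longrightarrow> \<tau> \<in> cfgs D X \<Longrightarrow> K \<sigma> \<tau> = M \<sigma> \<tau>"
  shows "K = M"
proof -
  have 1: "K = lext X K" and 2: "M = lext X M" using assms(1,2) by (simp_all only: loc_in_iff[symmetric])
  have "lext X K = lext X M" by (rule lext_cong[OF assms(3)])
  then show ?thesis using 1 2 by (rule box_equals[OF _ sym sym])
qed

lemma loc_in_mono:
  assumes K: "loc_in D X K" and XY: "X \<subseteq> Y"
  shows "loc_in D Y K"
  unfolding loc_in_def
proof (intro allI)
  fix \<sigma> \<tau>
  show "K \<sigma> \<tau> = (if valid D \<sigma> \<and> valid D \<tau> \<and> (\<forall>v. v \<notin> Y \<longrightarrow> \<sigma> v = \<tau> v)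
      then K (r0 Y \<sigma>) (r0 Y \<tau>) else 0)"
  proof (cases "valid D \<sigma> \<and> valid D \<tau> \<and> (\<forall>v. v \<notin> Y \<longrightarrow> \<sigma> v = \<tau> v)")
    case False
    then show ?thesis using loc_in_invalid[OF K, of \<sigma> \<tau>] loc_in_zero[OF K, of _ \<sigma> \<tau>] XY by auto
  next
    case ok: True
    show ?thesis
    proof (cases "\<forall>v. v \<notin> X \<longrightarrow> \<sigma> v = \<tau> v")
      case True
      have "K (r0 Y \<sigma>) (r0 Y \<tau>) = K (r0 X (r0 Y \<sigma>)) (r0 X (r0 Y \<tau>))"
        by (rule loc_in_r0[OF K]) (use True ok in \<open>simp_all add: valid_r0\<close>, simp add: r0_def)
      also have "\<dots> = K \<sigma> \<tau>"
        using loc_in_r0[OF K, of \<sigma> \<tau>] ok True XY by (simp add: Int_absorb2)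
      finally show ?thesis using ok by simp
    next
      case False
      then obtain v where v: "v \<notin> X" "\<sigma> v \<noteq> \<tau> v" by blast
      then have "v \<in> Y" using ok by blast
      then have "K (r0 Y \<sigma>) (r0 Y \<tau>) = 0" "K \<sigma> \<tau> = 0"
        using v by (auto intro!: loc_in_zero[OF K, of v] simp: r0_def)
      then show ?thesis by simp
    qed
  qed
qed

lemma loc_in_add:
  assumes "loc_in D X K" "loc_in D X M"
  shows "loc_in D X (\<lambda>\<sigma> \<tau>. K \<sigma> \<tau> + M \<sigma> \<tau>)"
proof (rule loc_inI)
  fix \<sigma> \<tau> assume a: "valid D \<sigma>" "valid D \<tau>" "\<And>v. v \<notin> X \<Longrightarrow> \<sigma> v = \<tau> v"
  show "K \<sigma> \<tau> + M \<sigma> \<tau> = K (r0 X \<sigma>) (r0 X \<tau>) + M (r0 X \<sigma>) (r0 X \<tau>)"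
    by (rule arg_cong2[where f = "(+)", OF loc_in_r0[OF assms(1) a] loc_in_r0[OF assms(2) a]])
next
  fix \<sigma> \<tau> assume a: "\<not> (valid D \<sigma> \<and> valid D \<tau> \<and> (\<forall>v. v \<notin> X \<longrightarrow> \<sigma> v = \<tau> v))"
  show "K \<sigma> \<tau> + M \<sigma> \<tau> = 0"
    unfolding loc_in_off[OF assms(1) a] loc_in_off[OF assms(2) a] by simp
qed

lemma loc_in_scale:
  assumes "loc_in D X K"
  shows "loc_in D X (\<lambda>\<sigma> \<tau>. c * K \<sigma> \<tau>)"
proof (rule loc_inI)
  fix \<sigma> \<tau> assume a: "valid D \<sigma>" "valid D \<tau>" "\<And>v. v \<notin> X \<Longrightarrow> \<sigma> v = \<tau> v"
  show "c * K \<sigma> \<tau> = c * K (r0 X \<sigma>) (r0 X \<tau>)"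
    by (rule arg_cong[OF loc_in_r0[OF assms a]])
next
  fix \<sigma> \<tau> assume a: "\<not> (valid D \<sigma> \<and> valid D \<tau> \<and> (\<forall>v. v \<notin> X \<longrightarrow> \<sigma> v = \<tau> v))"
  show "c * K \<sigma> \<tau> = 0"
    unfolding loc_in_off[OF assms a] by simp
qed

lemma loc_in_zero_op: "loc_in D X (\<lambda>\<sigma> \<tau>. 0)"
  unfolding loc_in_def by simp

lemma loc_in_sum: "(\<And>i. i \<in> S \<Longrightarrow> loc_in D X (K i)) \<Longrightarrow> loc_in D X (\<lambda>\<sigma> \<tau>. \<Sum>i\<in>S. K i \<sigma> \<tau>)"
  by (induction S rule: infinite_finite_induct) (auto simp: loc_in_zero_op loc_in_add)

lemma loc_in_gid: "loc_in D X (gid D)"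
proof (rule loc_inI)
  fix \<sigma> \<tau> :: "'a cfg"
  assume v: "valid D \<sigma>" and a: "\<And>v. v \<notin> X \<Longrightarrow> \<sigma> v = \<tau> v"
  have "\<sigma> x = \<tau> x" if "r0 X \<sigma> = r0 X \<tau>" for x
    using a[of x] fun_cong[OF that, of x] by (cases "x \<in> X") (simp_all add: r0_def)
  then show "gid D \<sigma> \<tau> = gid D (r0 X \<sigma>) (r0 X \<tau>)"
    using v by (auto simp: gid_def valid_r0)
qed (auto simp: gid_def)

text \<open>A factor \<open>K \<sigma> \<rho>\<close> vanishes unless \<open>\<rho>\<close> agrees
  with \<open>\<sigma>\<close> off \<open>X\<close>, so the infinite sum runs over finitely many
  \<open>upd X \<sigma> \<omega>\<close> and becomes ordinary matrix multiplication.\<close>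

lemma gmult_loc_in:
  assumes X: "finite X" and K: "loc_in D X K" and M: "loc_in D X M"
  shows "gmult K M = lext X (\<lambda>\<sigma> \<tau>. \<Sum>\<rho>\<in>cfgs D X. K \<sigma> \<rho> * M \<rho> \<tau>)"
proof (intro ext)
  fix \<sigma> \<tau> :: "'a cfg"
  have inj: "inj_on (upd X \<sigma>) (cfgs D X)"
  proof (rule inj_onI)
    fix x y assume "x \<in> cfgs D X" "y \<in> cfgs D X" "upd X \<sigma> x = upd X \<sigma> y"
    then show "x = y" by (auto simp: upd_def cfgs_def fun_eq_iff) metis
  qed
  have supp: "K \<sigma> \<rho> = 0" if "\<rho> \<notin> upd X \<sigma> ` cfgs D X" for \<rho>
  proof (rule ccontr)
    assume nz: "K \<sigma> \<rho> \<noteq> 0"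
    then have "valid D \<rho>" "\<forall>v. v \<notin> X \<longrightarrow> \<sigma> v = \<rho> v"
      using loc_in_invalid[OF K, of \<sigma> \<rho>] loc_in_zero[OF K, of _ \<sigma> \<rho>] by blast+
    then have "\<rho> = upd X \<sigma> (r0 X \<rho>)" "r0 X \<rho> \<in> cfgs D X"
      by (simp add: upd_def r0_def fun_eq_iff, simp add: r0_in_cfgs)
    with that show False by blast
  qed
  have "gmult K M \<sigma> \<tau> = infsum (\<lambda>\<rho>. K \<sigma> \<rho> * M \<rho> \<tau>) (upd X \<sigma> ` cfgs D X)"
    unfolding gmult_def by (rule infsum_cong_neutral) (auto simp: supp)
  also have "\<dots> = (\<Sum>\<omega>\<in>cfgs D X. K \<sigma> (upd X \<sigma> \<omega>) * M (upd X \<sigma> \<omega>) \<tau>)"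
    using X by (simp add: finite_cfgs sum.reindex[OF inj])
  also have "\<dots> = lext X (\<lambda>\<sigma> \<tau>. \<Sum>\<rho>\<in>cfgs D X. K \<sigma> \<rho> * M \<rho> \<tau>) \<sigma> \<tau>"
  proof (cases "valid D \<sigma> \<and> valid D \<tau> \<and> (\<forall>v. v \<notin> X \<longrightarrow> \<sigma> v = \<tau> v)")
    case True
    have "K \<sigma> (upd X \<sigma> \<omega>) = K (r0 X \<sigma>) \<omega> \<and> M (upd X \<sigma> \<omega>) \<tau> = M \<omega> (r0 X \<tau>)"
      if w: "\<omega> \<in> cfgs D X" for \<omega>
    proof -
      have "r0 X (upd X \<sigma> \<omega>) = \<omega>" using w by (auto simp: r0_def upd_def cfgs_def)
      moreover have "valid D (upd X \<sigma> \<omega>)" using True w by (auto intro: valid_upd)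
      ultimately show ?thesis
        using loc_in_r0[OF K, of \<sigma> "upd X \<sigma> \<omega>"] loc_in_r0[OF M, of "upd X \<sigma> \<omega>" \<tau>] True
        by (auto simp: upd_def)
    qed
    then show ?thesis using True by (simp add: lext_def)
  next
    case False
    have "K \<sigma> (upd X \<sigma> \<omega>) * M (upd X \<sigma> \<omega>) \<tau> = 0" for \<omega>
    proof (cases "valid D \<sigma> \<and> valid D \<tau>")
      case True
      with False obtain v where "v \<notin> X" "\<sigma> v \<noteq> \<tau> v" by blast
      then show ?thesis using loc_in_zero[OF M, of v "upd X \<sigma> \<omega>" \<tau>] by (simp add: upd_def)
    next
      case False
      then show ?thesis using loc_in_invalid[OF K, of \<sigma> "upd X \<sigma> \<omega>"] loc_in_invalid[OF M, of "upd X \<sigma> \<omega>" \<tau>]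
        by auto
    qed
    with False show ?thesis by (simp only: lext_def if_False sum.neutral_const)
  qed
  finally show "gmult K M \<sigma> \<tau> = lext X (\<lambda>\<sigma> \<tau>. \<Sum>\<rho>\<in>cfgs D X. K \<sigma> \<rho> * M \<rho> \<tau>) \<sigma> \<tau>" .
qed

lemma loc_in_gmult: "finite X \<Longrightarrow> loc_in D X K \<Longrightarrow> loc_in D X M \<Longrightarrow> loc_in D X (gmult K M)"
  by (simp add: gmult_loc_in loc_in_lext)

lemma gmult_cfgs:
  "finite X \<Longrightarrow> loc_in D X K \<Longrightarrow> loc_in D X M \<Longrightarrow> \<sigma> \<in> cfgs D X \<Longrightarrow> \<tau> \<in> cfgs D X
    \<Longrightarrow> gmult K M \<sigma> \<tau> = (\<Sum>\<rho>\<in>cfgs D X. K \<sigma> \<rho> * M \<rho> \<tau>)"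
  by (simp add: gmult_loc_in lext_cfgs)

section \<open>Positivity and the normalised partial trace\<close>

definition qf :: "'v set \<Rightarrow> 'v op \<Rightarrow> ('v cfg \<Rightarrow> complex) \<Rightarrow> real" where
  "qf X K \<psi> = Re (\<Sum>\<sigma>\<in>cfgs D X. \<Sum>\<tau>\<in>cfgs D X. cnj (\<psi> \<sigma>) * K \<sigma> \<tau> * \<psi> \<tau>)"

text \<open>Positivity of c + K and c - K expresses a norm bound on Hermitian K without mentioning a
  basis. This is how spectral bounds move between regions and between eigenbases.\<close>

definition psd :: "'v set \<Rightarrow> 'v op \<Rightarrow> bool" where
  "psd X K \<longleftrightarrow> (\<forall>\<psi>. 0 \<le> qf X K \<psi>)"

lemma qf_mv: "qf X K \<psi> = Re (ip (cfgs D X) \<psi> (mv (cfgs D X) K \<psi>))"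
  by (simp add: qf_def ip_mv)

text \<open>Off \<open>X\<close> the operator is the identity, so its matrix on \<open>Y\<close> is
  block diagonal and the quadratic form is a sum of the old forms, one for each configuration
  \<open>\<eta>\<close> of \<open>Y - X\<close>.\<close>

lemma psd_mono:
  assumes K: "loc_in D X K" and XY: "X \<subseteq> Y" "finite Y" and P: "psd X K"
  shows "psd Y K"
  unfolding psd_def
proof
  fix \<psi> :: "'a cfg \<Rightarrow> complex"
  let ?Z = "Y - X"
  have Y: "Y = X \<union> ?Z" "X \<inter> ?Z = {}" using XY by auto
  have fin: "finite (cfgs D ?Z)" using XY finite_cfgs by blast
  have K': "K (upd X \<eta> \<sigma>) (upd X \<eta>' \<tau>) = (if \<eta>' = \<eta> then K \<sigma> \<tau> else 0)"
    if "\<eta> \<in> cfgs D ?Z" "\<eta>' \<in> cfgs D ?Z" "\<sigma> \<in> cfgs D X" "\<tau> \<in> cfgs D X" for \<eta> \<eta>' \<sigma> \<tau>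
  proof (cases "\<eta>' = \<eta>")
    case True
    have "r0 X (upd X \<eta> \<sigma>) = \<sigma>" "r0 X (upd X \<eta> \<tau>) = \<tau>"
      using that by (auto simp: r0_def upd_def cfgs_def)
    moreover have "valid D (upd X \<eta> \<sigma>)" "valid D (upd X \<eta> \<tau>)"
      using that by (auto intro: valid_upd valid_cfgs)
    ultimately show ?thesis
      using loc_in_r0[OF K, of "upd X \<eta> \<sigma>" "upd X \<eta> \<tau>"] True by (simp add: upd_def)
  next
    case False
    then obtain v where "\<eta> v \<noteq> \<eta>' v" by (metis ext)
    moreover from this have "v \<notin> X" using that by (auto simp: cfgs_def)
    ultimately show ?thesis using loc_in_zero[OF K, of v] False by (simp add: upd_def)
  qed
  have "(\<Sum>\<sigma>\<in>cfgs D Y. \<Sum>\<tau>\<in>cfgs D Y. cnj (\<psi> \<sigma>) * K \<sigma> \<tau> * \<psi> \<tau>)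
     = (\<Sum>\<eta>\<in>cfgs D ?Z. \<Sum>\<sigma>\<in>cfgs D X. \<Sum>\<eta>'\<in>cfgs D ?Z. \<Sum>\<tau>\<in>cfgs D X.
          cnj (\<psi> (upd X \<eta> \<sigma>)) * K (upd X \<eta> \<sigma>) (upd X \<eta>' \<tau>) * \<psi> (upd X \<eta>' \<tau>))"
    by (subst (1 2) Y(1)) (simp only: sum_cfgs_Un[OF Y(2)])
  also have "\<dots> = (\<Sum>\<eta>\<in>cfgs D ?Z. \<Sum>\<sigma>\<in>cfgs D X. \<Sum>\<eta>'\<in>cfgs D ?Z. if \<eta>' = \<eta> then
       (\<Sum>\<tau>\<in>cfgs D X. cnj (\<psi> (upd X \<eta> \<sigma>)) * K \<sigma> \<tau> * \<psi> (upd X \<eta> \<tau>)) else 0)"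
    by (intro sum.cong refl) (auto simp: K' intro!: sum.neutral)
  also have "\<dots> = (\<Sum>\<eta>\<in>cfgs D ?Z. \<Sum>\<sigma>\<in>cfgs D X. \<Sum>\<tau>\<in>cfgs D X.
        cnj (\<psi> (upd X \<eta> \<sigma>)) * K \<sigma> \<tau> * \<psi> (upd X \<eta> \<tau>))"
    by (rule sum.cong[OF refl], rule sum.cong[OF refl]) (simp add: fin)
  finally have "qf Y K \<psi> = (\<Sum>\<eta>\<in>cfgs D ?Z. qf X K (\<lambda>\<sigma>. \<psi> (upd X \<eta> \<sigma>)))"
    by (simp add: qf_def)
  then show "0 \<le> qf Y K \<psi>" using P by (simp add: psd_def sum_nonneg)
qed

lemma condExp_eq_lext:
  assumes "loc_in D Y K"
  shows "condExp D L Y K = lext (Y \<inter> L) (\<lambda>\<sigma> \<tau>. (\<Sum>\<omega>\<in>cfgs D (Y - L). K (upd (Y - L) \<sigma> \<omega>) (upd (Y - L) \<tau> \<omega>))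
          / of_nat D ^ card (Y - L))"
proof (intro ext)
  fix \<sigma> \<tau> :: "'a cfg"
  have *: "K (upd (Y - L) \<sigma> \<omega>) (upd (Y - L) \<tau> \<omega>) =
        K (upd (Y - L) (r0 (Y \<inter> L) \<sigma>) \<omega>) (upd (Y - L) (r0 (Y \<inter> L) \<tau>) \<omega>)"
    if "valid D \<sigma>" "valid D \<tau>" "\<forall>v. v \<notin> Y \<inter> L \<longrightarrow> \<sigma> v = \<tau> v" "\<omega> \<in> cfgs D (Y - L)" for \<omega>
  proof -
    have e: "r0 Y (upd (Y - L) \<rho> \<omega>) = upd (Y - L) (r0 (Y \<inter> L) \<rho>) \<omega>" for \<rho>
      using that by (auto simp: r0_def upd_def fun_eq_iff cfgs_def)
    have "K (upd (Y - L) \<sigma> \<omega>) (upd (Y - L) \<tau> \<omega>)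
        = K (r0 Y (upd (Y - L) \<sigma> \<omega>)) (r0 Y (upd (Y - L) \<tau> \<omega>))"
      using that by (intro loc_in_r0[OF assms] valid_upd) (auto simp: upd_def)
    then show ?thesis by (simp add: e)
  qed
  show "condExp D L Y K \<sigma> \<tau> = lext (Y \<inter> L) (\<lambda>\<sigma> \<tau>. (\<Sum>\<omega>\<in>cfgs D (Y - L). K (upd (Y - L) \<sigma> \<omega>) (upd (Y - L) \<tau> \<omega>))
          / of_nat D ^ card (Y - L)) \<sigma> \<tau>"
    unfolding condExp_def lext_def using * by (auto intro!: arg_cong2[where f = "(/)"] sum.cong)
qed

lemma loc_in_condExp: "loc_in D Y K \<Longrightarrow> loc_in D (Y \<inter> L) (condExp D L Y K)"
  by (simp add: condExp_eq_lext loc_in_lext)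

lemma loc_in_condExp': "loc_in D Y K \<Longrightarrow> loc_in D Y (condExp D L Y K)"
  by (rule loc_in_mono[OF loc_in_condExp]) auto

lemma condExp_add: "condExp D L Y (\<lambda>\<sigma> \<tau>. K \<sigma> \<tau> + M \<sigma> \<tau>) = (\<lambda>\<sigma> \<tau>. condExp D L Y K \<sigma> \<tau> + condExp D L Y M \<sigma> \<tau>)"
  by (auto simp: condExp_def fun_eq_iff sum.distrib add_divide_distrib)

lemma condExp_scale: "condExp D L Y (\<lambda>\<sigma> \<tau>. c * K \<sigma> \<tau>) = (\<lambda>\<sigma> \<tau>. c * condExp D L Y K \<sigma> \<tau>)"
  by (auto simp: condExp_def fun_eq_iff sum_distrib_left[symmetric])

lemma condExp_sum: "condExp D L Y (\<lambda>\<sigma> \<tau>. \<Sum>i\<in>S. K i \<sigma> \<tau>) = (\<lambda>\<sigma> \<tau>. \<Sum>i\<in>S. condExp D L Y (K i) \<sigma> \<tau>)"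
proof (induction S rule: infinite_finite_induct)
  case (insert x F)
  then show ?case by (simp add: condExp_add)
qed (auto simp: condExp_def fun_eq_iff)

lemma condExp_gid:
  assumes "finite Y"
  shows "condExp D L Y (gid D) = gid D"
proof (intro ext)
  fix \<sigma> \<tau> :: "'a cfg"
  show "condExp D L Y (gid D) \<sigma> \<tau> = gid D \<sigma> \<tau>"
  proof (cases "valid D \<sigma> \<and> valid D \<tau> \<and> (\<forall>v. v \<notin> Y \<inter> L \<longrightarrow> \<sigma> v = \<tau> v)")
    case True
    have "gid D (upd (Y - L) \<sigma> \<omega>) (upd (Y - L) \<tau> \<omega>) = gid D \<sigma> \<tau>" if "\<omega> \<in> cfgs D (Y - L)" for \<omega>
    proof -
      have "upd (Y - L) \<sigma> \<omega> = upd (Y - L) \<tau> \<omega> \<longleftrightarrow> \<sigma> = \<tau>"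
        using True by (auto simp: upd_def fun_eq_iff)
      then show ?thesis using True that by (simp add: gid_def valid_upd)
    qed
    then show ?thesis
      using True assms D_pos by (simp add: condExp_def card_cfgs)
  next
    case False
    then show ?thesis unfolding condExp_def gid_def by auto
  qed
qed

lemma herm_condExp:
  assumes "herm K"
  shows "herm (condExp D L Y K)"
proof -
  have K: "cnj (K x y) = K y x" for x y using assms unfolding herm_def by metis
  show ?thesis unfolding herm_def condExp_def by (auto simp: K)
qed

lemma condExp_tendsto:
  assumes "\<And>\<sigma> \<tau>. (\<lambda>n. K n \<sigma> \<tau>) \<longlonglongrightarrow> M \<sigma> \<tau>"
  shows "(\<lambda>n. condExp D L Y (K n) \<sigma> \<tau>) \<longlonglongrightarrow> condExp D L Y M \<sigma> \<tau>"
  unfolding condExp_def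
  by (cases "valid D \<sigma> \<and> valid D \<tau> \<and> (\<forall>v. v \<notin> Y \<inter> L \<longrightarrow> \<sigma> v = \<tau> v)")
    (simp_all only: if_True if_False, auto intro!: tendsto_intros assms simp: D_pos[THEN less_imp_neq, symmetric])

text \<open>At each traced site of \<open>Y - X\<close> the kernel acts as the identity and
  contributes a factor \<open>D\<close>, which the normalisation cancels. The reference region is
  therefore immaterial.\<close>

lemma condExp_local:
  assumes K: "loc_in D X K" and XY: "X \<subseteq> Y" "finite Y"
  shows "condExp D L Y K = condExp D L X K"
proof (rule loc_in_eqI)
  show "loc_in D Y (condExp D L Y K)" by (intro loc_in_condExp' loc_in_mono[OF K] XY)
  show "loc_in D Y (condExp D L X K)" by (rule loc_in_mono[OF loc_in_condExp'[OF K] XY(1)])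
  fix \<sigma> \<tau> assume s: "\<sigma> \<in> cfgs D Y" "\<tau> \<in> cfgs D Y"
  let ?A = "X - L" and ?B = "(Y - L) - (X - L)"
  have v: "valid D \<sigma>" "valid D \<tau>" using s valid_cfgs by auto
  have YL: "Y - L = ?A \<union> ?B" "?A \<inter> ?B = {}" using XY by auto
  show "condExp D L Y K \<sigma> \<tau> = condExp D L X K \<sigma> \<tau>"
  proof (cases "\<forall>v. v \<notin> X \<inter> L \<longrightarrow> \<sigma> v = \<tau> v")
    case True
    have *: "K (upd (Y - L) \<sigma> (upd ?A \<eta> \<omega>)) (upd (Y - L) \<tau> (upd ?A \<eta> \<omega>)) = K (upd ?A \<sigma> \<omega>) (upd ?A \<tau> \<omega>)"
      if "\<eta> \<in> cfgs D ?B" "\<omega> \<in> cfgs D ?A" for \<eta> \<omega>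
    proof -
      have u: "upd ?A \<eta> \<omega> \<in> cfgs D (Y - L)"
        using that XY by (auto simp: upd_def cfgs_def)
      have e: "r0 X (upd (Y - L) \<rho> (upd ?A \<eta> \<omega>)) = r0 X (upd ?A \<rho> \<omega>)" for \<rho>
        using XY by (auto simp: r0_def upd_def fun_eq_iff)
      have "K (upd (Y - L) \<sigma> (upd ?A \<eta> \<omega>)) (upd (Y - L) \<tau> (upd ?A \<eta> \<omega>)) =
         K (r0 X (upd (Y - L) \<sigma> (upd ?A \<eta> \<omega>))) (r0 X (upd (Y - L) \<tau> (upd ?A \<eta> \<omega>)))"
        using True by (intro loc_in_r0[OF K] valid_upd v u) (auto simp: upd_def)
      also have "\<dots> = K (upd ?A \<sigma> \<omega>) (upd ?A \<tau> \<omega>)"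
        unfolding e using True that
        by (intro loc_in_r0[OF K, symmetric] valid_upd v) (auto simp: upd_def)
      finally show ?thesis .
    qed
    have "(\<Sum>\<omega>\<in>cfgs D (Y - L). K (upd (Y - L) \<sigma> \<omega>) (upd (Y - L) \<tau> \<omega>))
       = (\<Sum>\<eta>\<in>cfgs D ?B. \<Sum>\<omega>\<in>cfgs D ?A. K (upd (Y - L) \<sigma> (upd ?A \<eta> \<omega>)) (upd (Y - L) \<tau> (upd ?A \<eta> \<omega>)))"
      by (subst YL(1)) (rule sum_cfgs_Un[OF YL(2)])
    also have "\<dots> = (\<Sum>\<eta>\<in>cfgs D ?B. \<Sum>\<omega>\<in>cfgs D ?A. K (upd ?A \<sigma> \<omega>) (upd ?A \<tau> \<omega>))"
      using * by (intro sum.cong refl) auto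
    also have "\<dots> = of_nat D ^ card ?B * (\<Sum>\<omega>\<in>cfgs D ?A. K (upd ?A \<sigma> \<omega>) (upd ?A \<tau> \<omega>))"
      using XY by (simp add: card_cfgs)
    finally have sum: "(\<Sum>\<omega>\<in>cfgs D (Y - L). K (upd (Y - L) \<sigma> \<omega>) (upd (Y - L) \<tau> \<omega>))
       = of_nat D ^ card ?B * (\<Sum>\<omega>\<in>cfgs D ?A. K (upd ?A \<sigma> \<omega>) (upd ?A \<tau> \<omega>))" .
    have "card (Y - L) = card ?A + card ?B" using XY by (intro card_Diff_add) auto
    then have "(of_nat D :: complex) ^ card (Y - L) = of_nat D ^ card ?A * of_nat D ^ card ?B"
      by (simp add: power_add)
    then show ?thesis
      unfolding condExp_def sum using True v XY D_pos by auto
  next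
    case False
    then obtain x where x: "x \<notin> X \<inter> L" "\<sigma> x \<noteq> \<tau> x" by blast
    have "condExp D L Y K \<sigma> \<tau> = 0"
    proof (cases "\<forall>v. v \<notin> Y \<inter> L \<longrightarrow> \<sigma> v = \<tau> v")
      case True
      then have xL: "x \<in> L" "x \<notin> X" using x by auto
      have "K (upd (Y - L) \<sigma> \<omega>) (upd (Y - L) \<tau> \<omega>) = 0" for \<omega>
        by (rule loc_in_zero[OF K, of x]) (use xL x in \<open>auto simp: upd_def\<close>)
      then show ?thesis by (simp add: condExp_def)
    next
      case False
      then show ?thesis by (auto simp: condExp_def)
    qed
    then show ?thesis using False by (auto simp: condExp_def)
  qed
qed

text \<open>The form of the partial trace at \<open>\<psi>\<close> is an average of forms of
  \<open>K\<close> at the product vectors that equal \<open>\<psi>\<close> on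
  \<open>Y \<inter> L\<close> and are concentrated at one configuration \<open>\<omega>\<close> of
  \<open>Y - L\<close>.\<close>

lemma psd_condExp:
  assumes K: "loc_in D Y K" and Y: "finite Y" and P: "psd Y K"
  shows "psd (Y \<inter> L) (condExp D L Y K)"
  unfolding psd_def
proof
  fix \<psi> :: "'a cfg \<Rightarrow> complex"
  let ?M = "Y - L" and ?N = "Y \<inter> L"
  have YY: "Y = ?N \<union> ?M" "?N \<inter> ?M = {}" by auto
  let ?\<psi> = "\<lambda>\<omega> \<rho>. if r0 ?M \<rho> = \<omega> then \<psi> (r0 ?N \<rho>) else 0"
  have fin: "finite (cfgs D ?M)" using Y finite_cfgs by blast
  have e: "r0 ?M (upd ?N \<eta> \<sigma>) = \<eta>" "r0 ?N (upd ?N \<eta> \<sigma>) = \<sigma>" if "\<eta> \<in> cfgs D ?M" "\<sigma> \<in> cfgs D ?N" for \<eta> \<sigma>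
    using that by (auto simp: r0_def upd_def cfgs_def)
  have inner: "qf Y K (?\<psi> \<omega>) = Re (\<Sum>\<sigma>\<in>cfgs D ?N. \<Sum>\<tau>\<in>cfgs D ?N.
        cnj (\<psi> \<sigma>) * K (upd ?N \<omega> \<sigma>) (upd ?N \<omega> \<tau>) * \<psi> \<tau>)" if w: "\<omega> \<in> cfgs D ?M" for \<omega>
  proof -
    have "(\<Sum>\<sigma>\<in>cfgs D Y. \<Sum>\<tau>\<in>cfgs D Y. cnj (?\<psi> \<omega> \<sigma>) * K \<sigma> \<tau> * ?\<psi> \<omega> \<tau>)
      = (\<Sum>\<eta>\<in>cfgs D ?M. \<Sum>\<sigma>\<in>cfgs D ?N. \<Sum>\<eta>'\<in>cfgs D ?M. \<Sum>\<tau>\<in>cfgs D ?N.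
          cnj (?\<psi> \<omega> (upd ?N \<eta> \<sigma>)) * K (upd ?N \<eta> \<sigma>) (upd ?N \<eta>' \<tau>) * ?\<psi> \<omega> (upd ?N \<eta>' \<tau>))"
      by (subst (1 2) YY(1)) (simp only: sum_cfgs_Un[OF YY(2)])
    also have "\<dots> = (\<Sum>\<eta>\<in>cfgs D ?M. \<Sum>\<sigma>\<in>cfgs D ?N. \<Sum>\<eta>'\<in>cfgs D ?M. if \<eta>' = \<omega> then if \<eta> = \<omega> then
       (\<Sum>\<tau>\<in>cfgs D ?N. cnj (\<psi> \<sigma>) * K (upd ?N \<omega> \<sigma>) (upd ?N \<omega> \<tau>) * \<psi> \<tau>) else 0 else 0)"
      by (intro sum.cong refl) (auto simp: e intro!: sum.neutral)
    also have "\<dots> = (\<Sum>\<eta>\<in>cfgs D ?M. if \<eta> = \<omega> then \<Sum>\<sigma>\<in>cfgs D ?N.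
       (\<Sum>\<tau>\<in>cfgs D ?N. cnj (\<psi> \<sigma>) * K (upd ?N \<omega> \<sigma>) (upd ?N \<omega> \<tau>) * \<psi> \<tau>) else 0)"
      using fin w by (intro sum.cong refl) auto
    also have "\<dots> = (\<Sum>\<sigma>\<in>cfgs D ?N. \<Sum>\<tau>\<in>cfgs D ?N. cnj (\<psi> \<sigma>) * K (upd ?N \<omega> \<sigma>) (upd ?N \<omega> \<tau>) * \<psi> \<tau>)"
      using fin w by simp
    finally show ?thesis by (simp add: qf_def)
  qed
  have ce: "condExp D L Y K \<sigma> \<tau> = (\<Sum>\<omega>\<in>cfgs D ?M. K (upd ?N \<omega> \<sigma>) (upd ?N \<omega> \<tau>)) / of_nat D ^ card ?M"
    if "\<sigma> \<in> cfgs D ?N" "\<tau> \<in> cfgs D ?N" for \<sigma> \<tau>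
  proof -
    have "upd ?M \<rho> \<omega> = upd ?N \<omega> \<rho>" if "\<omega> \<in> cfgs D ?M" "\<rho> \<in> cfgs D ?N" for \<omega> \<rho>
      using that by (auto simp: upd_def cfgs_def fun_eq_iff)
    then show ?thesis using that K by (simp add: condExp_eq_lext lext_cfgs)
  qed
  have "(\<Sum>\<sigma>\<in>cfgs D ?N. \<Sum>\<tau>\<in>cfgs D ?N. cnj (\<psi> \<sigma>) * condExp D L Y K \<sigma> \<tau> * \<psi> \<tau>)
    = (\<Sum>\<sigma>\<in>cfgs D ?N. \<Sum>\<tau>\<in>cfgs D ?N. \<Sum>\<omega>\<in>cfgs D ?M. cnj (\<psi> \<sigma>) * K (upd ?N \<omega> \<sigma>) (upd ?N \<omega> \<tau>) * \<psi> \<tau> / of_nat D ^ card ?M)"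
    by (intro sum.cong refl) (simp add: ce sum_distrib_left sum_distrib_right sum_divide_distrib)
  also have "\<dots> = (\<Sum>\<sigma>\<in>cfgs D ?N. \<Sum>\<omega>\<in>cfgs D ?M. \<Sum>\<tau>\<in>cfgs D ?N. cnj (\<psi> \<sigma>) * K (upd ?N \<omega> \<sigma>) (upd ?N \<omega> \<tau>) * \<psi> \<tau> / of_nat D ^ card ?M)"
    by (intro sum.cong refl sum.swap)
  also have "\<dots> = (\<Sum>\<omega>\<in>cfgs D ?M. \<Sum>\<sigma>\<in>cfgs D ?N. \<Sum>\<tau>\<in>cfgs D ?N. cnj (\<psi> \<sigma>) * K (upd ?N \<omega> \<sigma>) (upd ?N \<omega> \<tau>) * \<psi> \<tau> / of_nat D ^ card ?M)"
    by (rule sum.swap)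
  also have "\<dots> = (\<Sum>\<omega>\<in>cfgs D ?M. (\<Sum>\<sigma>\<in>cfgs D ?N. \<Sum>\<tau>\<in>cfgs D ?N. cnj (\<psi> \<sigma>) * K (upd ?N \<omega> \<sigma>) (upd ?N \<omega> \<tau>) * \<psi> \<tau>) / of_real (real D ^ card ?M))"
    by (simp add: sum_divide_distrib)
  finally have "qf ?N (condExp D L Y K) \<psi> = (\<Sum>\<omega>\<in>cfgs D ?M.
      Re (\<Sum>\<sigma>\<in>cfgs D ?N. \<Sum>\<tau>\<in>cfgs D ?N. cnj (\<psi> \<sigma>) * K (upd ?N \<omega> \<sigma>) (upd ?N \<omega> \<tau>) * \<psi> \<tau>) / real D ^ card ?M)"
    unfolding qf_def by (simp only: Re_sum Re_divide_of_real)
  also have "\<dots> = (\<Sum>\<omega>\<in>cfgs D ?M. qf Y K (?\<psi> \<omega>) / real D ^ card ?M)"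
    by (rule sum.cong[OF refl], rule arg_cong2[where f = "(/)", OF inner[symmetric] refl])
  also have "\<dots> \<ge> 0" using P by (intro sum_nonneg) (simp add: psd_def)
  finally show "0 \<le> qf ?N (condExp D L Y K) \<psi>" .
qed

text \<open>Only one intermediate configuration contributes: \<open>A\<close> fixes it to
  \<open>\<sigma>\<close> off \<open>X\<close>, and \<open>B\<close> fixes it to
  \<open>\<tau>\<close> on \<open>X\<close>, which lies off \<open>Y\<close>.\<close>

lemma gmult_disjoint:
  assumes fin: "finite X" "finite Y" and XY: "X \<inter> Y = {}" and A: "loc_in D X A" and B: "loc_in D Y B"
    and s: "\<sigma> \<in> cfgs D (X \<union> Y)" "\<tau> \<in> cfgs D (X \<union> Y)"
  shows "gmult A B \<sigma> \<tau> = A (r0 X \<sigma>) (r0 X \<tau>) * B (r0 Y \<sigma>) (r0 Y \<tau>)"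
proof -
  let ?\<rho> = "upd X \<sigma> \<tau>"
  have v: "valid D \<sigma>" "valid D \<tau>" using s valid_cfgs by auto
  have \<rho>: "?\<rho> \<in> cfgs D (X \<union> Y)" using s by (auto simp: upd_def cfgs_def)
  have vr: "valid D ?\<rho>" using \<rho> valid_cfgs by auto
  have "gmult A B \<sigma> \<tau> = (\<Sum>\<rho>\<in>cfgs D (X \<union> Y). A \<sigma> \<rho> * B \<rho> \<tau>)"
    using fin s by (intro gmult_cfgs loc_in_mono[OF A] loc_in_mono[OF B]) auto
  also have "\<dots> = (\<Sum>\<rho>\<in>cfgs D (X \<union> Y). if \<rho> = ?\<rho> then A \<sigma> ?\<rho> * B ?\<rho> \<tau> else 0)"
  proof (intro sum.cong refl)
    fix \<rho> assume r: "\<rho> \<in> cfgs D (X \<union> Y)"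
    show "A \<sigma> \<rho> * B \<rho> \<tau> = (if \<rho> = ?\<rho> then A \<sigma> ?\<rho> * B ?\<rho> \<tau> else 0)"
    proof (cases "\<rho> = ?\<rho>")
      case False
      then obtain x where x: "\<rho> x \<noteq> ?\<rho> x" by (auto simp: fun_eq_iff)
      show ?thesis
      proof (cases "x \<in> X")
        case True
        then have "B \<rho> \<tau> = 0" using x XY by (intro loc_in_zero[OF B, of x]) (auto simp: upd_def)
        then show ?thesis using False by simp
      next
        case nX: False
        then have "A \<sigma> \<rho> = 0" using x by (intro loc_in_zero[OF A, of x]) (auto simp: upd_def)
        then show ?thesis using False by simp
      qed
    qed simp
  qed
  also have "\<dots> = A \<sigma> ?\<rho> * B ?\<rho> \<tau>" using \<rho> fin by (simp add: finite_cfgs)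
  also have "A \<sigma> ?\<rho> = A (r0 X \<sigma>) (r0 X ?\<rho>)"
    by (rule loc_in_r0[OF A v(1) vr]) (simp add: upd_def)
  also have "r0 X ?\<rho> = r0 X \<tau>" by (auto simp: r0_def upd_def)
  also have "B ?\<rho> \<tau> = B (r0 Y ?\<rho>) (r0 Y \<tau>)"
    using s by (intro loc_in_r0[OF B vr v(2)]) (auto simp: upd_def cfgs_def)
  also have "r0 Y ?\<rho> = r0 Y \<sigma>" using XY by (auto simp: r0_def upd_def fun_eq_iff)
  finally show ?thesis .
qed

text \<open>The traced sites split along the two regions and so does the summand, so the trace of
  the product is a product of two independent sums. This is the source of all decoupling in the
  cluster estimate.\<close>

lemma condExp_gmult_disjoint:
  assumes fin: "finite X" "finite Y" and XY: "X \<inter> Y = {}" and A: "loc_in D X A" and B: "loc_in D Y B"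
  shows "condExp D L (X \<union> Y) (gmult A B) = gmult (condExp D L X A) (condExp D L Y B)"
proof -
  let ?U = "X \<union> Y"
  let ?N = "?U \<inter> L" and ?P = "X - L" and ?Q = "Y - L"
  have AB: "loc_in D ?U (gmult A B)"
    using fin by (intro loc_in_gmult loc_in_mono[OF A] loc_in_mono[OF B]) auto
  note cA = loc_in_condExp[OF A, of L] and cB = loc_in_condExp[OF B, of L]
  have N: "?N = (X \<inter> L) \<union> (Y \<inter> L)" by auto
  have dN: "(X \<inter> L) \<inter> (Y \<inter> L) = {}" using XY by auto
  have dU: "?U - L = ?P \<union> ?Q" "?P \<inter> ?Q = {}" using XY by auto
  have card: "card (?U - L) = card ?P + card ?Q"
    unfolding dU(1) using fin dU(2) by (intro card_Un_disjoint) auto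
  show ?thesis
  proof (rule loc_in_eqI)
    show "loc_in D ?N (condExp D L ?U (gmult A B))" by (rule loc_in_condExp[OF AB])
    show "loc_in D ?N (gmult (condExp D L X A) (condExp D L Y B))"
      using fin by (intro loc_in_gmult loc_in_mono[OF cA] loc_in_mono[OF cB]) auto
    fix \<sigma> \<tau> assume s: "\<sigma> \<in> cfgs D ?N" "\<tau> \<in> cfgs D ?N"
    have v: "valid D \<sigma>" "valid D \<tau>" using s valid_cfgs by auto
    have step: "gmult A B (upd (?U - L) \<sigma> (upd ?P \<eta> \<omega>)) (upd (?U - L) \<tau> (upd ?P \<eta> \<omega>))
       = A (upd ?P (r0 (X \<inter> L) \<sigma>) \<omega>) (upd ?P (r0 (X \<inter> L) \<tau>) \<omega>) *
         B (upd ?Q (r0 (Y \<inter> L) \<sigma>) \<eta>) (upd ?Q (r0 (Y \<inter> L) \<tau>) \<eta>)"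
      if w: "\<omega> \<in> cfgs D ?P" "\<eta> \<in> cfgs D ?Q" for \<omega> \<eta>
    proof -
      have c: "upd (?U - L) \<rho> (upd ?P \<eta> \<omega>) \<in> cfgs D ?U" if "\<rho> \<in> cfgs D ?N" for \<rho>
        using w that XY by (auto simp: upd_def cfgs_def)
      have eX: "r0 X (upd (?U - L) \<rho> (upd ?P \<eta> \<omega>)) = upd ?P (r0 (X \<inter> L) \<rho>) \<omega>"
        and eY: "r0 Y (upd (?U - L) \<rho> (upd ?P \<eta> \<omega>)) = upd ?Q (r0 (Y \<inter> L) \<rho>) \<eta>" for \<rho>
        using XY by (auto simp: r0_def upd_def fun_eq_iff)
      show ?thesis
        unfolding gmult_disjoint[OF fin XY A B c[OF s(1)] c[OF s(2)]] eX eY ..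
    qed
    have "(\<Sum>\<omega>\<in>cfgs D (?U - L). gmult A B (upd (?U - L) \<sigma> \<omega>) (upd (?U - L) \<tau> \<omega>))
      = (\<Sum>\<eta>\<in>cfgs D ?Q. \<Sum>\<omega>\<in>cfgs D ?P. gmult A B (upd (?U - L) \<sigma> (upd ?P \<eta> \<omega>)) (upd (?U - L) \<tau> (upd ?P \<eta> \<omega>)))"
      by (subst dU(1)) (rule sum_cfgs_Un[OF dU(2)])
    also have "\<dots> = (\<Sum>\<omega>\<in>cfgs D ?P. A (upd ?P (r0 (X \<inter> L) \<sigma>) \<omega>) (upd ?P (r0 (X \<inter> L) \<tau>) \<omega>)) *
       (\<Sum>\<eta>\<in>cfgs D ?Q. B (upd ?Q (r0 (Y \<inter> L) \<sigma>) \<eta>) (upd ?Q (r0 (Y \<inter> L) \<tau>) \<eta>))"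
      by (simp add: step sum_product sum.swap[of _ "cfgs D ?Q"] cong: sum.cong)
    finally have sum: "(\<Sum>\<omega>\<in>cfgs D (?U - L). gmult A B (upd (?U - L) \<sigma> \<omega>) (upd (?U - L) \<tau> \<omega>)) = \<dots>" .
    have "condExp D L ?U (gmult A B) \<sigma> \<tau> =
        condExp D L X A (r0 (X \<inter> L) \<sigma>) (r0 (X \<inter> L) \<tau>) * condExp D L Y B (r0 (Y \<inter> L) \<sigma>) (r0 (Y \<inter> L) \<tau>)"
      unfolding condExp_eq_lext[OF AB] condExp_eq_lext[OF A] condExp_eq_lext[OF B]
      by (simp add: lext_cfgs s r0_in_cfgs v sum card power_add)
    also have "\<dots> = gmult (condExp D L X A) (condExp D L Y B) \<sigma> \<tau>"
      by (rule gmult_disjoint[OF _ _ dN cA cB, symmetric]) (use s fin in \<open>auto simp: N[symmetric]\<close>)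
    finally show "condExp D L ?U (gmult A B) \<sigma> \<tau> = gmult (condExp D L X A) (condExp D L Y B) \<sigma> \<tau>" .
  qed
qed

end

section \<open>Functional calculus in an eigenbasis\<close>

context spin
begin

text \<open>The spectral sum of f(v) times the projection onto v. Restricting to real
  \<open>f\<close> builds Hermiticity in.\<close>

definition dg :: "'v set \<Rightarrow> ('v cfg \<Rightarrow> complex) set \<Rightarrow> (('v cfg \<Rightarrow> complex) \<Rightarrow> real) \<Rightarrow> 'v op" where
  "dg X B f = lext X (\<lambda>x y. \<Sum>v\<in>B. of_real (f v) * v x * cnj (v y))"

end

text \<open>Any orthonormal basis of the region, with completeness as a resolution of the identity.
  No operator is fixed, so several bases can be interpreted side by side.\<close>

locale eigenbasis = spin +
  fixes X :: "'v set" and B :: "('v cfg \<Rightarrow> complex) set"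
  assumes finX: "finite X" and on: "orthonormal (cfgs D X) B"
    and complete: "\<And>x y. x \<in> cfgs D X \<Longrightarrow> y \<in> cfgs D X \<Longrightarrow> (\<Sum>v\<in>B. v x * cnj (v y)) = (if x = y then 1 else 0)"
begin

abbreviation "C \<equiv> cfgs D X"

lemma finC: "finite C" by (rule finite_cfgs[OF finX])

lemma finB: "finite B" using on by (simp add: orthonormal_def)

lemma loc_in_dg: "loc_in D X (dg X B f)"
  by (simp add: dg_def loc_in_lext)

lemma dg_cfgs: "x \<in> C \<Longrightarrow> y \<in> C \<Longrightarrow> dg X B f x y = (\<Sum>v\<in>B. of_real (f v) * v x * cnj (v y))"
  by (simp add: dg_def lext_cfgs)

lemma dg_cong: "(\<And>v. v \<in> B \<Longrightarrow> f v = g v) \<Longrightarrow> dg X B f = dg X B g"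
  by (simp add: dg_def cong: sum.cong)

lemma herm_dg: "herm (dg X B f)"
  unfolding herm_def dg_def lext_def by (auto simp: algebra_simps)

lemma dg_add: "(\<lambda>\<sigma> \<tau>. dg X B f \<sigma> \<tau> + dg X B g \<sigma> \<tau>) = dg X B (\<lambda>v. f v + g v)"
  by (auto simp: dg_def lext_def fun_eq_iff sum.distrib[symmetric] algebra_simps)

lemma dg_scale: "(\<lambda>\<sigma> \<tau>. of_real c * dg X B f \<sigma> \<tau>) = dg X B (\<lambda>v. c * f v)"
  by (auto simp: dg_def lext_def fun_eq_iff sum_distrib_left algebra_simps)

lemma dg_zero: "dg X B (\<lambda>v. 0) = (\<lambda>\<sigma> \<tau>. 0)"
  by (simp add: dg_def lext_def fun_eq_iff)

lemma dg_sum: "(\<lambda>\<sigma> \<tau>. \<Sum>i\<in>S. dg X B (f i) \<sigma> \<tau>) = dg X B (\<lambda>v. \<Sum>i\<in>S. f i v)"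
  by (induction S rule: infinite_finite_induct) (simp_all add: dg_zero dg_add[symmetric] fun_eq_iff)

lemma dg_one: "dg X B (\<lambda>v. 1) = gid D"
  by (rule loc_in_eqI[OF loc_in_dg loc_in_gid])
    (simp add: dg_cfgs complete gid_def valid_cfgs)

lemma ip_basis: "u \<in> B \<Longrightarrow> v \<in> B \<Longrightarrow> ip C u v = (if u = v then 1 else 0)"
  using on by (simp add: orthonormal_def)

lemma mv_dg:
  assumes "x \<in> C"
  shows "mv C (dg X B f) \<psi> x = (\<Sum>v\<in>B. of_real (f v) * ip C v \<psi> * v x)"
proof -
  have "mv C (dg X B f) \<psi> x = (\<Sum>y\<in>C. \<Sum>v\<in>B. of_real (f v) * v x * cnj (v y) * \<psi> y)"
    using assms by (simp add: mv_def dg_cfgs sum_distrib_right)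
  also have "\<dots> = (\<Sum>v\<in>B. \<Sum>y\<in>C. of_real (f v) * v x * cnj (v y) * \<psi> y)" by (rule sum.swap)
  also have "\<dots> = (\<Sum>v\<in>B. of_real (f v) * ip C v \<psi> * v x)"
    by (simp add: ip_def sum_distrib_left sum_distrib_right mult.assoc mult.left_commute mult.commute)
  finally show ?thesis .
qed

lemma mv_dg_basis:
  assumes "v \<in> B" "x \<in> C"
  shows "mv C (dg X B f) v x = of_real (f v) * v x"
proof -
  have "(\<Sum>u\<in>B. of_real (f u) * ip C u v * u x) = (\<Sum>u\<in>B. if u = v then of_real (f v) * v x else 0)"
    using assms by (intro sum.cong) (auto simp: ip_basis)
  then show ?thesis using assms finB by (simp add: mv_dg)
qed

lemma ip_mv_dg:
  assumes "v \<in> B"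
  shows "ip C v (mv C (dg X B f) \<psi>) = of_real (f v) * ip C v \<psi>"
proof -
  have "herm_on C (dg X B f)" using herm_dg[of f] unfolding herm_on_def herm_def by blast
  then have "ip C v (mv C (dg X B f) \<psi>) = ip C (mv C (dg X B f) v) \<psi>" by (simp add: ip_mv_herm)
  also have "\<dots> = ip C (\<lambda>x. of_real (f v) * v x) \<psi>"
    unfolding ip_def by (intro sum.cong refl) (simp add: mv_dg_basis[OF assms])
  finally show ?thesis by (simp add: ip_scale_left)
qed

lemma expand:
  assumes "x \<in> C"
  shows "(\<Sum>v\<in>B. ip C v \<psi> * v x) = \<psi> x"
proof -
  have "(\<Sum>v\<in>B. ip C v \<psi> * v x) = (\<Sum>v\<in>B. \<Sum>y\<in>C. v x * cnj (v y) * \<psi> y)"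
    by (simp add: ip_def sum_distrib_right sum_distrib_left algebra_simps)
  also have "\<dots> = (\<Sum>y\<in>C. (\<Sum>v\<in>B. v x * cnj (v y)) * \<psi> y)"
    unfolding sum_distrib_right by (rule sum.swap)
  also have "\<dots> = (\<Sum>y\<in>C. if y = x then \<psi> x else 0)"
    using assms by (intro sum.cong) (auto simp: complete)
  also have "\<dots> = \<psi> x" using assms finC by simp
  finally show ?thesis .
qed

lemma parseval: "(\<Sum>v\<in>B. cnj (ip C v \<phi>) * ip C v \<psi>) = ip C \<phi> \<psi>"
proof -
  have "(\<Sum>v\<in>B. cnj (ip C v \<phi>) * ip C v \<psi>) = (\<Sum>v\<in>B. \<Sum>x\<in>C. cnj (\<phi> x) * (ip C v \<psi> * v x))"
    unfolding cnj_ip by (simp add: ip_def[of C \<phi>] sum_distrib_right sum_distrib_left algebra_simps)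
  also have "\<dots> = (\<Sum>x\<in>C. cnj (\<phi> x) * (\<Sum>v\<in>B. ip C v \<psi> * v x))"
    unfolding sum_distrib_left by (rule sum.swap)
  also have "\<dots> = ip C \<phi> \<psi>" by (simp add: expand ip_def[of C \<phi> \<psi>] cong: sum.cong)
  finally show ?thesis .
qed

lemma parseval_norm: "(\<Sum>v\<in>B. (cmod (ip C v \<psi>))\<^sup>2) = (\<Sum>x\<in>C. (cmod (\<psi> x))\<^sup>2)"
proof -
  have "complex_of_real (\<Sum>v\<in>B. (cmod (ip C v \<psi>))\<^sup>2) = (\<Sum>v\<in>B. cnj (ip C v \<psi>) * ip C v \<psi>)"
    by (simp add: complex_norm_square mult.commute del: of_real_power)
  also have "\<dots> = complex_of_real (\<Sum>x\<in>C. (cmod (\<psi> x))\<^sup>2)" unfolding parseval ip_self ..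
  finally show ?thesis by (simp only: of_real_eq_iff)
qed

lemma qf_dg: "qf X (dg X B f) \<psi> = (\<Sum>v\<in>B. f v * (cmod (ip C v \<psi>))\<^sup>2)"
proof -
  have "ip C \<psi> (mv C (dg X B f) \<psi>) = (\<Sum>v\<in>B. cnj (ip C v \<psi>) * (of_real (f v) * ip C v \<psi>))"
    unfolding parseval[symmetric, of \<psi>] by (simp add: ip_mv_dg cong: sum.cong)
  also have "\<dots> = of_real (\<Sum>v\<in>B. f v * (cmod (ip C v \<psi>))\<^sup>2)"
    by (simp add: complex_norm_square algebra_simps del: of_real_power)
  finally show ?thesis by (simp add: qf_mv)
qed

lemma psd_dg: "psd X (dg X B f) \<longleftrightarrow> (\<forall>v\<in>B. 0 \<le> f v)"
proof
  assume P: "psd X (dg X B f)"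
  show "\<forall>v\<in>B. 0 \<le> f v"
  proof
    fix v assume v: "v \<in> B"
    have "qf X (dg X B f) v = (\<Sum>u\<in>B. if u = v then f v else 0)"
      unfolding qf_dg using v by (intro sum.cong) (auto simp: ip_basis)
    also have "\<dots> = f v" using v finB by simp
    finally show "0 \<le> f v" using P unfolding psd_def by metis
  qed
qed (auto simp: psd_def qf_dg intro!: sum_nonneg)

lemma gmult_dg: "gmult (dg X B f) (dg X B g) = dg X B (\<lambda>v. f v * g v)"
proof (rule loc_in_eqI[of X])
  show "loc_in D X (gmult (dg X B f) (dg X B g))" by (intro loc_in_gmult finX loc_in_dg)
  show "loc_in D X (dg X B (\<lambda>v. f v * g v))" by (rule loc_in_dg)
  fix x y assume xy: "x \<in> C" "y \<in> C"
  have "gmult (dg X B f) (dg X B g) x y = mv C (dg X B f) (\<lambda>z. dg X B g z y) x"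
    using xy by (simp add: gmult_cfgs[OF finX loc_in_dg loc_in_dg] mv_def)
  also have "\<dots> = (\<Sum>v\<in>B. of_real (f v) * ip C v (\<lambda>z. dg X B g z y) * v x)"
    by (rule mv_dg[OF xy(1)])
  also have "\<dots> = (\<Sum>v\<in>B. of_real (f v) * (of_real (g v) * cnj (v y)) * v x)"
  proof (intro sum.cong refl)
    fix v assume v: "v \<in> B"
    have "ip C v (\<lambda>z. dg X B g z y) = cnj (ip C (\<lambda>z. dg X B g z y) v)" by (simp add: cnj_ip)
    also have "ip C (\<lambda>z. dg X B g z y) v = (\<Sum>z\<in>C. dg X B g y z * v z)"
      unfolding ip_def using herm_dg[of g] unfolding herm_def by (metis (no_types, lifting) complex_cnj_cnj)
    also have "\<dots> = of_real (g v) * v y" using mv_dg_basis[OF v xy(2), of g] xy by (simp add: mv_def)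
    finally show "of_real (f v) * ip C v (\<lambda>z. dg X B g z y) * v x = of_real (f v) * (of_real (g v) * cnj (v y)) * v x"
      by simp
  qed
  also have "\<dots> = dg X B (\<lambda>v. f v * g v) x y"
    by (simp add: dg_cfgs xy algebra_simps)
  finally show "gmult (dg X B f) (dg X B g) x y = dg X B (\<lambda>v. f v * g v) x y" .
qed

lemma gpow_dg: "gpow D (dg X B f) k = dg X B (\<lambda>v. f v ^ k)"
  by (induction k) (simp_all add: dg_one gmult_dg)

text \<open>Kept as \<open>sums\<close> and not only as a value of \<open>gexp\<close>: convergence
  of the partial sums is used later to pass commutation to the limit.\<close>

lemma gexp_dg_sums: "(\<lambda>k. gpow D (dg X B f) k \<sigma> \<tau> / of_nat (fact k)) sums dg X B (\<lambda>v. exp (f v)) \<sigma> \<tau>"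
proof (cases "valid D \<sigma> \<and> valid D \<tau> \<and> (\<forall>v. v \<notin> X \<longrightarrow> \<sigma> v = \<tau> v)")
  case True
  have "(\<lambda>k. \<Sum>v\<in>B. of_real (f v ^ k / fact k) * (v (r0 X \<sigma>) * cnj (v (r0 X \<tau>)))) sums
        (\<Sum>v\<in>B. of_real (exp (f v)) * (v (r0 X \<sigma>) * cnj (v (r0 X \<tau>))))"
  proof (intro sums_sum sums_mult2 sums_of_real)
    fix v show "(\<lambda>k. f v ^ k / fact k) sums exp (f v)"
      using exp_converges[of "f v"] by (simp add: field_simps)
  qed
  moreover have "(\<lambda>k. \<Sum>v\<in>B. of_real (f v ^ k / fact k) * (v (r0 X \<sigma>) * cnj (v (r0 X \<tau>)))) =
      (\<lambda>k. gpow D (dg X B f) k \<sigma> \<tau> / of_nat (fact k))"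
    unfolding gpow_dg unfolding dg_def lext_def if_P[OF True] sum_divide_distrib
    by (intro ext sum.cong refl) (simp add: field_simps)
  moreover have "(\<Sum>v\<in>B. of_real (exp (f v)) * (v (r0 X \<sigma>) * cnj (v (r0 X \<tau>)))) = dg X B (\<lambda>v. exp (f v)) \<sigma> \<tau>"
    unfolding dg_def lext_def if_P[OF True] by (simp add: mult.assoc)
  ultimately show ?thesis by simp
next
  case False
  show ?thesis unfolding gpow_dg unfolding dg_def lext_def if_not_P[OF False] by simp
qed

lemma gexp_dg: "gexp D (dg X B f) = dg X B (\<lambda>v. exp (f v))"
  unfolding gexp_def using gexp_dg_sums by (intro ext) (simp add: sums_iff)

lemma eq_dgI:
  assumes K: "loc_in D X K"
    and ev: "\<And>v x. v \<in> B \<Longrightarrow> x \<in> C \<Longrightarrow> (\<Sum>y\<in>C. K x y * v y) = of_real (f v) * v x"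
  shows "K = dg X B f"
proof (rule loc_in_eqI[OF K loc_in_dg])
  fix x y assume xy: "x \<in> C" "y \<in> C"
  have "dg X B f x y = (\<Sum>v\<in>B. (\<Sum>z\<in>C. K x z * v z) * cnj (v y))"
    using xy by (simp add: dg_cfgs ev cong: sum.cong)
  also have "\<dots> = (\<Sum>z\<in>C. \<Sum>v\<in>B. K x z * (v z * cnj (v y)))"
    unfolding sum_distrib_right mult.assoc by (rule sum.swap)
  also have "\<dots> = (\<Sum>z\<in>C. if z = y then K x y else 0)"
    unfolding sum_distrib_left[symmetric] using xy by (intro sum.cong) (auto simp: complete)
  also have "\<dots> = K x y" using xy finC by simp
  finally show "K x y = dg X B f x y" by simp
qed

lemma norm_dg_le:
  assumes c: "0 \<le> c" and f: "\<And>v. v \<in> B \<Longrightarrow> \<bar>f v\<bar> \<le> c"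
    and \<psi>: "(\<Sum>\<tau>\<in>C. (cmod (\<psi> \<tau>))\<^sup>2) \<le> 1"
  shows "sqrt (\<Sum>\<sigma>\<in>C. (cmod (\<Sum>\<tau>\<in>C. dg X B f \<sigma> \<tau> * \<psi> \<tau>))\<^sup>2) \<le> c"
proof -
  let ?\<phi> = "mv C (dg X B f) \<psi>"
  have "(\<Sum>\<sigma>\<in>C. (cmod (\<Sum>\<tau>\<in>C. dg X B f \<sigma> \<tau> * \<psi> \<tau>))\<^sup>2) = (\<Sum>\<sigma>\<in>C. (cmod (?\<phi> \<sigma>))\<^sup>2)"
    by (simp add: mv_def)
  also have "\<dots> = (\<Sum>v\<in>B. (f v)\<^sup>2 * (cmod (ip C v \<psi>))\<^sup>2)"
    unfolding parseval_norm[symmetric]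
    by (intro sum.cong refl) (simp add: ip_mv_dg norm_mult power_mult_distrib)
  also have "\<dots> \<le> (\<Sum>v\<in>B. c\<^sup>2 * (cmod (ip C v \<psi>))\<^sup>2)"
    using f c by (intro sum_mono mult_right_mono) (auto intro: abs_le_square_iff[THEN iffD1])
  also have "\<dots> = c\<^sup>2 * (\<Sum>\<tau>\<in>C. (cmod (\<psi> \<tau>))\<^sup>2)"
    by (simp add: sum_distrib_left[symmetric] parseval_norm)
  also have "\<dots> \<le> c\<^sup>2" using \<psi> by (intro mult_left_le) auto
  finally show ?thesis using c real_le_lsqrt by (simp add: sum_nonneg)
qed

lemma opnorm_dg_le:
  assumes "0 \<le> c" "\<And>v. v \<in> B \<Longrightarrow> \<bar>f v\<bar> \<le> c"
  shows "opnorm D X (dg X B f) \<le> c"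
  unfolding opnorm_def
proof (rule cSup_least)
  show "{sqrt (\<Sum>\<sigma>\<in>C. (cmod (\<Sum>\<tau>\<in>C. dg X B f \<sigma> \<tau> * \<psi> \<tau>))\<^sup>2) |\<psi>. (\<Sum>\<tau>\<in>C. (cmod (\<psi> \<tau>))\<^sup>2) \<le> 1} \<noteq> {}"
    by (auto intro!: exI[of _ "\<lambda>_. 0"])
qed (use norm_dg_le[OF assms] in auto)

lemma dg_le_opnorm:
  assumes v: "v \<in> B"
  shows "\<bar>f v\<bar> \<le> opnorm D X (dg X B f)"
proof -
  have n: "(\<Sum>x\<in>C. (cmod (v x))\<^sup>2) = 1"
    using ip_basis[OF v v] ip_self[of C v] by (metis of_real_eq_1_iff)
  have "(\<Sum>\<sigma>\<in>C. (cmod (\<Sum>\<tau>\<in>C. dg X B f \<sigma> \<tau> * v \<tau>))\<^sup>2) = (\<Sum>\<sigma>\<in>C. (f v)\<^sup>2 * (cmod (v \<sigma>))\<^sup>2)"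
    using mv_dg_basis[OF v, of _ f]
    by (intro sum.cong refl) (simp add: mv_def norm_mult power_mult_distrib)
  also have "\<dots> = (f v)\<^sup>2" by (simp add: sum_distrib_left[symmetric] n)
  finally have "\<bar>f v\<bar> = sqrt (\<Sum>\<sigma>\<in>C. (cmod (\<Sum>\<tau>\<in>C. dg X B f \<sigma> \<tau> * v \<tau>))\<^sup>2)" by simp
  also have "\<dots> \<le> opnorm D X (dg X B f)"
    unfolding opnorm_def
  proof (rule cSup_upper)
    \<comment> \<open>The supremum is real-valued, so boundedness must be supplied; the sum of all
      \<open>\<bar>f u\<bar>\<close> is crude but dominates every eigenvalue.\<close>
    show "bdd_above {sqrt (\<Sum>\<sigma>\<in>C. (cmod (\<Sum>\<tau>\<in>C. dg X B f \<sigma> \<tau> * \<psi> \<tau>))\<^sup>2) |\<psi>. (\<Sum>\<tau>\<in>C. (cmod (\<psi> \<tau>))\<^sup>2) \<le> 1}"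
    proof (rule bdd_aboveI)
      fix y assume "y \<in> {sqrt (\<Sum>\<sigma>\<in>C. (cmod (\<Sum>\<tau>\<in>C. dg X B f \<sigma> \<tau> * \<psi> \<tau>))\<^sup>2) |\<psi>. (\<Sum>\<tau>\<in>C. (cmod (\<psi> \<tau>))\<^sup>2) \<le> 1}"
      then show "y \<le> (\<Sum>u\<in>B. \<bar>f u\<bar>)"
        using norm_dg_le[of "\<Sum>u\<in>B. \<bar>f u\<bar>" f] finB member_le_sum[of _ B "\<lambda>u. \<bar>f u\<bar>"]
        by (auto simp: sum_nonneg)
    qed
  qed (use n in auto)
  finally show ?thesis .
qed

end

section \<open>Exponentials, logarithms and norms of Hermitian local operators\<close>

context spin
begin

lemma exists_eigenbasis:
  fixes F :: "'v op set"
  assumes X: "finite X" and F: "finite F" and loc: "\<And>K. K \<in> F \<Longrightarrow> loc_in D X K"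
    and h: "\<And>K. K \<in> F \<Longrightarrow> herm K"
    and comm: "\<And>K M. K \<in> F \<Longrightarrow> M \<in> F \<Longrightarrow> gmult K M = gmult M K"
  shows "\<exists>B ev. eigenbasis D X B \<and> (\<forall>K\<in>F. K = dg X B (ev K))"
proof -
  let ?C = "cfgs D X"
  have "commute_on ?C K M" if "K \<in> F" "M \<in> F" for K M
    unfolding commute_on_def
  proof (intro ballI)
    fix x y assume xy: "x \<in> ?C" "y \<in> ?C"
    show "(\<Sum>z\<in>?C. K x z * M z y) = (\<Sum>z\<in>?C. M x z * K z y)"
      using gmult_cfgs[OF X loc[OF that(1)] loc[OF that(2)] xy] gmult_cfgs[OF X loc[OF that(2)] loc[OF that(1)] xy]
        comm[OF that] by simp
  qed
  moreover have "herm_on ?C K" if "K \<in> F" for K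
    using h[OF that] unfolding herm_def herm_on_def by blast
  ultimately obtain B ev where B: "orthonormal ?C B"
     "\<forall>x\<in>?C. \<forall>y\<in>?C. (\<Sum>v\<in>B. v x * cnj (v y)) = (if x = y then 1 else 0)"
     "\<forall>A\<in>F. \<forall>v\<in>B. \<forall>x\<in>?C. (\<Sum>y\<in>?C. A x y * v y) = of_real (ev A v) * v x"
    using joint_eigenbasis_exists[OF finite_cfgs[OF X] F] by blast
  interpret E: eigenbasis D X B by unfold_locales (use X B in auto)
  have "K = dg X B (ev K)" if "K \<in> F" for K
    by (rule E.eq_dgI) (use loc B that in auto)
  then show ?thesis using E.eigenbasis_axioms by blast
qed

lemma exists_eigenbasis_single:
  assumes "finite X" "loc_in D X K" "herm K"
  shows "\<exists>B f. eigenbasis D X B \<and> K = dg X B f"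
  using exists_eigenbasis[of X "{K}"] assms by auto

lemma loc_in_gexp:
  assumes "finite X" "loc_in D X K" "herm K"
  shows "loc_in D X (gexp D K)"
proof -
  obtain B f where "eigenbasis D X B" and K: "K = dg X B f"
    using exists_eigenbasis_single[OF assms] by blast
  then interpret eigenbasis D X B by simp
  show ?thesis unfolding K gexp_dg by (rule loc_in_dg)
qed

lemma herm_gexp:
  assumes "finite X" "loc_in D X K" "herm K"
  shows "herm (gexp D K)"
proof -
  obtain B f where "eigenbasis D X B" and K: "K = dg X B f"
    using exists_eigenbasis_single[OF assms] by blast
  then interpret eigenbasis D X B by simp
  show ?thesis unfolding K gexp_dg by (rule herm_dg)
qed

lemma gexp_sums:
  assumes "finite X" "loc_in D X K" "herm K"
  shows "(\<lambda>k. gpow D K k \<sigma> \<tau> / of_nat (fact k)) sums gexp D K \<sigma> \<tau>"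
proof -
  obtain B f where "eigenbasis D X B" and K: "K = dg X B f"
    using exists_eigenbasis_single[OF assms] by blast
  then interpret eigenbasis D X B by simp
  show ?thesis unfolding K gexp_dg by (rule gexp_dg_sums)
qed

lemma gexp_add:
  assumes "finite X" "loc_in D X K" "herm K" "loc_in D X M" "herm M" "gmult K M = gmult M K"
  shows "gexp D (\<lambda>\<sigma> \<tau>. K \<sigma> \<tau> + M \<sigma> \<tau>) = gmult (gexp D K) (gexp D M)"
proof -
  have "\<exists>B ev. eigenbasis D X B \<and> (\<forall>N\<in>{K, M}. N = dg X B (ev N))"
    by (rule exists_eigenbasis) (use assms in auto)
  then obtain B ev where "eigenbasis D X B" and K: "K = dg X B (ev K)" and M: "M = dg X B (ev M)" by blast
  then interpret eigenbasis D X B by simp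
  have "gexp D (\<lambda>\<sigma> \<tau>. K \<sigma> \<tau> + M \<sigma> \<tau>) = dg X B (\<lambda>v. exp (ev K v) * exp (ev M v))"
    by (subst K, subst M) (simp add: dg_add gexp_dg exp_add)
  also have "\<dots> = gmult (gexp D K) (gexp D M)"
    by (subst (2) K, subst (2) M) (simp add: gexp_dg gmult_dg)
  finally show ?thesis .
qed

text \<open>If \<open>v\<close> and \<open>u\<close> are eigenvectors of the two logarithms that are not orthogonal, then the
  eigenvalues agree, since \<open>exp\<close> is injective on the reals.\<close>

lemma herm_log_unique:
  assumes "is_local D G" "herm G" "is_local D G'" "herm G'" and eq: "gexp D G = gexp D G'"
  shows "G = G'"
proof -
  obtain Y Y' where Y: "finite Y" "loc_in D Y G" "finite Y'" "loc_in D Y' G'"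
    using assms by (auto simp: is_local_def)
  define X where "X = Y \<union> Y'"
  have X: "finite X" "loc_in D X G" "loc_in D X G'"
    using Y by (auto simp: X_def intro: loc_in_mono)
  obtain B f where B: "eigenbasis D X B" and G: "G = dg X B f"
    using exists_eigenbasis_single X assms by blast
  obtain B' f' where B': "eigenbasis D X B'" and G': "G' = dg X B' f'"
    using exists_eigenbasis_single X assms by blast
  interpret E: eigenbasis D X B by (rule B)
  interpret E': eigenbasis D X B' by (rule B')
  let ?C = "cfgs D X"
  have "exp (f v) = exp (f' u) \<or> ip ?C v u = 0" if v: "v \<in> B" and u: "u \<in> B'" for v u
  proof -
    have "of_real (exp (f v)) * ip ?C v u = ip ?C v (mv ?C (gexp D G) u)"
      unfolding G E.gexp_dg by (simp add: E.ip_mv_dg[OF v])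
    also have "\<dots> = ip ?C v (\<lambda>x. of_real (exp (f' u)) * u x)"
      unfolding eq G' E'.gexp_dg ip_def by (intro sum.cong refl) (simp add: E'.mv_dg_basis[OF u])
    also have "\<dots> = of_real (exp (f' u)) * ip ?C v u" by (rule ip_scale_right)
    finally show ?thesis by (metis mult_cancel_right of_real_eq_iff)
  qed
  then have ev: "of_real (f v) * ip ?C v u = of_real (f' u) * ip ?C v u" if "v \<in> B" "u \<in> B'" for v u
    using that by (metis exp_inj_iff mult_zero_right)
  have "G = dg X B' f'"
  proof (rule E'.eq_dgI[OF X(2)])
    fix u x assume u: "u \<in> B'" and x: "x \<in> ?C"
    have "(\<Sum>y\<in>?C. G x y * u y) = mv ?C G u x" using x by (simp add: mv_def)
    also have "\<dots> = (\<Sum>v\<in>B. of_real (f' u) * ip ?C v u * v x)"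
      unfolding G E.mv_dg[OF x] by (intro sum.cong refl) (simp add: ev u)
    also have "\<dots> = of_real (f' u) * u x"
      using E.expand[OF x, of u] by (simp add: sum_distrib_left[symmetric] mult.assoc)
    finally show "(\<Sum>y\<in>?C. G x y * u y) = of_real (f' u) * u x" .
  qed
  with G' show ?thesis by simp
qed

lemma glog_eq:
  assumes "is_local D G" "herm G" "gexp D G = K"
  shows "glog D K = G"
  unfolding glog_def by (rule the_equality) (use assms herm_log_unique in blast)+

text \<open>Extending vectors by 0 shows the matrix on \<open>X\<close> to be a compression of the
  one on \<open>Y\<close>. Estimates can thus be made in one large region although
  \<open>bnorm\<close> measures each term in its own.\<close>

lemma opnorm_mono:
  assumes XY: "X \<subseteq> Y" "finite Y" and "loc_in D Y K" "herm K"
  shows "opnorm D X K \<le> opnorm D Y K"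
proof -
  obtain B f where "eigenbasis D Y B" and K: "K = dg Y B f"
    using exists_eigenbasis_single assms by blast
  then interpret eigenbasis D Y B by simp
  have sub: "cfgs D X \<subseteq> cfgs D Y" by (rule cfgs_mono[OF XY(1)])
  let ?S = "\<lambda>Y. {sqrt (\<Sum>\<sigma>\<in>cfgs D Y. (cmod (\<Sum>\<tau>\<in>cfgs D Y. K \<sigma> \<tau> * \<psi> \<tau>))\<^sup>2) |\<psi>. (\<Sum>\<tau>\<in>cfgs D Y. (cmod (\<psi> \<tau>))\<^sup>2) \<le> 1}"
  have bdd: "bdd_above (?S Y)"
  proof (rule bdd_aboveI)
    fix y assume "y \<in> ?S Y"
    then show "y \<le> (\<Sum>u\<in>B. \<bar>f u\<bar>)"
      unfolding K using norm_dg_le[of "\<Sum>u\<in>B. \<bar>f u\<bar>" f] finB member_le_sum[of _ B "\<lambda>u. \<bar>f u\<bar>"]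
      by (auto simp: sum_nonneg)
  qed
  show ?thesis
    unfolding opnorm_def
  proof (rule cSup_mono)
    show "?S X \<noteq> {}" by (auto intro!: exI[of _ "\<lambda>_. 0"])
    show "bdd_above (?S Y)" by (rule bdd)
    fix y assume "y \<in> ?S X"
    then obtain \<psi> where y: "y = sqrt (\<Sum>\<sigma>\<in>cfgs D X. (cmod (\<Sum>\<tau>\<in>cfgs D X. K \<sigma> \<tau> * \<psi> \<tau>))\<^sup>2)"
      and \<psi>: "(\<Sum>\<tau>\<in>cfgs D X. (cmod (\<psi> \<tau>))\<^sup>2) \<le> 1" by blast
    define \<phi> where "\<phi> = (\<lambda>\<tau>. if \<tau> \<in> cfgs D X then \<psi> \<tau> else 0)"
    have 1: "(\<Sum>\<tau>\<in>cfgs D Y. (cmod (\<phi> \<tau>))\<^sup>2) = (\<Sum>\<tau>\<in>cfgs D X. (cmod (\<psi> \<tau>))\<^sup>2)"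
      using sub finC by (intro sum.mono_neutral_cong_right) (auto simp: \<phi>_def)
    have 2: "(\<Sum>\<tau>\<in>cfgs D Y. K \<sigma> \<tau> * \<phi> \<tau>) = (\<Sum>\<tau>\<in>cfgs D X. K \<sigma> \<tau> * \<psi> \<tau>)" for \<sigma>
      using sub finC by (intro sum.mono_neutral_cong_right) (auto simp: \<phi>_def)
    have "y \<le> sqrt (\<Sum>\<sigma>\<in>cfgs D Y. (cmod (\<Sum>\<tau>\<in>cfgs D Y. K \<sigma> \<tau> * \<phi> \<tau>))\<^sup>2)"
      unfolding y 2 using sub finC by (intro real_sqrt_le_mono sum_mono2) auto
    moreover have "sqrt (\<Sum>\<sigma>\<in>cfgs D Y. (cmod (\<Sum>\<tau>\<in>cfgs D Y. K \<sigma> \<tau> * \<phi> \<tau>))\<^sup>2) \<in> ?S Y"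
      using \<psi> 1 by auto
    ultimately show "\<exists>x\<in>?S Y. y \<le> x" by blast
  qed
qed

text \<open>The eigenvalues of the exponential are bounded below by some \<open>e > 0\<close>.
  Subtracting \<open>e\<close> times the identity keeps it positive, and the trace preserves both
  positivity and the identity, so its eigenvalues are positive too and \<open>ln\<close> can be
  applied to them.\<close>

lemma exists_log_condExp:
  assumes X: "finite X" and A: "loc_in D X A" "herm A"
  shows "\<exists>G. loc_in D (X \<inter> L) G \<and> herm G \<and> gexp D G = condExp D L X (gexp D A)"
proof -
  obtain B f where "eigenbasis D X B" and K: "A = dg X B f"
    using exists_eigenbasis_single[OF assms] by blast
  then interpret E: eigenbasis D X B by simp
  let ?K = "gexp D A"
  obtain e where e: "0 < e" "\<And>v. v \<in> B \<Longrightarrow> e \<le> exp (f v)"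
  proof
    \<comment> \<open>The inserted 1 makes the minimum well defined without an appeal to
      nonemptiness of \<open>B\<close>.\<close>
    let ?e = "Min (insert 1 ((\<lambda>v. exp (f v)) ` B))"
    show "0 < ?e" using E.finB by (subst Min_gr_iff) auto
    show "?e \<le> exp (f v)" if "v \<in> B" for v using E.finB that by (intro Min_le) auto
  qed
  let ?M = "\<lambda>\<sigma> \<tau>. ?K \<sigma> \<tau> + of_real (- e) * gid D \<sigma> \<tau>"
  have M: "?M = dg X B (\<lambda>v. exp (f v) + (- e) * 1)"
    unfolding E.dg_add[symmetric] E.dg_scale[symmetric] E.dg_one K E.gexp_dg ..
  have "psd (X \<inter> L) (condExp D L X ?M)"
  proof (rule psd_condExp[OF _ X])
    show "loc_in D X ?M" unfolding M by (rule E.loc_in_dg)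
    show "psd X ?M" unfolding M E.psd_dg using e by simp
  qed
  then have P: "psd (X \<inter> L) (\<lambda>\<sigma> \<tau>. condExp D L X ?K \<sigma> \<tau> + of_real (- e) * gid D \<sigma> \<tau>)"
    unfolding condExp_add condExp_scale condExp_gid[OF X] .
  have Z: "loc_in D (X \<inter> L) (condExp D L X ?K)" "herm (condExp D L X ?K)"
    using loc_in_condExp[OF loc_in_gexp[OF assms]] herm_condExp[OF herm_gexp[OF assms]] by auto
  have XL: "finite (X \<inter> L)" using X by simp
  obtain B' z where "eigenbasis D (X \<inter> L) B'" and z: "condExp D L X ?K = dg (X \<inter> L) B' z"
    using exists_eigenbasis_single[OF XL Z] by blast
  then interpret E': eigenbasis D "X \<inter> L" B' by simp
  have "psd (X \<inter> L) (dg (X \<inter> L) B' (\<lambda>v. z v + (- e) * 1))"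
    using P unfolding z E'.dg_add[symmetric] E'.dg_scale[symmetric] E'.dg_one .
  then have "0 < z v" if "v \<in> B'" for v using e that unfolding E'.psd_dg by force
  then have "gexp D (dg (X \<inter> L) B' (\<lambda>v. ln (z v))) = dg (X \<inter> L) B' z"
    unfolding E'.gexp_dg by (intro E'.dg_cong) simp
  then show ?thesis using E'.loc_in_dg E'.herm_dg z by metis
qed

end

section \<open>The effective interaction\<close>

lemma herm_add: "herm K \<Longrightarrow> herm M \<Longrightarrow> herm (\<lambda>\<sigma> \<tau>. K \<sigma> \<tau> + M \<sigma> \<tau>)"
  unfolding herm_def by (metis complex_cnj_add)

lemma herm_scale: "herm K \<Longrightarrow> herm (\<lambda>\<sigma> \<tau>. of_real c * K \<sigma> \<tau>)"
  unfolding herm_def by (metis complex_cnj_mult complex_cnj_complex_of_real)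

lemma herm_zero: "herm (\<lambda>\<sigma> \<tau>. 0)"
  by (simp add: herm_def)

lemma herm_sum: "(\<And>i. i \<in> S \<Longrightarrow> herm (K i)) \<Longrightarrow> herm (\<lambda>\<sigma> \<tau>. \<Sum>i\<in>S. K i \<sigma> \<tau>)"
proof (induction S rule: infinite_finite_induct)
  case (insert x F)
  then show ?case by (simp add: herm_add)
qed (simp_all add: herm_zero)

text \<open>Moebius signs of complex kernels are rewritten as real scalars, the form that
  \<open>herm_scale\<close> and \<open>dg_scale\<close> accept.\<close>

lemma neg_one_power_of_real: "(- 1 :: complex) ^ n = of_real ((- 1) ^ n)"
  by simp

lemma herm_mob:
  assumes "\<And>V. V \<subseteq> U \<Longrightarrow> herm (K V)"
  shows "herm (\<lambda>\<sigma> \<tau>. mob (\<lambda>V. K V \<sigma> \<tau>) U)"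
  unfolding mob_def neg_one_power_of_real by (intro herm_sum herm_scale assms) auto

context eigenbasis
begin

lemma dg_inj: "dg X B f = dg X B g \<Longrightarrow> v \<in> B \<Longrightarrow> f v = g v"
  using ip_mv_dg[of v f v] ip_mv_dg[of v g v] ip_basis[of v v] by simp

lemma dg_mob: "(\<lambda>\<sigma> \<tau>. mob (\<lambda>V. dg X B (f V) \<sigma> \<tau>) U) = dg X B (\<lambda>v. mob (\<lambda>V. f V v) U)"
  unfolding mob_def neg_one_power_of_real dg_sum[symmetric] dg_scale[symmetric] ..

lemma B_nonempty: "B \<noteq> {}"
  using cfgs_nonempty[of X] complete by fastforce

end

context spin
begin

lemma loc_in_mob:
  assumes "\<And>V. V \<subseteq> U \<Longrightarrow> loc_in D X (K V)"
  shows "loc_in D X (\<lambda>\<sigma> \<tau>. mob (\<lambda>V. K V \<sigma> \<tau>) U)"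
  unfolding mob_def by (intro loc_in_sum loc_in_scale assms) auto

lemma condExp_mob: "condExp D L X (\<lambda>\<sigma> \<tau>. mob (\<lambda>V. K V \<sigma> \<tau>) U) = (\<lambda>\<sigma> \<tau>. mob (\<lambda>V. condExp D L X (K V) \<sigma> \<tau>) U)"
  unfolding mob_def condExp_sum condExp_scale ..

text \<open>Both bounds are positivity statements, for c + K and c - K, and these survive a change
  of region and of basis.\<close>

lemma eigenvalue_bound_mono:
  assumes B: "eigenbasis D X B" and B': "eigenbasis D Y B'" and XY: "X \<subseteq> Y"
    and eq: "dg X B f = dg Y B' g" and f: "\<And>v. v \<in> B \<Longrightarrow> \<bar>f v\<bar> \<le> c" and u: "u \<in> B'"
  shows "\<bar>g u\<bar> \<le> c"
proof -
  interpret E: eigenbasis D X B by (rule B)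
  interpret E': eigenbasis D Y B' by (rule B')
  have "0 \<le> c * 1 + s * g u" if s: "s = 1 \<or> s = - 1" for s :: real
  proof -
    have "psd X (dg X B (\<lambda>v. c * 1 + s * f v))"
      unfolding E.psd_dg using f s by (fastforce simp: abs_le_iff)
    then have "psd Y (dg X B (\<lambda>v. c * 1 + s * f v))"
      by (rule psd_mono[OF E.loc_in_dg XY E'.finX])
    also have "dg X B (\<lambda>v. c * 1 + s * f v) = dg Y B' (\<lambda>v. c * 1 + s * g v)"
      unfolding E.dg_add[symmetric] E.dg_scale[symmetric] E'.dg_add[symmetric] E'.dg_scale[symmetric]
        E.dg_one E'.dg_one eq ..
    finally show ?thesis using u unfolding E'.psd_dg by blast
  qed
  from this[of 1] this[of "-1"] show ?thesis by simp
qed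

text \<open>The same two positivity statements pass through the trace, which fixes the identity: a
  positive unital map is a contraction on Hermitian operators.\<close>

lemma eigenvalue_bound_condExp:
  assumes B: "eigenbasis D X B" and B': "eigenbasis D X B'"
    and eq: "condExp D L X (dg X B f) = dg X B' g" and f: "\<And>v. v \<in> B \<Longrightarrow> \<bar>f v\<bar> \<le> c" and u: "u \<in> B'"
  shows "\<bar>g u\<bar> \<le> c"
proof -
  interpret E: eigenbasis D X B by (rule B)
  interpret E': eigenbasis D X B' by (rule B')
  have "0 \<le> c * 1 + s * g u" if s: "s = 1 \<or> s = - 1" for s :: real
  proof -
    have "psd X (dg X B (\<lambda>v. c * 1 + s * f v))"
      unfolding E.psd_dg using f s by (fastforce simp: abs_le_iff)
    then have "psd (X \<inter> L) (condExp D L X (dg X B (\<lambda>v. c * 1 + s * f v)))"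
      by (rule psd_condExp[OF E.loc_in_dg E.finX])
    then have "psd X (condExp D L X (dg X B (\<lambda>v. c * 1 + s * f v)))"
      by (rule psd_mono[OF loc_in_condExp[OF E.loc_in_dg] _ E.finX, rotated]) simp
    also have "condExp D L X (dg X B (\<lambda>v. c * 1 + s * f v)) = dg X B' (\<lambda>v. c * 1 + s * g v)"
      unfolding E.dg_add[symmetric] E.dg_scale[symmetric] E'.dg_add[symmetric] E'.dg_scale[symmetric]
        E.dg_one E'.dg_one condExp_add condExp_scale condExp_gid[OF E.finX] eq ..
    finally show ?thesis using u unfolding E'.psd_dg by blast
  qed
  from this[of 1] this[of "-1"] show ?thesis by simp
qed

lemma opnorm_nonneg:
  assumes "finite X" "loc_in D X K" "herm K"
  shows "0 \<le> opnorm D X K"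
proof -
  obtain B f where "eigenbasis D X B" and K: "K = dg X B f"
    using exists_eigenbasis_single[OF assms] by blast
  then interpret eigenbasis D X B by simp
  obtain v where "v \<in> B" using B_nonempty by blast
  from dg_le_opnorm[OF this, of f] show ?thesis unfolding K by linarith
qed

lemma gexp_shift:
  assumes "finite X" "loc_in D X K" "herm K"
  shows "gexp D (\<lambda>\<sigma> \<tau>. of_real c * gid D \<sigma> \<tau> + K \<sigma> \<tau>) = (\<lambda>\<sigma> \<tau>. of_real (exp c) * gexp D K \<sigma> \<tau>)"
proof -
  obtain B f where "eigenbasis D X B" and K: "K = dg X B f"
    using exists_eigenbasis_single[OF assms] by blast
  then interpret eigenbasis D X B by simp
  have "(\<lambda>\<sigma> \<tau>. of_real c * gid D \<sigma> \<tau> + K \<sigma> \<tau>) = dg X B (\<lambda>v. c * 1 + f v)"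
    unfolding dg_add[symmetric] dg_scale[symmetric] dg_one K ..
  moreover have "(\<lambda>\<sigma> \<tau>. of_real (exp c) * gexp D K \<sigma> \<tau>) = dg X B (\<lambda>v. exp c * exp (f v))"
    unfolding K gexp_dg dg_scale ..
  ultimately show ?thesis by (simp add: gexp_dg exp_add)
qed

lemma gexp_zero: "gexp D (\<lambda>\<sigma> \<tau>. 0) = (gid D :: 'v op)"
proof -
  have "finite ({} :: 'v set)" "loc_in D {} (\<lambda>\<sigma> \<tau>. 0 :: complex)" "herm ((\<lambda>\<sigma> \<tau>. 0) :: 'v op)"
    by (simp_all add: loc_in_zero_op herm_zero)
  then obtain B f where "eigenbasis D {} B" and K: "(\<lambda>\<sigma> \<tau>. 0) = dg ({} :: 'v set) B f"
    using exists_eigenbasis_single by blast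
  then interpret eigenbasis D "{}" B by simp
  have "gexp D (dg {} B (\<lambda>v. 0)) = gid D" unfolding gexp_dg by (simp add: dg_one)
  then show ?thesis unfolding dg_zero .
qed

lemma gmult_add_left:
  assumes "finite X" "loc_in D X K" "loc_in D X K'" "loc_in D X M"
  shows "gmult (\<lambda>\<sigma> \<tau>. K \<sigma> \<tau> + K' \<sigma> \<tau>) M = (\<lambda>\<sigma> \<tau>. gmult K M \<sigma> \<tau> + gmult K' M \<sigma> \<tau>)"
  by (rule loc_in_eqI[of X])
    (use assms in \<open>simp_all add: gmult_cfgs loc_in_add loc_in_gmult distrib_right sum.distrib\<close>)

lemma gmult_add_right:
  assumes "finite X" "loc_in D X K" "loc_in D X M" "loc_in D X M'"
  shows "gmult K (\<lambda>\<sigma> \<tau>. M \<sigma> \<tau> + M' \<sigma> \<tau>) = (\<lambda>\<sigma> \<tau>. gmult K M \<sigma> \<tau> + gmult K M' \<sigma> \<tau>)"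
  by (rule loc_in_eqI[of X])
    (use assms in \<open>simp_all add: gmult_cfgs loc_in_add loc_in_gmult distrib_left sum.distrib\<close>)

lemma gmult_gid_right:
  assumes "finite X" "loc_in D X K"
  shows "gmult K (gid D) = K"
proof (rule loc_in_eqI[of X])
  fix \<sigma> \<tau> assume s: "\<sigma> \<in> cfgs D X" "\<tau> \<in> cfgs D X"
  have "gmult K (gid D) \<sigma> \<tau> = (\<Sum>\<rho>\<in>cfgs D X. if \<rho> = \<tau> then K \<sigma> \<tau> else 0)"
    unfolding gmult_cfgs[OF assms loc_in_gid s]
    by (intro sum.cong refl) (auto simp: gid_def valid_cfgs)
  then show "gmult K (gid D) \<sigma> \<tau> = K \<sigma> \<tau>" using s assms by (simp add: finite_cfgs)
qed (use assms in \<open>auto intro: loc_in_gmult loc_in_gid\<close>)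

lemma gmult_gid_left:
  assumes "finite X" "loc_in D X K"
  shows "gmult (gid D) K = K"
proof (rule loc_in_eqI[of X])
  fix \<sigma> \<tau> assume s: "\<sigma> \<in> cfgs D X" "\<tau> \<in> cfgs D X"
  have "gmult (gid D) K \<sigma> \<tau> = (\<Sum>\<rho>\<in>cfgs D X. if \<rho> = \<sigma> then K \<sigma> \<tau> else 0)"
    unfolding gmult_cfgs[OF assms(1) loc_in_gid assms(2) s]
    by (intro sum.cong refl) (auto simp: gid_def valid_cfgs)
  then show "gmult (gid D) K \<sigma> \<tau> = K \<sigma> \<tau>" using s assms by (simp add: finite_cfgs)
qed (use assms in \<open>auto intro: loc_in_gmult loc_in_gid\<close>)

text \<open>Entries of both products are finite sums over \<open>cfgs D X\<close>, hence continuous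
  in the entries of the factors.\<close>

lemma commute_limit:
  assumes X: "finite X" and loc: "\<And>n. loc_in D X (K n)" "\<And>n. loc_in D X (M n)" "loc_in D X K'" "loc_in D X M'"
    and lim: "\<And>\<sigma> \<tau>. (\<lambda>n. K n \<sigma> \<tau>) \<longlonglongrightarrow> K' \<sigma> \<tau>" "\<And>\<sigma> \<tau>. (\<lambda>n. M n \<sigma> \<tau>) \<longlonglongrightarrow> M' \<sigma> \<tau>"
    and comm: "\<And>n. gmult (K n) (M n) = gmult (M n) (K n)"
  shows "gmult K' M' = gmult M' K'"
proof (rule loc_in_eqI[of X])
  show "loc_in D X (gmult K' M')" "loc_in D X (gmult M' K')" using X loc by (auto intro: loc_in_gmult)
  fix \<sigma> \<tau> assume s: "\<sigma> \<in> cfgs D X" "\<tau> \<in> cfgs D X"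
  have "(\<lambda>n. gmult (K n) (M n) \<sigma> \<tau>) \<longlonglongrightarrow> gmult K' M' \<sigma> \<tau>"
    unfolding gmult_cfgs[OF X loc(1) loc(2) s] gmult_cfgs[OF X loc(3) loc(4) s]
    by (intro tendsto_intros lim)
  moreover have "(\<lambda>n. gmult (M n) (K n) \<sigma> \<tau>) \<longlonglongrightarrow> gmult M' K' \<sigma> \<tau>"
    unfolding gmult_cfgs[OF X loc(2) loc(1) s] gmult_cfgs[OF X loc(4) loc(3) s]
    by (intro tendsto_intros lim)
  ultimately show "gmult K' M' \<sigma> \<tau> = gmult M' K' \<sigma> \<tau>" unfolding comm by (rule LIMSEQ_unique)
qed

end

section \<open>Construction of the effective interaction and its exact identities\<close>

locale commuting_interaction = spin +
  fixes \<Phi> :: "'v set \<Rightarrow> 'v op" and \<beta> :: real and \<A> :: "'v op set"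
  assumes \<Phi>: "local_interaction D \<Phi>" and \<A>: "comm_algebra D \<A>"
    and \<Phi>_in: "\<And>X. finite X \<Longrightarrow> \<Phi> X \<in> \<A>"
    and condExp_in: "\<And>L X Q. Q \<in> \<A> \<Longrightarrow> finite X \<Longrightarrow> loc_in D X Q \<Longrightarrow> condExp D L X Q \<in> \<A>"
begin

definition a :: "'v set \<Rightarrow> 'v op" where
  "a X = (\<lambda>\<sigma> \<tau>. of_real (- \<beta>) * \<Phi> X \<sigma> \<tau>)"

definition A :: "'v set set \<Rightarrow> 'v op" where
  "A T = (\<lambda>\<sigma> \<tau>. \<Sum>X\<in>T. a X \<sigma> \<tau>)"

definition Z :: "'v set \<Rightarrow> 'v set set \<Rightarrow> 'v op" where
  "Z L T = condExp D L (\<Union>T) (gexp D (A T))"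

definition G :: "'v set \<Rightarrow> 'v set set \<Rightarrow> 'v op" where
  "G L T = glog D (Z L T)"

definition \<phi> :: "'v set \<Rightarrow> 'v set set \<Rightarrow> 'v op" where
  "\<phi> L T = (\<lambda>\<sigma> \<tau>. mob (\<lambda>U. G L U \<sigma> \<tau>) T)"

text \<open>The empty set is left out: its term is a scalar, factors out of every exponential and
  trace, and returns in \<open>F\<close> as \<open>a {}\<close>.\<close>

definition S :: "'v set \<Rightarrow> 'v set set" where
  "S X = {Y. Y \<subseteq> X \<and> Y \<noteq> {} \<and> \<Phi> Y \<noteq> zero_op}"

definition covers :: "'v set \<Rightarrow> 'v set set set" where
  "covers X = {T. T \<subseteq> S X \<and> \<Union>T = X}"

text \<open>For \<open>X = {}\<close> the only cover is the empty collection, whose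
  \<open>\<phi>\<close> is the logarithm of the identity, so just the scalar \<open>a {}\<close>
  remains.\<close>

definition F :: "'v set \<Rightarrow> 'v set \<Rightarrow> 'v op" where
  "F L X = (\<lambda>\<sigma> \<tau>. (if X = {} then a {} \<sigma> \<tau> else 0) + (\<Sum>T\<in>covers X. \<phi> L T \<sigma> \<tau>))"

lemma add_in: "K \<in> \<A> \<Longrightarrow> M \<in> \<A> \<Longrightarrow> (\<lambda>\<sigma> \<tau>. K \<sigma> \<tau> + M \<sigma> \<tau>) \<in> \<A>"
  using \<A> by (simp add: comm_algebra_def)

lemma mult_in: "K \<in> \<A> \<Longrightarrow> M \<in> \<A> \<Longrightarrow> gmult K M \<in> \<A>"
  using \<A> by (simp add: comm_algebra_def)

lemma scale_in: "K \<in> \<A> \<Longrightarrow> (\<lambda>\<sigma> \<tau>. c * K \<sigma> \<tau>) \<in> \<A>"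
  using \<A> by (simp add: comm_algebra_def)

lemma mult_commute_in: "K \<in> \<A> \<Longrightarrow> M \<in> \<A> \<Longrightarrow> gmult K M = gmult M K"
  using \<A> unfolding comm_algebra_def by blast

lemma loc_in_a: "finite X \<Longrightarrow> loc_in D X (a X)"
  using \<Phi> unfolding a_def local_interaction_def by (intro loc_in_scale) auto

lemma herm_a: "finite X \<Longrightarrow> herm (a X)"
  using \<Phi> unfolding a_def local_interaction_def by (intro herm_scale) auto

lemma a_in: "finite X \<Longrightarrow> a X \<in> \<A>"
  unfolding a_def by (intro scale_in \<Phi>_in)

lemma loc_in_A: "(\<And>X. X \<in> T \<Longrightarrow> finite X) \<Longrightarrow> \<Union>T \<subseteq> X \<Longrightarrow> loc_in D X (A T)"
  unfolding A_def by (intro loc_in_sum loc_in_mono[OF loc_in_a]) auto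

lemma herm_A: "(\<And>X. X \<in> T \<Longrightarrow> finite X) \<Longrightarrow> herm (A T)"
  unfolding A_def by (intro herm_sum herm_a) auto

lemma sum_in:
  assumes "finite J" "\<And>i. i \<in> J \<Longrightarrow> K i \<in> \<A>"
  shows "(\<lambda>\<sigma> \<tau>. \<Sum>i\<in>J. K i \<sigma> \<tau>) \<in> \<A>"
  using assms
proof (induction J rule: finite_induct)
  case empty
  then show ?case using \<A> by (simp add: comm_algebra_def zero_op_def)
next
  case (insert x J)
  then show ?case by (simp add: add_in)
qed

lemma A_in: "finite T \<Longrightarrow> (\<And>X. X \<in> T \<Longrightarrow> finite X) \<Longrightarrow> A T \<in> \<A>"
  unfolding A_def by (intro sum_in a_in) auto

lemma finite_S: "finite X \<Longrightarrow> finite (S X)"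
  unfolding S_def by (rule finite_subset[of _ "Pow X"]) auto

lemma finite_covers: "finite X \<Longrightarrow> finite (covers X)"
  unfolding covers_def by (rule finite_subset[of _ "Pow (S X)"]) (auto simp: finite_S)

lemma S_subset: "Y \<in> S X \<Longrightarrow> Y \<subseteq> X"
  by (simp add: S_def)

lemma S_mono: "X \<subseteq> Y \<Longrightarrow> S X \<subseteq> S Y"
  by (auto simp: S_def)

lemma S_collection:
  assumes "finite X" "T \<subseteq> S X"
  shows "finite T" "\<And>Y. Y \<in> T \<Longrightarrow> finite Y" "\<Union>T \<subseteq> X" "finite (\<Union>T)"
proof -
  show "finite T" by (rule finite_subset[OF assms(2) finite_S[OF assms(1)]])
  show "finite Y" if "Y \<in> T" for Y
    by (rule finite_subset[OF S_subset assms(1)]) (use assms(2) that in auto)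
  show 3: "\<Union>T \<subseteq> X" using assms(2) by (auto simp: S_def)
  show "finite (\<Union>T)" by (rule finite_subset[OF 3 assms(1)])
qed

lemma Z_eq:
  assumes "finite X" "\<And>Y. Y \<in> T \<Longrightarrow> finite Y" "\<Union>T \<subseteq> X"
  shows "condExp D L X (gexp D (A T)) = Z L T"
  unfolding Z_def
  by (rule condExp_local[OF loc_in_gexp[OF _ loc_in_A herm_A]])
    (use assms in \<open>auto intro: finite_subset\<close>)

lemma loc_in_Z:
  assumes "finite (\<Union>T)" "\<And>Y. Y \<in> T \<Longrightarrow> finite Y"
  shows "loc_in D (\<Union>T \<inter> L) (Z L T)"
  unfolding Z_def by (intro loc_in_condExp loc_in_gexp loc_in_A herm_A) (use assms in auto)

lemma herm_Z:
  assumes "finite (\<Union>T)" "\<And>Y. Y \<in> T \<Longrightarrow> finite Y"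
  shows "herm (Z L T)"
  unfolding Z_def by (rule herm_condExp, rule herm_gexp[of "\<Union>T"]) (use assms in \<open>auto intro: loc_in_A herm_A\<close>)

lemma Z_empty: "Z L {} = gid D"
  by (simp add: Z_def A_def gexp_zero condExp_gid)

text \<open>Existence of a Hermitian logarithm together with its uniqueness identifies the
  description operator in \<open>glog\<close>, and the witness brings locality in the untraced
  sites.\<close>

lemma G_props:
  assumes "finite (\<Union>T)" "\<And>Y. Y \<in> T \<Longrightarrow> finite Y"
  shows "loc_in D (\<Union>T \<inter> L) (G L T)" "herm (G L T)" "gexp D (G L T) = Z L T"
proof -
  have "loc_in D (\<Union>T) (A T)" "herm (A T)" using assms by (auto intro: loc_in_A herm_A)
  from exists_log_condExp[OF assms(1) this, of L] obtain H
    where H: "loc_in D (\<Union>T \<inter> L) H" "herm H" "gexp D H = Z L T" by (auto simp: Z_def)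
  then have "is_local D H" using assms(1) by (auto simp: is_local_def)
  then have "G L T = H" unfolding G_def using H by (intro glog_eq) auto
  with H show "loc_in D (\<Union>T \<inter> L) (G L T)" "herm (G L T)" "gexp D (G L T) = Z L T" by auto
qed

text \<open>The exponential of the sum splits because the two Hamiltonians lie in the commutative
  algebra; the trace of the product splits because the regions are disjoint.\<close>

lemma Z_union:
  assumes fin: "finite T" "finite T'" "\<And>Y. Y \<in> T \<union> T' \<Longrightarrow> finite Y" and d: "T \<inter> T' = {}" "\<Union>T \<inter> \<Union>T' = {}"
  shows "Z L (T \<union> T') = gmult (Z L T) (Z L T')"
proof -
  have f: "finite (\<Union>T)" "finite (\<Union>T')" using fin by auto
  have lT: "loc_in D (\<Union>T) (A T)" "loc_in D (\<Union>T') (A T')" "herm (A T)" "herm (A T')"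
    using fin by (auto intro: loc_in_A herm_A)
  have l: "loc_in D (\<Union>(T \<union> T')) (A T)" "loc_in D (\<Union>(T \<union> T')) (A T')"
    using fin by (auto intro!: loc_in_A)
  have "A (T \<union> T') = (\<lambda>\<sigma> \<tau>. A T \<sigma> \<tau> + A T' \<sigma> \<tau>)"
    unfolding A_def using fin d by (simp add: sum.union_disjoint)
  then have "gexp D (A (T \<union> T')) = gmult (gexp D (A T)) (gexp D (A T'))"
    using gexp_add[OF _ l(1) lT(3) l(2) lT(4)] mult_commute_in[OF A_in A_in] fin f by auto
  then have "Z L (T \<union> T') = condExp D L (\<Union>T \<union> \<Union>T') (gmult (gexp D (A T)) (gexp D (A T')))"
    by (simp add: Z_def Union_Un_distrib)
  also have "\<dots> = gmult (Z L T) (Z L T')"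
    unfolding Z_def by (rule condExp_gmult_disjoint[OF f d(2)]) (use lT f in \<open>auto intro: loc_in_gexp\<close>)
  finally show ?thesis .
qed

text \<open>The truncated exponential series without its constant term: \<open>comm_algebra\<close>
  does not provide the identity, so only positive powers of \<open>K\<close> are known to stay in
  the algebra.\<close>

definition P :: "'v op \<Rightarrow> nat \<Rightarrow> 'v op" where
  "P K n = (\<lambda>\<sigma> \<tau>. \<Sum>k<n. (1 / of_nat (fact (Suc k))) * gpow D K (Suc k) \<sigma> \<tau>)"

lemma gpow_in:
  assumes "finite X" "loc_in D X K" "K \<in> \<A>"
  shows "gpow D K (Suc k) \<in> \<A> \<and> loc_in D X (gpow D K (Suc k))"
proof (induction k)
  case 0
  then show ?case using assms by (simp add: gmult_gid_right)
next
  case (Suc k)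
  then have "gmult K (gpow D K (Suc k)) \<in> \<A>" using assms(3) mult_in by blast
  with Suc show ?case using assms by (auto intro: loc_in_gmult)
qed

lemma P_in:
  assumes "finite X" "loc_in D X K" "K \<in> \<A>"
  shows "P K n \<in> \<A>" "loc_in D X (P K n)"
proof -
  have "(\<lambda>\<sigma> \<tau>. (1 / of_nat (fact (Suc k))) * gpow D K (Suc k) \<sigma> \<tau>) \<in> \<A>" for k
    by (intro scale_in conjunct1[OF gpow_in[OF assms]])
  then show "P K n \<in> \<A>" unfolding P_def by (intro sum_in) auto
  show "loc_in D X (P K n)"
    unfolding P_def by (intro loc_in_sum loc_in_scale conjunct2[OF gpow_in[OF assms]])
qed

lemma P_tendsto:
  assumes "finite X" "loc_in D X K" "herm K"
  shows "(\<lambda>n. gid D \<sigma> \<tau> + P K n \<sigma> \<tau>) \<longlonglongrightarrow> gexp D K \<sigma> \<tau>"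
proof -
  have "(\<lambda>n. \<Sum>k<Suc n. gpow D K k \<sigma> \<tau> / of_nat (fact k)) \<longlonglongrightarrow> gexp D K \<sigma> \<tau>"
    using gexp_sums[OF assms, of \<sigma> \<tau>] unfolding sums_def by (rule LIMSEQ_Suc)
  moreover have "(\<Sum>k<Suc n. gpow D K k \<sigma> \<tau> / of_nat (fact k)) = gid D \<sigma> \<tau> + P K n \<sigma> \<tau>" for n
    unfolding sum.lessThan_Suc_shift P_def by simp
  ultimately show ?thesis by simp
qed

text \<open>The traces of the truncations \<open>P\<close> lie in the algebra and commute. Adding
  the identity preserves this, as does the limit, which is never claimed to lie in the
  algebra.\<close>

lemma Z_commute:
  assumes X: "finite X" and T: "T \<subseteq> S X" and T': "T' \<subseteq> S X"
  shows "gmult (Z L T) (Z L T') = gmult (Z L T') (Z L T)"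
proof -
  note s = S_collection[OF X T] and s' = S_collection[OF X T']
  let ?Q = "\<lambda>T n. condExp D L X (\<lambda>\<sigma> \<tau>. gid D \<sigma> \<tau> + P (A T) n \<sigma> \<tau>)"
  have Q: "?Q T n = (\<lambda>\<sigma> \<tau>. gid D \<sigma> \<tau> + condExp D L X (P (A T) n) \<sigma> \<tau>)" for T n
    by (simp add: condExp_add condExp_gid[OF X])
  have in_A: "A U \<in> \<A>" "loc_in D X (A U)" "herm (A U)" if "U \<subseteq> S X" for U
    using S_collection[OF X that] by (auto intro: A_in loc_in_A herm_A)
  have cP: "condExp D L X (P (A U) n) \<in> \<A>" "loc_in D X (condExp D L X (P (A U) n))" if "U \<subseteq> S X" for U n
    using P_in[OF X in_A(2) in_A(1), OF that that, of n] X condExp_in by (auto intro: loc_in_condExp')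
  have locQ: "loc_in D X (?Q U n)" if "U \<subseteq> S X" for U n
    unfolding Q by (intro loc_in_add loc_in_gid cP that)
  have lim: "(\<lambda>n. ?Q U n \<sigma> \<tau>) \<longlonglongrightarrow> Z L U \<sigma> \<tau>" if "U \<subseteq> S X" for U \<sigma> \<tau>
  proof -
    have e: "Z L U = condExp D L X (gexp D (A U))"
      by (rule sym, rule Z_eq[OF X]) (use S_collection[OF X that] in auto)
    show ?thesis unfolding e by (intro condExp_tendsto P_tendsto[OF X in_A(2,3)] that)
  qed
  have locZ: "loc_in D X (Z L U)" if "U \<subseteq> S X" for U
    by (rule loc_in_mono[OF loc_in_Z]) (use S_collection[OF X that] in auto)
  show ?thesis
  proof (rule commute_limit[OF X locQ[OF T] locQ[OF T'] locZ[OF T] locZ[OF T'] lim[OF T] lim[OF T']])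
    fix n
    let ?K = "condExp D L X (P (A T) n)" and ?M = "condExp D L X (P (A T') n)"
    have K: "loc_in D X ?K" and M: "loc_in D X ?M" using cP T T' by auto
    have comm: "gmult ?K ?M = gmult ?M ?K" using cP T T' by (intro mult_commute_in) auto
    have exp: "gmult (\<lambda>\<sigma> \<tau>. gid D \<sigma> \<tau> + K \<sigma> \<tau>) (\<lambda>\<sigma> \<tau>. gid D \<sigma> \<tau> + M \<sigma> \<tau>)
       = (\<lambda>\<sigma> \<tau>. gid D \<sigma> \<tau> + M \<sigma> \<tau> + (K \<sigma> \<tau> + gmult K M \<sigma> \<tau>))"
      if "loc_in D X K" "loc_in D X M" for K M
      using that X
      by (simp add: gmult_add_left[OF X loc_in_gid] gmult_add_right[OF X _ loc_in_gid] loc_in_add loc_in_gid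
          gmult_gid_left[OF X] gmult_gid_right[OF X])
    show "gmult (?Q T n) (?Q T' n) = gmult (?Q T' n) (?Q T n)"
      unfolding Q exp[OF K M] exp[OF M K] comm by (simp add: algebra_simps)
  qed
qed

lemma loc_in_F:
  assumes "finite X"
  shows "loc_in D (X \<inter> L) (F L X)"
proof -
  have G: "loc_in D (X \<inter> L) (G L U)" if "T \<in> covers X" "U \<subseteq> T" for T U
  proof -
    have U: "U \<subseteq> S X" using that by (auto simp: covers_def)
    show ?thesis
      by (rule loc_in_mono[OF G_props(1)]) (use S_collection[OF assms U] in auto)
  qed
  have "loc_in D (X \<inter> L) (\<lambda>\<sigma> \<tau>. if X = {} then a {} \<sigma> \<tau> else 0)"
    using loc_in_a[of "{}"] by (cases "X = {}") (simp_all add: loc_in_zero_op)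
  then show ?thesis
    unfolding F_def \<phi>_def by (intro loc_in_add loc_in_sum loc_in_mob G) auto
qed

lemma herm_F:
  assumes "finite X"
  shows "herm (F L X)"
proof -
  have G: "herm (G L U)" if "T \<in> covers X" "U \<subseteq> T" for T U
  proof -
    have U: "U \<subseteq> S X" using that by (auto simp: covers_def)
    show ?thesis by (rule G_props(2)) (use S_collection[OF assms U] in auto)
  qed
  have "herm (\<lambda>\<sigma> \<tau>. if X = {} then a {} \<sigma> \<tau> else 0)"
    using herm_a[of "{}"] by (cases "X = {}") (simp_all add: herm_zero)
  then show ?thesis
    unfolding F_def \<phi>_def by (intro herm_add herm_sum herm_mob G) auto
qed

text \<open>For collections inside \<open>X\<close>, the trace sees \<open>L\<close> only through
  the traced and the untraced sites of their union, and \<open>X \<inter> L\<close> determines both.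
  Equality then passes through \<open>glog\<close> without evaluating it.\<close>

lemma F_local:
  assumes "X \<inter> L' = X \<inter> L"
  shows "F L X = F L' X"
proof -
  have Z: "Z L U = Z L' U" if "\<Union>U \<subseteq> X" for U
  proof -
    have 1: "\<Union>U \<inter> L = \<Union>U \<inter> L'" and 2: "\<Union>U - L = \<Union>U - L'" using assms that by auto
    show ?thesis unfolding Z_def condExp_def 1 2 ..
  qed
  have "\<phi> L T = \<phi> L' T" if T: "T \<in> covers X" for T
    unfolding \<phi>_def
  proof (intro ext mob_cong)
    fix \<sigma> \<tau> U assume "U \<subseteq> T"
    then have "\<Union>U \<subseteq> X" using T by (auto simp: covers_def)
    then show "G L U \<sigma> \<tau> = G L' U \<sigma> \<tau>" unfolding G_def by (simp only: Z)
  qed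
  then show ?thesis by (simp add: F_def cong: sum.cong)
qed

text \<open>Collections are partitioned by their union. Summing \<open>F\<close> over subsets of
  \<open>X\<close> thereby becomes full Moebius inversion over \<open>Pow (S X)\<close>.\<close>

lemma sum_covers:
  assumes "finite X"
  shows "(\<Sum>Y\<in>Pow X. \<Sum>T\<in>covers Y. f T) = (\<Sum>T\<in>Pow (S X). f T)"
proof -
  have "(\<Sum>Y\<in>Pow X. \<Sum>T\<in>covers Y. f T) = (\<Sum>T\<in>(\<Union>Y\<in>Pow X. covers Y). f T)"
  proof (rule sum.UNION_disjoint[symmetric])
    show "\<forall>Y\<in>Pow X. finite (covers Y)"
      using assms by (auto intro: finite_covers finite_subset)
  qed (use assms in \<open>auto simp: covers_def\<close>)
  also have "(\<Union>Y\<in>Pow X. covers Y) = Pow (S X)"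
  proof (intro equalityI subsetI)
    fix T assume "T \<in> (\<Union>Y\<in>Pow X. covers Y)"
    then obtain Y where "Y \<subseteq> X" "T \<subseteq> S Y" by (auto simp: covers_def)
    then show "T \<in> Pow (S X)" using S_mono[of Y X] by simp
  next
    fix T assume T: "T \<in> Pow (S X)"
    have "\<Union>T \<in> Pow X" using S_collection(3)[OF assms, of T] T by simp
    moreover have "T \<in> covers (\<Union>T)" using T unfolding covers_def S_def by blast
    ultimately show "T \<in> (\<Union>Y\<in>Pow X. covers Y)" by (rule UN_I)
  qed
  finally show ?thesis .
qed

lemma Ham_F:
  assumes "finite X"
  shows "Ham (F L) X = (\<lambda>\<sigma> \<tau>. a {} \<sigma> \<tau> + G L (S X) \<sigma> \<tau>)"
proof (intro ext)
  fix \<sigma> \<tau>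
  have "Ham (F L) X \<sigma> \<tau> = (\<Sum>Y\<in>Pow X. if Y = {} then a {} \<sigma> \<tau> else 0) + (\<Sum>T\<in>Pow (S X). \<phi> L T \<sigma> \<tau>)"
    by (simp add: Ham_def F_def sum.distrib sum_covers[OF assms])
  also have "(\<Sum>T\<in>Pow (S X). \<phi> L T \<sigma> \<tau>) = G L (S X) \<sigma> \<tau>"
    unfolding \<phi>_def by (rule sum_mob[OF finite_S[OF assms]])
  also have "(\<Sum>Y\<in>Pow X. if Y = {} then a {} \<sigma> \<tau> else 0) = a {} \<sigma> \<tau>"
    using assms by (simp add: sum.delta')
  finally show "Ham (F L) X \<sigma> \<tau> = a {} \<sigma> \<tau> + G L (S X) \<sigma> \<tau>" .
qed

lemma scale_Ham:
  assumes "finite X"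
  shows "(\<lambda>\<sigma> \<tau>. complex_of_real (- \<beta>) * Ham \<Phi> X \<sigma> \<tau>) = (\<lambda>\<sigma> \<tau>. a {} \<sigma> \<tau> + A (S X) \<sigma> \<tau>)"
proof (intro ext)
  fix \<sigma> \<tau>
  have "complex_of_real (- \<beta>) * Ham \<Phi> X \<sigma> \<tau> = (\<Sum>Y\<in>Pow X. a Y \<sigma> \<tau>)"
    by (simp only: Ham_def a_def sum_distrib_left)
  also have "\<dots> = (\<Sum>Y\<in>insert {} (S X). a Y \<sigma> \<tau>)"
    using assms by (intro sum.mono_neutral_right) (auto simp: S_def a_def zero_op_def)
  also have "\<dots> = a {} \<sigma> \<tau> + A (S X) \<sigma> \<tau>"
    unfolding A_def using finite_S[OF assms] by (subst sum.insert) (auto simp: S_def)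
  finally show "complex_of_real (- \<beta>) * Ham \<Phi> X \<sigma> \<tau> = a {} \<sigma> \<tau> + A (S X) \<sigma> \<tau>" .
qed

text \<open>An operator on no sites has a single free entry, and Hermiticity makes it real.\<close>

lemma a_empty: "\<exists>c. a {} = (\<lambda>\<sigma> \<tau>. of_real c * gid D \<sigma> \<tau>)"
proof -
  define k where "k = a {} (\<lambda>_. 0) (\<lambda>_. 0)"
  have "k = cnj k" using herm_a[of "{}"] unfolding herm_def k_def by blast
  then have k: "k = of_real (Re k)" by (metis Reals_cnj_iff of_real_Re)
  have "a {} \<sigma> \<tau> = of_real (Re k) * gid D \<sigma> \<tau>" for \<sigma> \<tau>
  proof (cases "valid D \<sigma> \<and> \<sigma> = \<tau>")
    case True
    have "r0 {} \<sigma> = (\<lambda>_. 0)" for \<sigma> :: "'v cfg" by (simp add: r0_def)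
    then have "a {} \<sigma> \<tau> = k"
      unfolding k_def using loc_in_r0[OF loc_in_a[of "{}"], of \<sigma> \<tau>] True by auto
    moreover have "gid D \<sigma> \<tau> = 1" using True by (auto simp: gid_def)
    ultimately show ?thesis using k by simp
  next
    case False
    then have "a {} \<sigma> \<tau> = 0" by (intro loc_in_off[OF loc_in_a[of "{}"]]) auto
    then show ?thesis using False by (auto simp: gid_def)
  qed
  then show ?thesis by blast
qed

text \<open>The scalar part contributes the factor \<open>exp c\<close> on both sides, since the
  trace is linear. What remains is \<open>G_props\<close> for the full collection
  \<open>S X\<close>, and uniqueness of the logarithm concludes.\<close>

lemma glog_Ham:
  assumes X: "finite X"
  shows "glog D (condExp D L X (gexp D (\<lambda>\<sigma> \<tau>. complex_of_real (- \<beta>) * Ham \<Phi> X \<sigma> \<tau>))) = Ham (F L) X"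
proof -
  note s = S_collection[OF X subset_refl]
  obtain c where c: "a {} = (\<lambda>\<sigma> \<tau>. of_real c * gid D \<sigma> \<tau>)" using a_empty by blast
  have AS: "loc_in D X (A (S X))" "herm (A (S X))" using s by (auto intro: loc_in_A herm_A)
  have G: "loc_in D (\<Union>(S X) \<inter> L) (G L (S X))" "herm (G L (S X))" "gexp D (G L (S X)) = Z L (S X)"
    using s by (auto intro!: G_props)
  have GX: "loc_in D X (G L (S X))" by (rule loc_in_mono[OF G(1)]) (use s in auto)
  have Zeq: "condExp D L X (gexp D (A (S X))) = Z L (S X)"
    by (rule Z_eq[OF X]) (use s in auto)
  have "condExp D L X (gexp D (\<lambda>\<sigma> \<tau>. complex_of_real (- \<beta>) * Ham \<Phi> X \<sigma> \<tau>)) = (\<lambda>\<sigma> \<tau>. of_real (exp c) * Z L (S X) \<sigma> \<tau>)"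
    unfolding scale_Ham[OF X] c gexp_shift[OF X AS] condExp_scale Zeq ..
  also have "\<dots> = gexp D (Ham (F L) X)"
    unfolding Ham_F[OF X] c gexp_shift[OF X GX G(2)] G(3) ..
  finally have e: "condExp D L X (gexp D (\<lambda>\<sigma> \<tau>. complex_of_real (- \<beta>) * Ham \<Phi> X \<sigma> \<tau>)) = gexp D (Ham (F L) X)" .
  have "loc_in D X (Ham (F L) X)" "herm (Ham (F L) X)"
    unfolding Ham_F[OF X] by (auto intro!: loc_in_add herm_add GX G(2) herm_a loc_in_mono[OF loc_in_a[of "{}"]])
  then show ?thesis unfolding e using X by (intro glog_eq) (auto simp: is_local_def)
qed

end

section \<open>The norm estimate\<close>

lemma sum_UN_le:
  fixes f :: "'b \<Rightarrow> real"
  assumes "finite I" "\<And>i. i \<in> I \<Longrightarrow> finite (A i)" "\<And>x. 0 \<le> f x"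
  shows "(\<Sum>x\<in>(\<Union>i\<in>I. A i). f x) \<le> (\<Sum>i\<in>I. \<Sum>x\<in>A i. f x)"
  using assms(1,2)
proof (induction I rule: finite_induct)
  case (insert i I)
  have "sum f (A i \<union> (\<Union>i\<in>I. A i)) + sum f (A i \<inter> (\<Union>i\<in>I. A i)) = sum f (A i) + sum f (\<Union>i\<in>I. A i)"
    using insert by (intro sum.union_inter) auto
  moreover have "0 \<le> sum f (A i \<inter> (\<Union>i\<in>I. A i))" by (intro sum_nonneg assms(3))
  ultimately show ?case using insert by simp
qed simp

text \<open>The temperature condition stands in product form, so that \<open>d = 0\<close> or a
  vanishing norm is no special case.\<close>

locale high_temperature = commuting_interaction D \<Phi> \<beta> \<A>
  for D :: nat and \<Phi> :: "'v set \<Rightarrow> 'v op" and \<beta> :: real and \<A> :: "'v op set" +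
  fixes b :: "'v set \<Rightarrow> real" and d :: nat
  assumes b_nonneg: "\<And>X. finite X \<Longrightarrow> 0 \<le> b X" and subadd: "subadditive b"
    and bnorm_finite: "bnorm D b \<Phi> < \<infinity>" and deg: "finite_degree \<Phi> d"
    and small: "\<bar>\<beta>\<bar> * (real d * (1 + real d) * exp 2 * enn2real (bnorm D b \<Phi>)) < 1"
begin

definition t :: real where
  "t = \<bar>\<beta>\<bar> * enn2real (bnorm D b \<Phi>)"

text \<open>Nothing is assumed about \<open>b\<close> on infinite sets and \<open>d = 0\<close> is allowed; the absolute value and the
  maxima below make the positivity requirements of the cluster estimate hold unconditionally.\<close>

definition \<alpha> :: "'v set \<Rightarrow> real" where
  "\<alpha> X = \<bar>\<beta> * opnorm D X (\<Phi> X)\<bar>"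

definition w :: "'v set \<Rightarrow> real" where
  "w X = max 1 (exp (b X))"

definition \<theta> :: "'v set \<Rightarrow> real" where
  "\<theta> X = exp (\<alpha> X) - 1"

definition \<epsilon> :: real where
  "\<epsilon> = 1 / real (max 1 d)"

lemma loc_in_\<Phi>: "finite X \<Longrightarrow> loc_in D X (\<Phi> X)" and herm_\<Phi>: "finite X \<Longrightarrow> herm (\<Phi> X)"
  using \<Phi> by (simp_all add: local_interaction_def)

lemma opnorm_\<Phi>_nonneg: "finite X \<Longrightarrow> 0 \<le> opnorm D X (\<Phi> X)"
  by (simp add: opnorm_nonneg loc_in_\<Phi> herm_\<Phi>)

lemma w_finite: "finite X \<Longrightarrow> w X = exp (b X)"
  using b_nonneg[of X] by (simp add: w_def)

lemma w_ge_1: "1 \<le> w X"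
  by (simp add: w_def)

lemma alpha_nonneg: "0 \<le> \<alpha> X"
  by (simp add: \<alpha>_def)

lemma theta_nonneg: "0 \<le> \<theta> X"
  using alpha_nonneg[of X] by (simp add: \<theta>_def)

text \<open>The extended sum is the supremum of its finite subsums, and finiteness of
  \<open>bnorm\<close> lets \<open>enn2real\<close> carry the inequality to the reals.\<close>

lemma sum_alpha_w:
  assumes "finite J" "\<And>X. X \<in> J \<Longrightarrow> finite X \<and> x \<in> X"
  shows "(\<Sum>X\<in>J. \<alpha> X * w X) \<le> t"
proof -
  let ?f = "\<lambda>X. opnorm D X (\<Phi> X) * exp (b X)"
  have "ennreal (\<Sum>X\<in>J. ?f X) = (\<Sum>X\<in>J. ennreal (?f X))"
    using assms opnorm_\<Phi>_nonneg by (subst sum_ennreal) auto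
  also have "\<dots> \<le> (\<Sum>\<^sub>\<infinity>X\<in>{X. finite X \<and> x \<in> X}. ennreal (?f X))"
    by (subst nonneg_infsum_complete) (use assms in \<open>auto intro!: SUP_upper\<close>)
  also have "\<dots> \<le> bnorm D b \<Phi>"
    unfolding bnorm_def by (rule SUP_upper) simp
  finally have "enn2real (ennreal (\<Sum>X\<in>J. ?f X)) \<le> enn2real (bnorm D b \<Phi>)"
    using bnorm_finite by (intro enn2real_mono) auto
  moreover have "0 \<le> (\<Sum>X\<in>J. ?f X)"
    using assms opnorm_\<Phi>_nonneg by (intro sum_nonneg) auto
  ultimately have "\<bar>\<beta>\<bar> * (\<Sum>X\<in>J. ?f X) \<le> t"
    unfolding t_def by (intro mult_left_mono) auto
  moreover have "(\<Sum>X\<in>J. \<alpha> X * w X) = \<bar>\<beta>\<bar> * (\<Sum>X\<in>J. ?f X)"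
    unfolding sum_distrib_left using assms opnorm_\<Phi>_nonneg
    by (intro sum.cong refl) (auto simp: \<alpha>_def w_finite abs_mult)
  ultimately show ?thesis by simp
qed

lemma t_nonneg: "0 \<le> t"
  by (simp add: t_def)

text \<open>Members of \<open>S X\<close> are nonempty, so \<open>finite_degree\<close> counts
  \<open>Y\<close> among its own neighbours. This saves one neighbour and forces
  \<open>1 \<le> d\<close> as soon as a member exists.\<close>

lemma S_degree:
  assumes "finite X" "Y \<in> S X"
  shows "card {Y' \<in> S X. Y' \<noteq> Y \<and> Y \<inter> Y' \<noteq> {}} \<le> d - 1" "1 \<le> d"
proof -
  let ?N = "{Y' \<in> interaction_support \<Phi>. Y' \<inter> Y \<noteq> {}}"
  let ?M = "{Y' \<in> S X. Y' \<noteq> Y \<and> Y \<inter> Y' \<noteq> {}}"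
  have supp: "S X \<subseteq> interaction_support \<Phi>"
    using assms(1) by (auto simp: S_def interaction_support_def intro: finite_subset)
  then have N: "finite ?N" "card ?N \<le> d"
    using deg assms(2) unfolding finite_degree_def by blast+
  have Y: "Y \<in> ?N" using supp assms(2) by (auto simp: S_def)
  have "card (insert Y ?M) \<le> card ?N"
    using Y supp by (intro card_mono N) auto
  moreover have "card (insert Y ?M) = Suc (card ?M)"
    using finite_S[OF assms(1)] by (intro card_insert_disjoint) auto
  ultimately show "card ?M \<le> d - 1" "1 \<le> d" using N(2) by linarith+
qed

text \<open>The quadratic Taylor bound e \<ge> 5/2 gives 25/4 for exp 2, and
  \<open>d * (1 + d) \<ge> 2\<close> turns the condition into the absolute bound 2/25.\<close>

lemma t_bound:
  assumes "1 \<le> d"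
  shows "25 / 4 * t * (real d * (1 + real d)) \<le> 1" "t \<le> 2 / 25"
proof -
  have "(5/2)\<^sup>2 \<le> (exp 1 :: real)\<^sup>2"
    using exp_lower_Taylor_quadratic[of "1::real"] by (intro power_mono) auto
  also have "(exp 1 :: real)\<^sup>2 = exp 2" by (simp add: exp_double[of 1, simplified, symmetric])
  finally have e: "25 / 4 \<le> (exp 2 :: real)" by (simp add: power2_eq_square)
  have "25 / 4 * (t * (real d * (1 + real d))) \<le> exp 2 * (t * (real d * (1 + real d)))"
    using t_nonneg e by (intro mult_right_mono) auto
  also have "\<dots> \<le> 1" using small by (simp add: t_def algebra_simps)
  finally show 1: "25 / 4 * t * (real d * (1 + real d)) \<le> 1" by (simp add: mult.assoc)
  have "1 * 2 \<le> real d * (1 + real d)" using assms by (intro mult_mono) auto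
  then have "25 / 4 * t * 2 \<le> 25 / 4 * t * (real d * (1 + real d))"
    using t_nonneg by (intro mult_left_mono) auto
  then have "25 / 4 * t * 2 \<le> 1" using 1 by (rule order_trans)
  then show "t \<le> 2 / 25" by simp
qed

text \<open>From \<open>\<alpha> Y \<le> 2 / 25\<close> follows
  \<open>\<theta> Y \<le> 27 / 25 * \<alpha> Y\<close>, and \<open>(1 + 1 / d)^(d - 1)\<close> is at
  most e \<le> 2.72; the product of both constants is below 3. The second bound amounts to
  \<open>3 * t \<le> 1 / (2 * d + 1)\<close>, the value of
  \<open>\<epsilon> / (2 + \<epsilon>)\<close> at \<open>\<epsilon> = 1 / d\<close>.\<close>

lemma w_theta_bound:
  assumes X: "finite X" and Y: "Y \<in> S X"
  shows "w Y * \<theta> Y * (1 + \<epsilon>) ^ (d - 1) \<le> 3 * (\<alpha> Y * w Y)"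
    and "w Y * \<theta> Y * (1 + \<epsilon>) ^ (d - 1) \<le> \<epsilon> / (2 + \<epsilon>)" and "\<epsilon> \<le> 1"
proof -
  have d: "1 \<le> d" using S_degree[OF assms] by simp
  have \<epsilon>: "\<epsilon> = 1 / real d" using d by (simp add: \<epsilon>_def max_absorb2)
  show "\<epsilon> \<le> 1" using d by (simp add: \<epsilon>)
  obtain x where "x \<in> Y" using Y by (auto simp: S_def)
  moreover have "finite Y" using X Y S_subset finite_subset by blast
  ultimately have aw: "\<alpha> Y * w Y \<le> t" using sum_alpha_w[of "{Y}" x] by simp
  have "\<alpha> Y * 1 \<le> \<alpha> Y * w Y" by (intro mult_left_mono w_ge_1 alpha_nonneg)
  with aw have at: "\<alpha> Y \<le> 2 / 25" using t_bound[OF d] by simp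
  have "\<theta> Y \<le> \<alpha> Y + (\<alpha> Y)\<^sup>2"
    using exp_bound[of "\<alpha> Y"] alpha_nonneg[of Y] at by (simp add: \<theta>_def)
  also have "\<dots> = \<alpha> Y * (1 + \<alpha> Y)" by (simp add: power2_eq_square algebra_simps)
  also have "\<dots> \<le> \<alpha> Y * (27 / 25)" using at alpha_nonneg[of Y] by (intro mult_left_mono) auto
  finally have \<theta>: "\<theta> Y \<le> \<alpha> Y * (27 / 25)" .
  have "(1 + \<epsilon>) ^ (d - 1) \<le> exp \<epsilon> ^ (d - 1)"
    using d by (intro power_mono) (auto simp: \<epsilon>)
  also have "\<dots> = exp (real (d - 1) * \<epsilon>)" by (simp add: exp_of_nat_mult)
  also have "\<dots> \<le> exp 1" using d by (simp add: \<epsilon> field_simps)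
  also have "\<dots> \<le> 2.72" using e_less_272 by simp
  finally have p: "(1 + \<epsilon>) ^ (d - 1) \<le> 2.72" .
  have "w Y * \<theta> Y * (1 + \<epsilon>) ^ (d - 1) \<le> w Y * (\<alpha> Y * (27 / 25)) * 2.72"
    using w_ge_1[of Y] alpha_nonneg[of Y] theta_nonneg[of Y] \<epsilon> d
    by (intro mult_mono p \<theta> order_refl) auto
  also have "\<dots> \<le> 3 * (\<alpha> Y * w Y)"
    using mult_nonneg_nonneg[of "\<alpha> Y" "w Y"] w_ge_1[of Y] alpha_nonneg[of Y] by simp
  finally show 1: "w Y * \<theta> Y * (1 + \<epsilon>) ^ (d - 1) \<le> 3 * (\<alpha> Y * w Y)" .
  have "3 * t * (2 * real d + 1) \<le> 25 / 4 * t * (real d * (1 + real d))"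
  proof -
    have "3 * (2 * y + 1) \<le> 25 / 4 * (y * (1 + y))" if "1 \<le> y" for y :: real
    proof -
      \<comment> \<open>The square is abstracted to a variable \<open>q\<close> so that the
        inequality to be decided is linear.\<close>
      have lin: "3 * (2 * y + 1) \<le> 25 / 4 * y + 25 / 4 * q" if "y \<le> q" for q
        using that \<open>1 \<le> y\<close> by simp
      have "y \<le> y * y" using mult_left_mono[of 1 y y] \<open>1 \<le> y\<close> by simp
      then have "3 * (2 * y + 1) \<le> 25 / 4 * y + 25 / 4 * (y * y)" by (rule lin)
      also have "\<dots> = 25 / 4 * (y * (1 + y))" by (simp add: algebra_simps)
      finally show ?thesis .
    qed
    from this[of "real d"] have "3 * (2 * real d + 1) \<le> 25 / 4 * (real d * (1 + real d))"
      using d by simp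
    from mult_left_mono[OF this t_nonneg] show ?thesis by (simp add: algebra_simps)
  qed
  also have "\<dots> \<le> 1" by (rule t_bound[OF d])
  finally have "3 * t \<le> 1 / (2 * real d + 1)" using d by (simp add: field_simps)
  also have "\<dots> = \<epsilon> / (2 + \<epsilon>)" using d by (simp add: \<epsilon> field_simps)
  finally show "w Y * \<theta> Y * (1 + \<epsilon>) ^ (d - 1) \<le> \<epsilon> / (2 + \<epsilon>)" using 1 aw by linarith
qed

lemma eigenvalue_a_bound:
  assumes B: "eigenbasis D X B" and Y: "Y \<subseteq> X" and eq: "a Y = dg X B l" and u: "u \<in> B"
  shows "\<bar>l u\<bar> \<le> \<alpha> Y"
proof -
  interpret E: eigenbasis D X B by (rule B)
  have fY: "finite Y" using Y E.finX finite_subset by blast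
  obtain B' f where B': "eigenbasis D Y B'" and f: "\<Phi> Y = dg Y B' f"
    using exists_eigenbasis_single[OF fY loc_in_\<Phi>[OF fY] herm_\<Phi>[OF fY]] by blast
  interpret E': eigenbasis D Y B' by (rule B')
  show ?thesis
  proof (rule eigenvalue_bound_mono[OF B' B Y _ _ u])
    show "dg Y B' (\<lambda>v. (- \<beta>) * f v) = dg X B l"
      unfolding eq[symmetric] a_def f E'.dg_scale[symmetric] ..
    fix v assume "v \<in> B'"
    then have "\<bar>f v\<bar> \<le> opnorm D Y (\<Phi> Y)" unfolding f by (rule E'.dg_le_opnorm)
    then show "\<bar>(- \<beta>) * f v\<bar> \<le> \<alpha> Y"
      by (simp add: \<alpha>_def abs_mult mult_left_mono)
  qed
qed

text \<open>Two eigenbases are at work: \<open>B\<close> diagonalises the traced operators,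
  \<open>B2\<close> the interaction terms. The estimate on \<open>z\<close> originates in
  \<open>B2\<close> and is carried to \<open>B\<close> by positivity of the trace.\<close>

lemma cluster_exists:
  assumes X: "finite X"
  shows "\<exists>B z. eigenbasis D X B \<and> (\<forall>T\<subseteq>S X. Z L T = dg X B (z T)) \<and>
     cluster B w (S X) (\<lambda>Y Y'. Y \<inter> Y' \<noteq> {}) z \<theta> (d - 1) \<epsilon>"
proof -
  have locZ: "loc_in D X (Z L T)" "herm (Z L T)" if "T \<subseteq> S X" for T
    using S_collection[OF X that] by (auto intro!: loc_in_mono[OF loc_in_Z] herm_Z)
  have "\<exists>B ev. eigenbasis D X B \<and> (\<forall>K\<in>Z L ` Pow (S X). K = dg X B (ev K))"
    by (rule exists_eigenbasis[OF X]) (use finite_S[OF X] locZ Z_commute[OF X] in auto)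
  then obtain B ev where B: "eigenbasis D X B" and ev: "\<And>T. T \<subseteq> S X \<Longrightarrow> Z L T = dg X B (ev (Z L T))"
    by blast
  interpret E: eigenbasis D X B by (rule B)
  define z where "z = (\<lambda>T. ev (Z L T))"
  have Zz: "Z L T = dg X B (z T)" if "T \<subseteq> S X" for T using ev[OF that] by (simp add: z_def)
  have fin_S: "finite Y" "Y \<subseteq> X" if "Y \<in> S X" for Y
    using that S_subset[of Y X] X by (auto intro: finite_subset)
  have "\<exists>B ev. eigenbasis D X B \<and> (\<forall>K\<in>a ` S X. K = dg X B (ev K))"
    by (rule exists_eigenbasis[OF X])
      (use finite_S[OF X] fin_S in \<open>auto intro!: loc_in_mono[OF loc_in_a] herm_a mult_commute_in a_in\<close>)
  then obtain B2 ev2 where B2: "eigenbasis D X B2" and ev2: "\<And>Y. Y \<in> S X \<Longrightarrow> a Y = dg X B2 (ev2 (a Y))"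
    by blast
  interpret E2: eigenbasis D X B2 by (rule B2)
  define l where "l = (\<lambda>Y. ev2 (a Y))"
  have al: "a Y = dg X B2 (l Y)" if "Y \<in> S X" for Y using ev2[OF that] by (simp add: l_def)
  have expA: "gexp D (A T) = dg X B2 (\<lambda>u. \<Prod>Y\<in>T. exp (l Y u))" if T: "T \<subseteq> S X" for T
  proof -
    have "A T = (\<lambda>\<sigma> \<tau>. \<Sum>Y\<in>T. dg X B2 (l Y) \<sigma> \<tau>)"
      unfolding A_def using T al by (intro ext sum.cong refl) auto
    also have "\<dots> = dg X B2 (\<lambda>u. \<Sum>Y\<in>T. l Y u)" by (rule E2.dg_sum)
    finally show ?thesis
      using S_collection(1)[OF X T] by (simp add: E2.gexp_dg exp_sum)
  qed
  have "cluster B w (S X) (\<lambda>Y Y'. Y \<inter> Y' \<noteq> {}) z \<theta> (d - 1) \<epsilon>"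
  proof (intro cluster.intro weighted.intro cluster_axioms.intro)
    show "finite B" by (rule E.finB)
    show "1 \<le> w Y" for Y by (rule w_ge_1)
    show "finite (S X)" by (rule finite_S[OF X])
    show "z {} v = 1" if "v \<in> B" for v
    proof -
      have "dg X B (z {}) = dg X B (\<lambda>_. 1)" using Zz[of "{}"] by (simp add: Z_empty E.dg_one)
      then show ?thesis using that by (rule E.dg_inj)
    qed
    show "z (T \<union> T') v = z T v * z T' v"
      if "T \<subseteq> S X" "T' \<subseteq> S X" "T \<inter> T' = {}" "\<And>Y Y'. Y \<in> T \<Longrightarrow> Y' \<in> T' \<Longrightarrow> \<not> Y \<inter> Y' \<noteq> {}" "v \<in> B" for T T' v
    proof -
      have "Z L (T \<union> T') = gmult (Z L T) (Z L T')"
      proof (rule Z_union)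
        show "\<Union>T \<inter> \<Union>T' = {}" using that(4) by blast
      qed (use S_collection[OF X that(1)] S_collection[OF X that(2)] that(3) in auto)
      then have "dg X B (z (T \<union> T')) = dg X B (\<lambda>v. z T v * z T' v)"
        using Zz[of T] Zz[of T'] Zz[of "T \<union> T'"] that by (simp add: E.gmult_dg)
      then show ?thesis using that(5) by (rule E.dg_inj)
    qed
    show "snorm B (\<lambda>v. mob (\<lambda>V. z V v) T) \<le> (\<Prod>Y\<in>T. \<theta> Y)" if T: "T \<subseteq> S X" for T
    proof -
      interpret weighted B w by unfold_locales (auto simp: E.finB w_ge_1)
      have finT: "finite T" by (rule S_collection(1)[OF X T])
      let ?g = "\<lambda>u. \<Prod>Y\<in>T. exp (l Y u) - 1"
      have "dg X B (\<lambda>v. mob (\<lambda>V. z V v) T) = (\<lambda>\<sigma> \<tau>. mob (\<lambda>V. dg X B (z V) \<sigma> \<tau>) T)"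
        by (rule E.dg_mob[symmetric])
      also have "\<dots> = (\<lambda>\<sigma> \<tau>. mob (\<lambda>V. condExp D L X (dg X B2 (\<lambda>u. \<Prod>Y\<in>V. exp (l Y u))) \<sigma> \<tau>) T)"
      proof (intro ext mob_cong)
        fix \<sigma> \<tau> V assume "V \<subseteq> T"
        then have V: "V \<subseteq> S X" using T by simp
        have "condExp D L X (gexp D (A V)) = Z L V"
          by (rule Z_eq[OF X]) (use S_collection[OF X V] in auto)
        then show "dg X B (z V) \<sigma> \<tau> = condExp D L X (dg X B2 (\<lambda>u. \<Prod>Y\<in>V. exp (l Y u))) \<sigma> \<tau>"
          unfolding expA[OF V] Zz[OF V] by simp
      qed
      \<comment> \<open>By linearity the Moebius sum moves inside the trace, where
        \<open>mob_prod\<close> turns it into the product of the factors exp - 1.\<close>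
      also have "\<dots> = condExp D L X (dg X B2 ?g)"
        unfolding condExp_mob[symmetric] E2.dg_mob mob_prod[OF finT] ..
      finally have eq: "condExp D L X (dg X B2 ?g) = dg X B (\<lambda>v. mob (\<lambda>V. z V v) T)" by simp
      have g: "\<bar>?g u\<bar> \<le> (\<Prod>Y\<in>T. \<theta> Y)" if u: "u \<in> B2" for u
        unfolding abs_prod
      proof (intro prod_mono conjI abs_ge_zero)
        fix Y assume "Y \<in> T"
        then have Y: "Y \<in> S X" using T by auto
        have "\<bar>exp (l Y u) - 1\<bar> \<le> exp \<bar>l Y u\<bar> - 1"
        proof (cases "0 \<le> l Y u")
          case False
          \<comment> \<open>For a negative exponent x the claim reads 1 - exp x \<le> exp (- x) -
            1.\<close>
          have "2 \<le> exp (l Y u) + exp (- l Y u)"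
            using exp_ge_add_one_self[of "l Y u"] exp_ge_add_one_self[of "- l Y u"] by linarith
          then show ?thesis using False by simp
        qed simp
        also have "\<dots> \<le> \<theta> Y"
          using eigenvalue_a_bound[OF B2 fin_S(2)[OF Y] al[OF Y] u] by (simp add: \<theta>_def)
        finally show "\<bar>exp (l Y u) - 1\<bar> \<le> \<theta> Y" .
      qed
      show ?thesis
        by (rule snorm_least)
          (use theta_nonneg eigenvalue_bound_condExp[OF B2 B eq g] in \<open>auto intro: prod_nonneg\<close>)
    qed
    show "card {Y' \<in> S X. Y' \<noteq> Y \<and> Y \<inter> Y' \<noteq> {}} \<le> d - 1" if "Y \<in> S X" for Y
      by (rule S_degree(1)[OF X that])
    show "0 \<le> \<theta> Y" for Y by (rule theta_nonneg)
    show "0 < \<epsilon>" by (simp add: \<epsilon>_def)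
    show "w Y * \<theta> Y * (1 + \<epsilon>) ^ (d - 1) \<le> \<epsilon> / (2 + \<epsilon>)" if "Y \<in> S X" for Y
      by (rule w_theta_bound(2)[OF X that])
  qed
  then show ?thesis using B Zz by blast
qed

text \<open>Subadditivity makes the weight of a union at most the product of the weights.
  Nonemptiness matters, as \<open>b {}\<close> may be positive while the empty product is 1.\<close>

lemma exp_b_Union:
  assumes "finite T" "T \<noteq> {}" "\<And>Y. Y \<in> T \<Longrightarrow> finite Y"
  shows "exp (b (\<Union>T)) \<le> (\<Prod>Y\<in>T. w Y)"
  using assms
proof (induction T rule: finite_ne_induct)
  case (singleton Y)
  then show ?case by (simp add: w_finite)
next
  case (insert Y T)
  have "b (Y \<union> \<Union>T) \<le> b Y + b (\<Union>T)"
    using subadd insert by (auto simp: subadditive_def)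
  then have "exp (b (\<Union>(insert Y T))) \<le> exp (b Y) * exp (b (\<Union>T))"
    by (simp add: exp_add[symmetric])
  also have "\<dots> \<le> w Y * (\<Prod>Y\<in>T. w Y)"
    using insert by (intro mult_mono) (auto simp: w_finite)
  finally show ?case using insert by simp
qed

text \<open>A collection covering a set through \<open>x\<close> has a member through
  \<open>x\<close>. Summing over that member reduces the claim to \<open>mob_ln_bound\<close> at
  each such member and to the one-point bound on \<open>\<alpha> * w\<close>.\<close>

lemma sum_F_bound:
  assumes J: "finite J" "\<And>Y. Y \<in> J \<Longrightarrow> finite Y \<and> x \<in> Y"
  shows "(\<Sum>Y\<in>J. opnorm D Y (F L Y) * exp (b Y)) \<le> 1"
proof -
  \<comment> \<open>One finite region contains all of \<open>J\<close>, so a single eigenbasis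
    serves every term; the resulting bound does not depend on \<open>X\<close>.\<close>
  define X where "X = \<Union>J"
  have X: "finite X" using J by (simp add: X_def)
  obtain B z where B: "eigenbasis D X B" and Zz: "\<And>T. T \<subseteq> S X \<Longrightarrow> Z L T = dg X B (z T)"
    and cl: "cluster B w (S X) (\<lambda>Y Y'. Y \<inter> Y' \<noteq> {}) z \<theta> (d - 1) \<epsilon>"
    using cluster_exists[OF X, of L] by blast
  interpret E: eigenbasis D X B by (rule B)
  interpret cl: cluster B w "S X" "\<lambda>Y Y'. Y \<inter> Y' \<noteq> {}" z \<theta> "d - 1" \<epsilon> by (rule cl)
  have Gz: "G L T = dg X B (\<lambda>v. ln (z T v))" if T: "T \<subseteq> S X" for T
    unfolding G_def
  proof (rule glog_eq)
    show "is_local D (dg X B (\<lambda>v. ln (z T v)))" using E.loc_in_dg X by (auto simp: is_local_def)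
    show "herm (dg X B (\<lambda>v. ln (z T v)))" by (rule E.herm_dg)
    show "gexp D (dg X B (\<lambda>v. ln (z T v))) = Z L T"
      unfolding E.gexp_dg Zz[OF T] using cl.z_pos[OF T] by (intro E.dg_cong) simp
  qed
  let ?h = "\<lambda>T v. mob (\<lambda>V. ln (z V v)) T"
  let ?s = "\<lambda>T. snorm B (?h T) * (\<Prod>Y\<in>T. w Y)"
  have s0: "0 \<le> ?s T" for T
    using cl.snorm_nonneg cl.prod_w_ge1[of T] by (intro mult_nonneg_nonneg) auto
  have \<phi>h: "\<phi> L T = dg X B (?h T)" if T: "T \<subseteq> S X" for T
  proof -
    have "\<phi> L T = (\<lambda>\<sigma> \<tau>. mob (\<lambda>V. dg X B (\<lambda>v. ln (z V v)) \<sigma> \<tau>) T)"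
      unfolding \<phi>_def using T Gz by (intro ext mob_cong) (metis order_trans)
    then show ?thesis by (simp only: E.dg_mob)
  qed
  have F_term: "opnorm D Y (F L Y) * exp (b Y) \<le> (\<Sum>T\<in>covers Y. ?s T)" if Y: "Y \<in> J" for Y
  proof -
    \<comment> \<open>Containing \<open>x\<close> makes \<open>Y\<close> nonempty, which removes the
      scalar term from \<open>F L Y\<close>.\<close>
    have fY: "finite Y" and ne: "Y \<noteq> {}" and YX: "Y \<subseteq> X" using J(2)[OF Y] Y by (auto simp: X_def)
    have cov: "T \<subseteq> S X" if "T \<in> covers Y" for T using that S_mono[OF YX] by (auto simp: covers_def)
    have "F L Y = (\<lambda>\<sigma> \<tau>. \<Sum>T\<in>covers Y. dg X B (?h T) \<sigma> \<tau>)"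
      unfolding F_def using ne cov \<phi>h by (intro ext) (auto intro!: sum.cong)
    also have "\<dots> = dg X B (\<lambda>v. \<Sum>T\<in>covers Y. ?h T v)" by (rule E.dg_sum)
    finally have Fd: "F L Y = dg X B (\<lambda>v. \<Sum>T\<in>covers Y. ?h T v)" .
    have "opnorm D Y (F L Y) \<le> opnorm D X (F L Y)"
      by (rule opnorm_mono[OF YX X]) (simp_all add: Fd E.loc_in_dg E.herm_dg)
    also have "\<dots> \<le> (\<Sum>T\<in>covers Y. snorm B (?h T))"
      unfolding Fd
    proof (rule E.opnorm_dg_le)
      show "0 \<le> (\<Sum>T\<in>covers Y. snorm B (?h T))" by (intro sum_nonneg cl.snorm_nonneg)
      fix v assume v: "v \<in> B"
      show "\<bar>\<Sum>T\<in>covers Y. ?h T v\<bar> \<le> (\<Sum>T\<in>covers Y. snorm B (?h T))"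
        using cl.snorm_upper[OF v, of "?h _"] by (intro order_trans[OF sum_abs] sum_mono) auto
    qed
    finally have "opnorm D Y (F L Y) * exp (b Y) \<le> (\<Sum>T\<in>covers Y. snorm B (?h T)) * exp (b Y)"
      by (intro mult_right_mono) auto
    also have "\<dots> \<le> (\<Sum>T\<in>covers Y. ?s T)"
      unfolding sum_distrib_right
    proof (intro sum_mono mult_left_mono cl.snorm_nonneg)
      fix T assume T: "T \<in> covers Y"
      then have "Y = \<Union>T" "T \<noteq> {}" using ne by (auto simp: covers_def)
      then show "exp (b Y) \<le> (\<Prod>Y\<in>T. w Y)"
        using S_collection[OF X cov[OF T]] by (auto intro: exp_b_Union)
    qed
    finally show ?thesis .
  qed
  have finc: "finite (covers Y)" if "Y \<in> J" for Y using J(2)[OF that] finite_covers by blast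
  have "(\<Sum>Y\<in>J. opnorm D Y (F L Y) * exp (b Y)) \<le> (\<Sum>Y\<in>J. \<Sum>T\<in>covers Y. ?s T)"
    by (intro sum_mono F_term)
  also have "\<dots> = (\<Sum>T\<in>(\<Union>Y\<in>J. covers Y). ?s T)"
    by (rule sum.UNION_disjoint[symmetric]) (use J finc in \<open>auto simp: covers_def\<close>)
  \<comment> \<open>The index set is enlarged from covers of members of \<open>J\<close> to all
    collections with a member through \<open>x\<close>; the subsequent union bound may count a
    collection several times, which nonnegative terms permit.\<close>
  also have "\<dots> \<le> (\<Sum>T\<in>(\<Union>Y\<in>{Y \<in> S X. x \<in> Y}. {T. T \<subseteq> S X \<and> Y \<in> T}). ?s T)"
  proof (rule sum_mono2[OF _ _ s0])
    show "finite (\<Union>Y\<in>{Y \<in> S X. x \<in> Y}. {T. T \<subseteq> S X \<and> Y \<in> T})"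
      by (rule finite_subset[of _ "Pow (S X)"]) (auto simp: finite_S[OF X])
    show "(\<Union>Y\<in>J. covers Y) \<subseteq> (\<Union>Y\<in>{Y \<in> S X. x \<in> Y}. {T. T \<subseteq> S X \<and> Y \<in> T})"
    proof
      fix T assume "T \<in> (\<Union>Y\<in>J. covers Y)"
      then obtain Y where Y: "Y \<in> J" "T \<subseteq> S Y" "\<Union>T = Y" by (auto simp: covers_def)
      have "Y \<subseteq> X" using Y(1) by (auto simp: X_def)
      then have "T \<subseteq> S X" using Y(2) S_mono[of Y X] by blast
      moreover obtain W where "W \<in> T" "x \<in> W" using Y J(2)[of Y] by blast
      ultimately show "T \<in> (\<Union>Y\<in>{Y \<in> S X. x \<in> Y}. {T. T \<subseteq> S X \<and> Y \<in> T})" by blast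
    qed
  qed
  also have "\<dots> \<le> (\<Sum>Y | Y \<in> S X \<and> x \<in> Y. \<Sum>T | T \<subseteq> S X \<and> Y \<in> T. ?s T)"
    by (rule sum_UN_le) (use finite_S[OF X] s0 in auto)
  \<comment> \<open>The constant is 3 from \<open>w_theta_bound\<close> times 3/2 from
    \<open>1 + \<epsilon> / 2\<close> with \<open>\<epsilon> \<le> 1\<close>.\<close>
  also have "\<dots> \<le> (\<Sum>Y | Y \<in> S X \<and> x \<in> Y. 9/2 * (\<alpha> Y * w Y))"
  proof (rule sum_mono)
    fix Y assume "Y \<in> {Y \<in> S X. x \<in> Y}"
    then have Y: "Y \<in> S X" by simp
    note bd = w_theta_bound[OF X Y]
    have "(\<Sum>T | T \<subseteq> S X \<and> Y \<in> T. ?s T) \<le> (w Y * \<theta> Y * (1 + \<epsilon>) ^ (d - 1)) * (1 + \<epsilon> / 2)"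
      by (rule cl.mob_ln_bound[OF Y])
    also have "\<dots> \<le> (3 * (\<alpha> Y * w Y)) * (3/2)"
      by (rule mult_mono[OF bd(1)]) (use bd(3) alpha_nonneg[of Y] w_ge_1[of Y] cl.eps_pos in auto)
    finally show "(\<Sum>T | T \<subseteq> S X \<and> Y \<in> T. ?s T) \<le> 9/2 * (\<alpha> Y * w Y)" by simp
  qed
  also have "\<dots> = 9/2 * (\<Sum>Y | Y \<in> S X \<and> x \<in> Y. \<alpha> Y * w Y)" by (simp add: sum_distrib_left)
  also have "\<dots> \<le> 1"
  \<comment> \<open>The bound on \<open>t\<close> requires \<open>1 \<le> d\<close>, which any
    member through \<open>x\<close> provides; without members the sum is empty. Numerically 9/2 *
    2/25 = 9/25.\<close>
  proof (cases "{Y. Y \<in> S X \<and> x \<in> Y} = {}")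
    case False
    then obtain Y where "Y \<in> S X" by blast
    then have "t \<le> 2 / 25" using S_degree(2)[OF X] t_bound(2) by blast
    moreover have "(\<Sum>Y | Y \<in> S X \<and> x \<in> Y. \<alpha> Y * w Y) \<le> t"
      using finite_S[OF X] S_collection(2)[OF X subset_refl] by (intro sum_alpha_w) auto
    ultimately show ?thesis by simp
  next
    case True
    show ?thesis unfolding True by simp
  qed
  finally show ?thesis .
qed

text \<open>An infinite sum of nonnegative extended reals is bounded as soon as all finite subsums
  are, so the estimate for finite \<open>J\<close> suffices.\<close>

lemma bnorm_F: "bnorm D b (F L) \<le> 1"
  unfolding bnorm_def
proof (rule SUP_least)
  fix x
  show "(\<Sum>\<^sub>\<infinity>X\<in>{X. finite X \<and> x \<in> X}. ennreal (opnorm D X (F L X) * exp (b X))) \<le> 1"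
  proof (rule infsum_le_finite_sums[OF nonneg_summable_on_complete])
    fix J assume J: "finite J" "J \<subseteq> {X. finite X \<and> x \<in> X}"
    have "0 \<le> opnorm D Y (F L Y)" if "Y \<in> J" for Y
      using J that by (intro opnorm_nonneg loc_in_mono[OF loc_in_F] herm_F) auto
    then have "(\<Sum>Y\<in>J. ennreal (opnorm D Y (F L Y) * exp (b Y))) = ennreal (\<Sum>Y\<in>J. opnorm D Y (F L Y) * exp (b Y))"
      by (intro sum_ennreal) auto
    also have "\<dots> \<le> ennreal 1" by (intro ennreal_leI sum_F_bound[of J x]) (use J in auto)
    finally show "(\<Sum>Y\<in>J. ennreal (opnorm D Y (F L Y) * exp (b Y))) \<le> 1" by simp
  qed simp
qed

end

theorem theorem3p8:
  fixes D :: nat and \<Phi> :: "'v set \<Rightarrow> 'v op" and b :: "'v set \<Rightarrow> real"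
    and d :: nat and \<beta> :: real
  assumes "0 < D"
    and "local_interaction D \<Phi>"
    and "commuting_hyp D \<Phi>"
    and "\<forall>X. finite X \<longrightarrow> 0 \<le> b X"
    and "subadditive b"
    and "bnorm D b \<Phi> < \<infinity>"
    and "finite_degree \<Phi> d"
    and "\<bar>\<beta>\<bar> * (real d * (1 + real d) * exp 2 * enn2real (bnorm D b \<Phi>)) < 1"
  shows "\<exists>F :: 'v set \<Rightarrow> 'v set \<Rightarrow> 'v op.
     (\<forall>L. local_interaction D (F L)
        \<and> (\<forall>X. finite X \<longrightarrow> loc_in D (X \<inter> L) (F L X))
        \<and> (\<forall>\<Lambda>. finite \<Lambda> \<longrightarrow>
             glog D (condExp D L \<Lambda> (gexp D (\<lambda>\<sigma> \<tau>. complex_of_real (- \<beta>) * Ham \<Phi> \<Lambda> \<sigma> \<tau>)))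
             = Ham (F L) \<Lambda>)
        \<and> bnorm D b (F L) \<le> 1)
   \<and> (\<forall>L L' X. finite X \<longrightarrow> X \<inter> L' = X \<inter> L \<longrightarrow> F L X = F L' X)"
proof -
  obtain \<A> where A: "comm_algebra D \<A>" "\<And>X. finite X \<Longrightarrow> \<Phi> X \<in> \<A>"
    "\<And>L \<Lambda> Q. Q \<in> \<A> \<Longrightarrow> finite \<Lambda> \<Longrightarrow> loc_in D \<Lambda> Q \<Longrightarrow> condExp D L \<Lambda> Q \<in> \<A>"
    using assms(3) unfolding commuting_hyp_def by blast
  interpret high_temperature D \<Phi> \<beta> \<A> b d
    by unfold_locales (use assms A in auto)
  have "local_interaction D (F L)" for L
    unfolding local_interaction_def
    by (intro allI impI conjI herm_F loc_in_mono[OF loc_in_F]) auto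
  then show ?thesis
    using loc_in_F glog_Ham bnorm_F F_local by (intro exI[of _ F]) blast
qed

end
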